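(* For each positive integer $n$ let $X_n$ be the random variable `size' on the set of $(2n+1,2n+3)$-core partitions with distinct parts, equipped with the uniform distribution. Then the skewness of $X_n$ satisfies $$ \lim_{n\to\infty}\frac{\mathbb{E}\big[(X_n-\mathbb{E}[X_n])^3\big]}{\mathrm{Var}(X_n)^{3/2}}=\frac{396793}{390815488}\,\sqrt{467}\,\sqrt{7680}. $$
   Context: A partition is a non-increasing finite sequence $\lambda=(\lambda_1,\dots,\lambda_k)$, $k\ge 0$, of positive integers (the empty partition is allowed); its size is $\lambda_1+\dots+\lambda_k$, and it has distinct parts if the $\lambda_i$ are pairwise distinct. The hook length of a cell $(i,j)$, $1\le j\le\lambda_i$, of its Ferrers (Young) diagram is $\lambda_i-i+\lambda'_j-j+1$, where $\lambda'$ is the conjugate partition. A partition is an $(s,t)$-core partition if none of its hook lengths equals $s$ and none equals $t$. For $s=2n+1$, $t=2n+3$ (relatively prime) the set of $(s,t)$-core partitions is finite. *)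

theory Defs
  imports "HOL-Probability.Probability"
begin

text \<open>
  A partition \<open>\<lambda>\<close> is the list of its parts. Rows and columns of the diagram
  are numbered from 1 (so the \<open>i\<close>-th part is \<open>\<lambda> ! (i - 1)\<close>).
\<close>

definition is_partition :: "nat list \<Rightarrow> bool" where
  "is_partition l \<longleftrightarrow> sorted_wrt (\<ge>) l \<and> (\<forall>p\<in>set l. 0 < p)"

definition part :: "nat list \<Rightarrow> nat \<Rightarrow> nat" where
  "part l i = l ! (i - 1)"

definition cells :: "nat list \<Rightarrow> (nat \<times> nat) set" where
  "cells l = {(i, j). 1 \<le> i \<and> i \<le> length l \<and> 1 \<le> j \<and> j \<le> part l i}"

text \<open>The \<open>j\<close>-th part of the conjugate partition, i.e. the length of column \<open>j\<close>:\<close>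

definition conj_part :: "nat list \<Rightarrow> nat \<Rightarrow> nat" where
  "conj_part l j = card {i. (i, j) \<in> cells l}"

text \<open>Integer-valued, because some partial sums may be negative.\<close>

definition hook_length :: "nat list \<Rightarrow> nat \<Rightarrow> nat \<Rightarrow> int" where
  "hook_length l i j =
     int (part l i) - int i + int (conj_part l j) - int j + 1"

definition is_core :: "nat \<Rightarrow> nat \<Rightarrow> nat list \<Rightarrow> bool" where
  "is_core s t l \<longleftrightarrow>
     (\<forall>(i, j)\<in>cells l. hook_length l i j \<noteq> int s \<and> hook_length l i j \<noteq> int t)"

definition distinct_cores :: "nat \<Rightarrow> nat \<Rightarrow> nat list set" where
  "distinct_cores s t = {l. is_partition l \<and> distinct l \<and> is_core s t l}"

definition psize :: "nat list \<Rightarrow> real" where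
  "psize l = real (sum_list l)"

definition skewness :: "'a pmf \<Rightarrow> ('a \<Rightarrow> real) \<Rightarrow> real" where
  "skewness M X =
     measure_pmf.expectation M (\<lambda>x. (X x - measure_pmf.expectation M X) ^ 3)
       / measure_pmf.variance M X powr (3 / 2)"

end

theory Submission
  imports Defs
    "HOL-Computational_Algebra.Formal_Power_Series"
    "HOL-Computational_Algebra.Polynomial"
    "HOL-Real_Asymp.Real_Asymp"
begin

text \<open>
  The proof reduces the size of a random core partition to an additive functional of a simple random walk whose moments are found from an algebraic generating function.

  A partition is encoded by the set of its beads (the hook lengths in the first column). It is a core if and only if its bead set is closed under subtracting \<open>s\<close> and \<open>t\<close>, and its
  parts are distinct if and only if no two beads are consecutive (\<open>is_core_iff_beads\<close>, \<open>distinct_iff_beads\<close>). For \<open>s = 2 * n + 1\<close> and \<open>t = s + 2\<close> the beads are put on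
  an abacus with \<open>s\<close> runners. Closure under \<open>s\<close> says that only the numbers of beads per runner matter, closure under \<open>t\<close> says that these numbers grow by at most
  one from runner to runner in the order \<open>2, 4, \<dots>, 2 * n, 1, 3, \<dots>\<close> (two from \<open>2 * n\<close> to \<open>1\<close>), and the absence of consecutive beads says that neighbouring runners are not both occupied. Counting even
  runners positively and odd runners negatively, one obtains a list of \<open>n\<close> nonzero integers with a closing condition (\<open>abacus_bij\<close>).

  Such a list consists of the positions that a walk with steps \<open>1\<close> and \<open>- 1\<close> reaches by moving away from 0. Hence the cores correspond to all \<open>4 ^ n\<close> walks of length \<open>2 * n\<close>
  (\<open>outward_bij\<close>, \<open>close_walk_bij\<close>). If a walk is started at minus half of its displacement, and \<open>A\<close> and \<open>S\<close> are the sums of the squares and of the absolute values of its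
  positions, the size is \<open>n * A / 2 - S\<^sup>2 / 8\<close> up to terms of lower order (\<open>core_size_estimate\<close>).

  The joint moments of \<open>S\<close> and \<open>A\<close> come from the generating function of paths from \<open>- h\<close> to \<open>h\<close>, weighted by \<open>exp (\<sigma> * S + \<alpha> * A)\<close>. Rotation turns such a path into an
  excursion with a marked point followed by further excursions, so that the generating function is essentially a logarithmic derivative (\<open>loop_series_eq\<close>). The coefficients of \<open>\<sigma> ^ j * \<alpha> ^ k\<close> are
  Laurent polynomials in \<open>\<delta> = sqrt (1 - 4 x\<^sup>2)\<close>, and only their leading terms matter: in the variable \<open>h * \<delta>\<close> the recursion between excursions above consecutive heights becomes the Riccati
  equation of an anharmonic oscillator, whose polynomial solutions are computed explicitly (\<open>arch_moments_lead\<close>, \<open>loop_mom_lead\<close>, \<open>profile_eq\<close>). Extracting coefficients (\<open>lead_coeff_asymp\<close>)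
  yields \<open>5 / 16\<close>, \<open>1217 / 7680\<close> and \<open>1601353 / 13762560\<close> as the limits of the first three moments of the size divided by \<open>n ^ 3\<close>, and these give the stated value.
\<close>

section \<open>Partitions as bead sets\<close>

text \<open>
  The bead of a row is the hook length of its first cell (its beta-number).
\<close>

definition bead :: "nat list \<Rightarrow> nat \<Rightarrow> nat" where
  "bead l i = l ! i + (length l - 1 - i)"

definition beads :: "nat list \<Rightarrow> nat set" where
  "beads l = bead l ` {..<length l}"

lemma partition_antimono: "is_partition l \<Longrightarrow> i \<le> j \<Longrightarrow> j < length l \<Longrightarrow> l ! j \<le> l ! i"
  unfolding is_partition_def by (cases "i = j") (auto simp: sorted_wrt_iff_nth_less)

lemma bead_strict_decreasing:
  assumes "is_partition l" "i < j" "j < length l"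
  shows "bead l j < bead l i"
  using partition_antimono[of l i j] assms by (simp add: bead_def)

lemma inj_on_bead: "is_partition l \<Longrightarrow> inj_on (bead l) {..<length l}"
  by (intro inj_onI) (metis bead_strict_decreasing lessThan_iff nat_neq_iff)

lemma card_beads: "is_partition l \<Longrightarrow> card (beads l) = length l"
  by (simp add: beads_def card_image inj_on_bead)

lemma sum_beads:
  assumes "is_partition l"
  shows "\<Sum>(beads l) = sum_list l + \<Sum>{..<length l}"
proof -
  have "\<Sum>(beads l) = (\<Sum>i<length l. l ! i + (length l - 1 - i))"
    unfolding beads_def sum.reindex[OF inj_on_bead[OF assms]] by (simp add: bead_def)
  also have "\<dots> = (\<Sum>i<length l. l ! i) + (\<Sum>i<length l. length l - 1 - i)"
    by (rule sum.distrib)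
  also have "\<dots> = sum_list l + (\<Sum>i<length l. length l - Suc i)"
    by (simp add: sum_list_sum_nth atLeast0LessThan)
  also have "(\<Sum>i<length l. length l - Suc i) = \<Sum>{..<length l}"
    by (rule sum.nat_diff_reindex)
  finally show ?thesis .
qed

lemma sorted_list_of_beads:
  assumes "is_partition l"
  shows "rev (sorted_list_of_set (beads l)) = map (bead l) [0..<length l]"
proof -
  let ?xs = "rev (map (bead l) [0..<length l])"
  have "sorted_wrt (>) (map (bead l) [0..<length l])"
    using bead_strict_decreasing[OF assms] by (auto simp: sorted_wrt_iff_nth_less)
  then have "sorted_wrt (<) ?xs" by (simp add: sorted_wrt_rev)
  then have "sorted ?xs" "distinct ?xs" by (auto simp: strict_sorted_iff)
  moreover have "set ?xs = beads l" by (simp add: beads_def atLeast0LessThan)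
  ultimately show ?thesis using sorted_list_of_set.idem_if_sorted_distinct[of ?xs] by simp
qed

text \<open>
  A row is recovered from its bead by subtracting the number of smaller beads; the bead 0 is excluded because parts are positive.
\<close>

lemma beads_bij: "bij_betw beads {l. is_partition l} {B. finite B \<and> 0 \<notin> B}"
proof (rule bij_betw_byWitness)
  let ?g = "\<lambda>B. map (\<lambda>i. rev (sorted_list_of_set B) ! i - (card B - 1 - i)) [0..<card (B :: nat set)]"
  show "\<forall>l\<in>{l. is_partition l}. ?g (beads l) = l"
    by (auto simp: sorted_list_of_beads card_beads bead_def intro!: nth_equalityI)
  show "beads ` {l. is_partition l} \<subseteq> {B. finite B \<and> 0 \<notin> B}"
  proof clarify
    fix l assume l: "is_partition l"
    have "0 < bead l i" if "i < length l" for i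
      using l nth_mem[OF that] by (simp add: bead_def is_partition_def)
    then show "finite (beads l) \<and> 0 \<notin> beads l" by (force simp: beads_def)
  qed
  have inverse: "is_partition (?g B) \<and> beads (?g B) = B" if B: "finite B" "0 \<notin> B" for B
  proof -
    let ?xs = "rev (sorted_list_of_set B)" let ?k = "card B"
    have len: "length ?xs = ?k" by simp
    have set: "set ?xs = B" using B by simp
    have "sorted_wrt (>) ?xs" using strict_sorted_list_of_set[of B] by (simp add: sorted_wrt_rev)
    then have dec: "?xs ! j < ?xs ! i" if "i < j" "j < ?k" for i j
      using that len by (metis sorted_wrt_iff_nth_less)
    have pos: "0 < ?xs ! i" if "i < ?k" for i
      using that B set len by (metis gr0I nth_mem)
    have low: "?k - i \<le> ?xs ! i" if "i < ?k" for i
      using that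
    proof (induction "?k - i" arbitrary: i)
      case (Suc d)
      show ?case
      proof (cases "Suc i < ?k")
        case True
        then have "?k - Suc i \<le> ?xs ! Suc i" using Suc.hyps Suc.prems by auto
        then show ?thesis using dec[of i "Suc i"] True by auto
      next
        case False
        then show ?thesis using pos[of i] Suc.prems by auto
      qed
    qed simp
    have gap: "?xs ! j + (j - i) \<le> ?xs ! i" if "i \<le> j" "j < ?k" for i j
      using that
    proof (induction "j - i" arbitrary: i)
      case (Suc d)
      then have "?xs ! j + (j - Suc i) \<le> ?xs ! Suc i" by auto
      moreover have "?xs ! Suc i < ?xs ! i" using Suc dec[of i "Suc i"] by auto
      ultimately show ?case using Suc.hyps(2) by linarith
    qed simp
    have part: "is_partition (?g B)"
      unfolding is_partition_def
    proof
      show "sorted_wrt (\<ge>) (?g B)"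
        unfolding sorted_wrt_iff_nth_less
      proof (intro allI impI)
        fix i j assume "i < j" "j < length (?g B)"
        then show "?g B ! i \<ge> ?g B ! j" using gap[of i j] by (simp add: less_imp_le_nat)
      qed
      show "\<forall>p\<in>set (?g B). 0 < p"
      proof
        fix p assume "p \<in> set (?g B)"
        then obtain i where "i < ?k" "p = ?xs ! i - (?k - 1 - i)" by auto
        then show "0 < p" using low[of i] by linarith
      qed
    qed
    have "bead (?g B) i = ?xs ! i" if "i < ?k" for i
      using low[OF that] that by (simp add: bead_def)
    then have "beads (?g B) = (!) ?xs ` {..<?k}"
      by (auto simp: beads_def)
    also have "\<dots> = B" using set len by (metis atLeast0LessThan list.set_map map_nth set_upt)
    finally show ?thesis using part by simp
  qed
  show "\<forall>B\<in>{B. finite B \<and> 0 \<notin> B}. beads (?g B) = B" "?g ` {B. finite B \<and> 0 \<notin> B} \<subseteq> {l. is_partition l}"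
    using inverse by auto
qed

text \<open>
  Equal parts may be assumed to lie in adjacent rows, and there equality means that the beads differ by one.
\<close>

lemma distinct_iff_beads:
  assumes l: "is_partition l"
  shows "distinct l \<longleftrightarrow> (\<forall>x\<in>beads l. Suc x \<notin> beads l)"
proof
  assume d: "distinct l"
  show "\<forall>x\<in>beads l. Suc x \<notin> beads l"
  proof (intro ballI notI)
    fix x assume "x \<in> beads l" "Suc x \<in> beads l"
    then obtain i j where ij: "i < length l" "j < length l" "bead l j = x" "bead l i = Suc x"
      by (auto simp: beads_def)
    then have "i < j" using bead_strict_decreasing[OF l, of j i] by (metis lessI less_asym nat_neq_iff n_not_Suc_n)
    moreover have "l ! j \<noteq> l ! i" using d ij \<open>i < j\<close> by (simp add: nth_eq_iff_index_eq)
    ultimately show False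
      using partition_antimono[OF l, of i j] ij by (auto simp: bead_def)
  qed
next
  assume b: "\<forall>x\<in>beads l. Suc x \<notin> beads l"
  have "l ! i \<noteq> l ! j" if "i < j" "j < length l" for i j
  proof
    assume "l ! i = l ! j"
    then have "l ! i = l ! Suc i"
      using partition_antimono[OF l, of i "Suc i"] partition_antimono[OF l, of "Suc i" j] that by auto
    then have "bead l i = Suc (bead l (Suc i))" using that by (auto simp: bead_def)
    moreover have "bead l i \<in> beads l" "bead l (Suc i) \<in> beads l" using that by (auto simp: beads_def)
    ultimately show False using b by metis
  qed
  then show "distinct l" by (metis distinct_conv_nth nat_neq_iff)
qed

lemma downset_eq_lessThan:
  fixes S :: "nat set"
  assumes "finite S" "\<And>x y. x \<in> S \<Longrightarrow> y < x \<Longrightarrow> y \<in> S"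
  shows "S = {..<card S}"
proof (cases "S = {}")
  case False
  then have "Max S \<in> S" using assms(1) by simp
  then have "S = {..Max S}"
    using assms by (auto intro: Max_ge) (metis le_neq_implies_less)
  then show ?thesis by (metis card_atMost lessThan_Suc_atMost)
qed simp

lemma conj_part_iff:
  assumes l: "is_partition l" and j: "1 \<le> j"
  shows "conj_part l j \<le> length l" and "i < length l \<Longrightarrow> i < conj_part l j \<longleftrightarrow> j \<le> l ! i"
proof -
  let ?S = "{i. i < length l \<and> j \<le> l ! i}"
  have "{i. (i, j) \<in> cells l} = Suc ` ?S"
  proof (intro equalityI subsetI)
    fix i assume "i \<in> {i. (i, j) \<in> cells l}"
    then have "i = Suc (i - 1)" "i - 1 \<in> ?S" by (auto simp: cells_def part_def)
    then show "i \<in> Suc ` ?S" by blast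
  qed (use j in \<open>auto simp: cells_def part_def\<close>)
  then have c: "conj_part l j = card ?S" by (simp add: conj_part_def card_image)
  have S: "?S = {..<card ?S}"
    by (rule downset_eq_lessThan) (auto intro: order_trans[OF _ partition_antimono[OF l]])
  then show "i < length l \<Longrightarrow> i < conj_part l j \<longleftrightarrow> j \<le> l ! i"
    unfolding c by (metis (mono_tags, lifting) lessThan_iff mem_Collect_eq)
  show "conj_part l j \<le> length l"
    unfolding c using card_mono[of "{..<length l}" ?S] by auto
qed

text \<open>
  The hook lengths in the row with bead \<open>b\<close> are the differences \<open>b - y\<close> for the gaps \<open>y < b\<close>, that is, for the numbers \<open>y\<close> that
  are not beads. With \<open>k\<close> rows, the cell in column \<open>j\<close> belongs to the gap \<open>y = j - 1 + (k - \<lambda>'\<^sub>j)\<close>, where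
  \<open>k - \<lambda>'\<^sub>j\<close> beads lie below \<open>y\<close>.
\<close>

lemma hook_iff_beads:
  assumes l: "is_partition l" and i: "i < length l" and h: "1 \<le> h"
  shows "(\<exists>j. (Suc i, j) \<in> cells l \<and> hook_length l (Suc i) j = int h)
    \<longleftrightarrow> h \<le> bead l i \<and> bead l i - h \<notin> beads l"
proof
  let ?k = "length l"
  assume "\<exists>j. (Suc i, j) \<in> cells l \<and> hook_length l (Suc i) j = int h"
  then obtain j where j: "1 \<le> j" "j \<le> l ! i" and hk: "hook_length l (Suc i) j = int h"
    by (auto simp: cells_def part_def)
  let ?c = "conj_part l j"
  note c = conj_part_iff[OF l j(1)]
  have h_eq: "int h = int (l ! i) - int i + int ?c - int j"
    using hk by (simp add: hook_length_def part_def)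
  have "int (bead l i) - int h = int (j - 1 + (?k - ?c))"
    using h_eq i j c(1) by (simp add: bead_def of_nat_diff)
  then have y: "h \<le> bead l i" "bead l i - h = j - 1 + (?k - ?c)" by linarith+
  have ne: "bead l i' \<noteq> j - 1 + (?k - ?c)" if "i' < ?k" for i'
  proof (cases "i' < ?c")
    case True
    then show ?thesis using c(2)[OF that] that c(1) j(1) by (simp add: bead_def)
  next
    case False
    then show ?thesis using c(2)[OF that] that c(1) j(1) by (simp add: bead_def)
  qed
  have "j - 1 + (?k - ?c) \<notin> beads l"
    unfolding beads_def using ne by (metis imageE lessThan_iff)
  with y show "h \<le> bead l i \<and> bead l i - h \<notin> beads l" by simp
next
  let ?k = "length l"
  assume y: "h \<le> bead l i \<and> bead l i - h \<notin> beads l"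
  define y where "y = bead l i - h"
  have yB: "bead l i' \<noteq> y" if "i' < ?k" for i' using y that unfolding y_def beads_def by (metis imageI lessThan_iff)
  have yi: "y < bead l i" using y h by (simp add: y_def)
  let ?A = "{i'. i' < ?k \<and> y < bead l i'}"
  define a where "a = card ?A"
  have A: "?A = {..<a}" unfolding a_def
    by (rule downset_eq_lessThan) (auto intro: less_trans bead_strict_decreasing[OF l])
  then have a_iff: "i' < a \<longleftrightarrow> y < bead l i'" if "i' < ?k" for i' using that by blast
  have ia: "i < a" using a_iff[OF i] yi by simp
  have ak: "a \<le> ?k"
    unfolding a_def using card_mono[of "{..<?k}" ?A] by auto
  have "?k - a \<le> y"
  proof -
    have "bead l ` {a..<?k} \<subseteq> {..<y}"
      using a_iff yB by (auto simp: not_less) (metis le_neq_implies_less not_less)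
    then have "card (bead l ` {a..<?k}) \<le> card {..<y}" by (intro card_mono) auto
    moreover have "inj_on (bead l) {a..<?k}"
      using inj_on_bead[OF l] by (rule inj_on_subset) auto
    ultimately show ?thesis by (simp add: card_image)
  qed
  \<comment> \<open>the column whose cell in this row corresponds to the gap \<open>y\<close>\<close>
  define j where "j = y - (?k - a) + 1"
  have j1: "1 \<le> j" by (simp add: j_def)
  have lj: "j \<le> l ! i' \<longleftrightarrow> i' < a" if i': "i' < ?k" for i'
  proof
    assume "i' < a"
    have "a - 1 < ?k" using ia ak by auto
    then have "y < bead l (a - 1)" using a_iff[of "a - 1"] ia by auto
    then have "j \<le> l ! (a - 1)" using ia ak \<open>?k - a \<le> y\<close> by (simp add: bead_def j_def)
    also have "\<dots> \<le> l ! i'" using partition_antimono[OF l, of i' "a - 1"] \<open>i' < a\<close> \<open>a - 1 < ?k\<close> by auto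
    finally show "j \<le> l ! i'" .
  next
    assume ji: "j \<le> l ! i'"
    show "i' < a"
    proof (rule ccontr)
      assume "\<not> i' < a"
      then have "a \<le> i'" "a < ?k" using i' by auto
      then have "bead l a < y" using a_iff[of a] yB[of a] by auto
      then have "l ! a < j" using \<open>a < ?k\<close> \<open>?k - a \<le> y\<close> by (simp add: bead_def j_def)
      moreover have "l ! i' \<le> l ! a" using partition_antimono[OF l \<open>a \<le> i'\<close> i'] .
      ultimately show False using ji by simp
    qed
  qed
  have "conj_part l j = a"
  proof -
    have c: "i' < conj_part l j \<longleftrightarrow> i' < a" if "i' < ?k" for i'
      using conj_part_iff(2)[OF l j1 that] lj[OF that] by simp
    show ?thesis
      using c[of a] c[of "conj_part l j"] conj_part_iff(1)[OF l j1] ak by (metis less_irrefl nat_less_le nat_neq_iff order_less_le_trans)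
  qed
  moreover have "j \<le> l ! i" using lj[OF i] ia by simp
  moreover have "int (bead l i) - int y = int h" using y by (simp add: y_def of_nat_diff)
  ultimately have "(Suc i, j) \<in> cells l" "hook_length l (Suc i) j = int h"
    using i j1 ak \<open>?k - a \<le> y\<close> by (auto simp: cells_def part_def hook_length_def bead_def j_def of_nat_diff)
  then show "\<exists>j. (Suc i, j) \<in> cells l \<and> hook_length l (Suc i) j = int h" by blast
qed

definition down_closed :: "nat \<Rightarrow> nat set \<Rightarrow> bool" where
  "down_closed s B \<longleftrightarrow> (\<forall>x\<in>B. s \<le> x \<longrightarrow> x - s \<in> B)"

text \<open>
  A hook of length \<open>s\<close> in the row of bead \<open>b\<close> says that \<open>b - s\<close> is a gap, so the cores are the bead sets from which \<open>s\<close> and \<open>t\<close> can be subtracted.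
\<close>

lemma is_core_iff_beads:
  assumes l: "is_partition l" and st: "1 \<le> s" "1 \<le> t"
  shows "is_core s t l \<longleftrightarrow> down_closed s (beads l) \<and> down_closed t (beads l)"
proof -
  have "(\<exists>i j. (i, j) \<in> cells l \<and> hook_length l i j = int h) \<longleftrightarrow> \<not> down_closed h (beads l)" if "1 \<le> h" for h
  proof -
    have "(\<exists>i j. (i, j) \<in> cells l \<and> hook_length l i j = int h)
        \<longleftrightarrow> (\<exists>i<length l. \<exists>j. (Suc i, j) \<in> cells l \<and> hook_length l (Suc i) j = int h)"
      by (auto simp: cells_def) (metis Suc_le_D Suc_le_lessD)
    also have "\<dots> \<longleftrightarrow> (\<exists>i<length l. h \<le> bead l i \<and> bead l i - h \<notin> beads l)"
      using hook_iff_beads[OF l _ that] by auto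
    also have "\<dots> \<longleftrightarrow> \<not> down_closed h (beads l)"
      unfolding down_closed_def by (auto simp: beads_def)
    finally show ?thesis .
  qed
  from this[OF st(1)] this[OF st(2)] show ?thesis
    by (auto simp: is_core_def)
qed

definition core_beads :: "nat \<Rightarrow> nat \<Rightarrow> nat set set" where
  "core_beads s t = {B. finite B \<and> 0 \<notin> B \<and> down_closed s B \<and> down_closed t B \<and> (\<forall>x\<in>B. Suc x \<notin> B)}"

lemma distinct_cores_beads_bij:
  assumes "1 \<le> s" "1 \<le> t"
  shows "bij_betw beads (distinct_cores s t) (core_beads s t)"
proof -
  have "bij_betw beads (distinct_cores s t) (beads ` distinct_cores s t)"
    using beads_bij by (rule bij_betw_subset) (auto simp: distinct_cores_def)
  moreover have "beads ` distinct_cores s t = core_beads s t"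
  proof (intro equalityI subsetI)
    fix B assume "B \<in> beads ` distinct_cores s t"
    then obtain l where l: "l \<in> distinct_cores s t" "B = beads l" by auto
    then have "beads l \<in> {B. finite B \<and> 0 \<notin> B}"
      using beads_bij by (auto simp: distinct_cores_def bij_betw_def)
    then show "B \<in> core_beads s t"
      using l is_core_iff_beads[OF _ assms] distinct_iff_beads by (auto simp: distinct_cores_def core_beads_def)
  next
    fix B assume B: "B \<in> core_beads s t"
    then have "B \<in> beads ` {l. is_partition l}"
      using beads_bij by (auto simp: core_beads_def bij_betw_def)
    then obtain l where l: "is_partition l" "B = beads l" by auto
    then have "l \<in> distinct_cores s t"
      using B is_core_iff_beads[OF l(1) assms] distinct_iff_beads[OF l(1)] by (auto simp: distinct_cores_def core_beads_def)
    then show "B \<in> beads ` distinct_cores s t" using l by auto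
  qed
  ultimately show ?thesis by simp
qed

lemma psize_beads:
  assumes "is_partition l"
  shows "2 * psize l = 2 * real (\<Sum>(beads l)) - real (card (beads l)) ^ 2 + real (card (beads l))"
proof -
  have "2 * real (\<Sum>{..<k}) = real k ^ 2 - real k" for k :: nat
    by (induction k) (auto simp: power2_eq_square algebra_simps)
  then show ?thesis
    by (simp add: psize_def sum_beads[OF assms] card_beads[OF assms] del: of_nat_sum)
qed

section \<open>The outward moves of a walk\<close>

definition walks :: "nat \<Rightarrow> int list set" where
  "walks N = {w. length w = N \<and> set w \<subseteq> {1, -1}}"

fun pos_sum :: "(int \<Rightarrow> int) \<Rightarrow> int \<Rightarrow> int list \<Rightarrow> int" where
  "pos_sum f p [] = 0"
| "pos_sum f p (s # ss) = f (p + s) + pos_sum f (p + s) ss"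

fun outward :: "int \<Rightarrow> int list \<Rightarrow> int list" where
  "outward p [] = []"
| "outward p (s # ss) = (if \<bar>p\<bar> < \<bar>p + s\<bar> then (p + s) # outward (p + s) ss else outward (p + s) ss)"

text \<open>
  These are the possible pairs of consecutive outward positions of a walk: after arriving at \<open>p\<close> the walk moves some way
  towards 0 and then outwards once, which leads at most one further out on the same side, or, if 0 is reached and left on the other side, to distance 1.
\<close>

definition allowed :: "int \<Rightarrow> int \<Rightarrow> bool" where
  "allowed p v \<longleftrightarrow> v \<noteq> 0 \<and> (if 0 < p * v then \<bar>v\<bar> \<le> \<bar>p\<bar> + 1 else \<bar>v\<bar> = 1)"

fun chain :: "int \<Rightarrow> int list \<Rightarrow> bool" where
  "chain p [] \<longleftrightarrow> True"
| "chain p (v # vs) \<longleftrightarrow> allowed p v \<and> chain v vs"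

text \<open>
  Between two outward positions the inward steps are forced, and this function restores them. After the last
  one a walk on the negative side returns to 0.
\<close>

fun refill :: "int \<Rightarrow> int list \<Rightarrow> int list" where
  "refill p [] = (if p < 0 then replicate (nat (- p)) 1 else [])"
| "refill p (v # vs) = replicate (nat \<bar>p - (v - sgn v)\<bar>) (- sgn p) @ sgn v # refill v vs"

text \<open>
  This end condition makes the inward steps after the last outward step determined: there are none on the
  positive side, and the walk stops at 0 when it comes from the negative side.
\<close>

definition rising_end :: "int \<Rightarrow> int list \<Rightarrow> bool" where
  "rising_end p ss \<longleftrightarrow> set ss \<subseteq> {1, -1} \<and> 0 \<le> p + sum_list ss \<and> (ss \<noteq> [] \<longrightarrow> last ss = 1)"

lemma allowed_step_in:
  assumes "s \<in> {1, -1}" "\<bar>p + s\<bar> < \<bar>p\<bar>" "allowed (p + s) v"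
  shows "allowed p v"
    and "replicate (nat \<bar>p - (v - sgn v)\<bar>) (- sgn p) = s # replicate (nat \<bar>p + s - (v - sgn v)\<bar>) (- sgn (p + s))"
proof -
  consider (pos) "0 < p" "s = -1" | (neg) "p < 0" "s = 1" using assms(1,2) by auto
  then have "allowed p v \<and> nat \<bar>p - (v - sgn v)\<bar> = Suc (nat \<bar>p + s - (v - sgn v)\<bar>)
    \<and> - sgn p = s \<and> (p + s = 0 \<longrightarrow> v - sgn v = 0) \<and> (p + s \<noteq> 0 \<longrightarrow> sgn (p + s) = sgn p)"
    using assms(3)
    by cases (auto simp: allowed_def zero_less_mult_iff sgn_if split: if_splits)
  then show "allowed p v"
    and "replicate (nat \<bar>p - (v - sgn v)\<bar>) (- sgn p) = s # replicate (nat \<bar>p + s - (v - sgn v)\<bar>) (- sgn (p + s))"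
    by (auto simp: replicate_eq_replicate split: if_splits) 
qed

text \<open>
  Walks with the right end condition are determined by their outward positions; the induction peels off one step, an inward step being absorbed by the block of inward steps that follows.
\<close>

lemma outward_chain:
  "rising_end p ss \<Longrightarrow> chain p (outward p ss) \<and> refill p (outward p ss) = ss"
proof (induction ss arbitrary: p)
  case Nil
  then show ?case by (simp add: rising_end_def)
next
  case (Cons s ss)
  have s: "s \<in> {1, -1}" and re: "rising_end (p + s) ss" and last: "ss = [] \<Longrightarrow> s = 1"
    using Cons.prems by (auto simp: rising_end_def add.assoc)
  note IH = Cons.IH[OF re]
  show ?case
  proof (cases "\<bar>p\<bar> < \<bar>p + s\<bar>")
    case True
    then have "allowed p (p + s)" "sgn (p + s) = s"
      using s by (auto simp: allowed_def zero_less_mult_iff sgn_if)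
    then show ?thesis using True IH by simp
  next
    case False
    then have in_step: "\<bar>p + s\<bar> < \<bar>p\<bar>" using s by auto
    show ?thesis
    proof (cases "outward (p + s) ss")
      case Nil
      then have ss: "ss = refill (p + s) []" using IH by simp
      have "p < 0"
      proof (rule ccontr)
        assume "\<not> p < 0"
        then have "s = -1" "0 \<le> p + s" using s in_step by auto
        moreover from \<open>0 \<le> p + s\<close> have "ss = []" by (subst ss) simp
        ultimately show False using last by simp
      qed
      then have "s = 1" using s in_step by auto
      moreover have "replicate (nat (- p)) (1::int) = 1 # replicate (nat (- p - 1)) 1"
        using \<open>p < 0\<close> by (metis Suc_nat_eq_nat_zadd1 add.commute diff_add_cancel neg_0_less_iff_less nat_eq_iff replicate_Suc zle_diff1_eq)
      moreover have "ss = replicate (nat (- p - 1)) 1"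
        using \<open>p < 0\<close> \<open>s = 1\<close> by (subst ss) auto
      ultimately show ?thesis using Nil False \<open>p < 0\<close> by simp
    next
      case (Cons v vs)
      then have "allowed (p + s) v" using IH by simp
      from allowed_step_in[OF s in_step this] show ?thesis
        using Cons False IH by simp
    qed
  qed
qed

lemma outward_replicate:
  "int k \<le> \<bar>p\<bar> \<Longrightarrow> outward p (replicate k (- sgn p) @ ss) = outward (p - int k * sgn p) ss"
proof (induction k arbitrary: p)
  case (Suc k)
  then have "p \<noteq> 0" by auto
  show ?case
  proof (cases "p - sgn p = 0")
    case True
    then have "k = 0" using Suc.prems by (auto simp: sgn_if split: if_splits)
    then show ?thesis using True \<open>p \<noteq> 0\<close> by auto
  next
    case False
    then have "sgn (p - sgn p) = sgn p" "\<bar>p - sgn p\<bar> = \<bar>p\<bar> - 1" using \<open>p \<noteq> 0\<close> by (auto simp: sgn_if)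
    then show ?thesis using Suc.IH[of "p - sgn p"] Suc.prems by (simp add: algebra_simps)
  qed
qed simp

text \<open>
  Conversely every chain of allowed positions occurs. The end point is the last outward position, or 0 if that is negative.
\<close>

lemma refill_outward:
  "chain p vs \<Longrightarrow> outward p (refill p vs) = vs \<and> rising_end p (refill p vs)
     \<and> p + sum_list (refill p vs) = max 0 (last (p # vs))"
proof (induction vs arbitrary: p)
  case Nil
  have "outward p (replicate (nat (- p)) 1) = []" if "p < 0"
    using outward_replicate[of "nat (- p)" p "[]"] that by simp
  then show ?case by (auto simp: rising_end_def sum_list_replicate)
next
  case (Cons v vs)
  let ?k = "nat \<bar>p - (v - sgn v)\<bar>"
  have v: "allowed p v" "chain v vs" "v \<noteq> 0" using Cons.prems by (auto simp: allowed_def)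
  have k: "int ?k \<le> \<bar>p\<bar>" "p - int ?k * sgn p = v - sgn v"
    using v(1) by (auto simp: allowed_def zero_less_mult_iff sgn_if split: if_splits)
  note IH = Cons.IH[OF v(2)]
  have "outward p (refill p (v # vs)) = v # vs"
    using outward_replicate[OF k(1)] k(2) IH v(3) by (auto simp: sgn_if)
  moreover have sum: "p + sum_list (refill p (v # vs)) = v + sum_list (refill v vs)"
    using k(2) by (simp add: sum_list_replicate algebra_simps)
  moreover have "rising_end p (refill p (v # vs))"
  proof -
    have "set (refill p (v # vs)) \<subseteq> {1, -1}"
      using IH v(3) k by (auto simp: rising_end_def sgn_if split: if_splits)
    moreover have "last (refill p (v # vs)) = 1"
    proof (cases "refill v vs = []")
      case True
      then have "0 \<le> v" using IH by (simp add: rising_end_def)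
      then show ?thesis using True v(3) by simp
    next
      case False
      then show ?thesis using IH by (simp add: rising_end_def)
    qed
    ultimately show ?thesis using IH sum by (simp only: rising_end_def) simp
  qed
  ultimately show ?case using IH by simp
qed

lemma length_outward:
  "set ss \<subseteq> {1, -1} \<Longrightarrow> int (length ss) = 2 * int (length (outward p ss)) - (\<bar>p + sum_list ss\<bar> - \<bar>p\<bar>)"
proof (induction ss arbitrary: p)
  case (Cons s ss)
  then show ?case using Cons.IH[of "p + s"] by (auto simp: add.assoc)
qed simp

lemma unit_step_cases:
  fixes p s :: int
  assumes "s = 1 \<or> s = -1"
  obtains "0 < p" "\<bar>p\<bar> = p" "\<bar>p + s\<bar> = p + s" "\<bar>p\<bar> < \<bar>p + s\<bar> \<longleftrightarrow> s = 1"
  | "p < 0" "\<bar>p\<bar> = - p" "\<bar>p + s\<bar> = - p - s" "\<bar>p\<bar> < \<bar>p + s\<bar> \<longleftrightarrow> s = -1"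
  | "p = 0" "\<bar>s\<bar> = 1"
  using assms by (cases p "0::int" rule: linorder_cases) auto

text \<open>
  The potential is the squared position: an outward step to distance \<open>m\<close> raises it by \<open>2 m - 1\<close> and an inward step to distance
  \<open>m\<close> lowers it by \<open>2 m + 1\<close>. Hence outward and inward steps share the sum of distances equally up to boundary terms.
\<close>

lemma sum_abs_outward:
  "set ss \<subseteq> {1, -1} \<Longrightarrow> 4 * sum_list (map abs (outward p ss))
     = 2 * pos_sum abs p ss + int (length ss) + (p + sum_list ss) ^ 2 - p ^ 2"
proof (induction ss arbitrary: p)
  case (Cons s ss)
  then have s: "s = 1 \<or> s = -1" and IH: "4 * sum_list (map abs (outward (p + s) ss))
     = 2 * pos_sum abs (p + s) ss + int (length ss) + (p + s + sum_list ss) ^ 2 - (p + s) ^ 2" by auto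
  have "(if \<bar>p\<bar> < \<bar>p + s\<bar> then 4 * \<bar>p + s\<bar> else 0) = 2 * \<bar>p + s\<bar> + 1 + (p + s) ^ 2 - p ^ 2"
    using s by (cases rule: unit_step_cases[OF s, of p]) (auto simp: power2_eq_square algebra_simps)
  with IH show ?case by (auto simp: add.assoc split: if_splits)
qed simp

text \<open>
  The same argument with the cubed distance as potential.
\<close>

lemma sum_square_outward:
  "set ss \<subseteq> {1, -1} \<Longrightarrow> 6 * sum_list (map power2 (outward p ss))
     = 3 * pos_sum power2 p ss + 3 * pos_sum abs p ss + int (length ss)
       - 2 * int (length (outward p ss)) + \<bar>p + sum_list ss\<bar> ^ 3 - \<bar>p\<bar> ^ 3"
proof (induction ss arbitrary: p)
  case (Cons s ss)
  then have s: "s = 1 \<or> s = -1" and IH: "6 * sum_list (map power2 (outward (p + s) ss))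
     = 3 * pos_sum power2 (p + s) ss + 3 * pos_sum abs (p + s) ss + int (length ss)
       - 2 * int (length (outward (p + s) ss)) + \<bar>p + s + sum_list ss\<bar> ^ 3 - \<bar>p + s\<bar> ^ 3" by auto
  have "(if \<bar>p\<bar> < \<bar>p + s\<bar> then 6 * (p + s) ^ 2 + 2 else 0)
     = 3 * (p + s) ^ 2 + 3 * \<bar>p + s\<bar> + 1 + \<bar>p + s\<bar> ^ 3 - \<bar>p\<bar> ^ 3"
    using s by (cases rule: unit_step_cases[OF s, of p]) (auto simp: power2_eq_square power3_eq_cube algebra_simps)
  with IH show ?case by (auto simp: add.assoc split: if_splits)
qed simp

lemma pos_sum_append: "pos_sum f p (xs @ ys) = pos_sum f p xs + pos_sum f (p + sum_list xs) ys"
  by (induction xs arbitrary: p) (auto simp: add.assoc)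

lemma pos_sum_uminus: "(\<And>x. f (- x) = f x) \<Longrightarrow> pos_sum f (- p) (map uminus w) = pos_sum f p w"
proof (induction w arbitrary: p)
  case (Cons s w)
  have "- p + - s = - (p + s)" by simp
  then show ?case using Cons.IH[OF Cons.prems] Cons.prems by (simp only: list.map pos_sum.simps)
qed simp

lemma pos_sum_abs_shift: "\<bar>pos_sum abs (p + c) w - pos_sum abs p w\<bar> \<le> \<bar>c\<bar> * int (length w)"
proof (induction w arbitrary: p)
  case (Cons s w)
  have "p + c + s = (p + s) + c" by simp
  then show ?case using Cons.IH[of "p + s"] by (simp add: algebra_simps)
qed simp

lemma pos_sum_square_shift:
  "\<bar>pos_sum power2 (p + c) w - pos_sum power2 p w\<bar> \<le> 2 * \<bar>c\<bar> * pos_sum abs p w + c ^ 2 * int (length w)"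
proof (induction w arbitrary: p)
  case (Cons s w)
  have e: "p + c + s = (p + s) + c" by simp
  have "(p + s + c) ^ 2 - (p + s) ^ 2 = 2 * c * (p + s) + c ^ 2"
    by (simp add: power2_eq_square algebra_simps)
  then have "\<bar>(p + s + c) ^ 2 - (p + s) ^ 2\<bar> \<le> 2 * \<bar>c\<bar> * \<bar>p + s\<bar> + c ^ 2"
    using abs_triangle_ineq[of "2 * c * (p + s)" "c ^ 2"] by (simp add: abs_mult)
  then show ?case using Cons.IH[of "p + s"] unfolding pos_sum.simps e
    by (simp add: algebra_simps)
qed simp

text \<open>
  The function \<open>x * \<bar>x\<bar>\<close> is increasing, so the squares of a negative start and a positive end add up, while a single step to \<open>x\<close> changes it by at most \<open>2 * \<bar>x\<bar> + 1\<close>.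
\<close>

lemma signed_square_growth:
  "set w \<subseteq> {1, -1} \<Longrightarrow> (p + sum_list w) * \<bar>p + sum_list w\<bar> - p * \<bar>p\<bar> \<le> 2 * pos_sum abs p w + int (length w)"
proof (induction w arbitrary: p)
  case (Cons s w)
  then have s: "s = 1 \<or> s = -1" by auto
  have "(p + s) * \<bar>p + s\<bar> - p * \<bar>p\<bar> \<le> 2 * \<bar>p + s\<bar> + 1"
    using s by (cases rule: unit_step_cases[OF s, of p]) (auto simp: algebra_simps)
  then show ?case using Cons.IH[of "p + s"] Cons.prems by (simp add: add.assoc)
qed simp

section \<open>Walks and their centred statistics\<close>

lemma walks_0: "walks 0 = {[]}" by (auto simp: walks_def)

lemma walks_Suc: "walks (Suc N) = (#) 1 ` walks N \<union> (#) (-1) ` walks N"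
  by (auto simp: walks_def length_Suc_conv image_iff)

lemma finite_walks [simp]: "finite (walks N)"
  by (induction N) (simp_all add: walks_0 walks_Suc)

lemma card_walks: "card (walks N) = 2 ^ N"
proof (induction N)
  case (Suc N)
  have "card (walks (Suc N)) = card ((#) 1 ` walks N) + card ((#) (-1) ` walks N)"
    unfolding walks_Suc by (rule card_Un_disjoint) auto
  then show ?case by (simp add: card_image Suc.IH)
qed (simp add: walks_0)

lemma sum_walks_Suc: "(\<Sum>w\<in>walks (Suc N). f w) = (\<Sum>w\<in>walks N. f (1 # w)) + (\<Sum>w\<in>walks N. f (-1 # w))"
  unfolding walks_Suc by (subst sum.union_disjoint) (auto simp: sum.reindex)

lemma even_sum_walk: "w \<in> walks N \<Longrightarrow> even (sum_list w - int N)"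
proof (induction w arbitrary: N)
  case (Cons s w)
  then obtain M where N: "N = Suc M" "w \<in> walks M" "s \<in> {1, -1}" by (auto simp: walks_def)
  then show ?case using Cons.IH[of M] by auto
qed (simp add: walks_def)

lemma abs_sum_walk: "w \<in> walks N \<Longrightarrow> \<bar>sum_list w\<bar> \<le> int N"
proof (induction w arbitrary: N)
  case (Cons s w)
  then obtain M where N: "N = Suc M" "w \<in> walks M" "s \<in> {1, -1}" by (auto simp: walks_def)
  then show ?case using Cons.IH[of M] by auto
qed (simp add: walks_def)

text \<open>
  The walk is started at minus half of its displacement, so it ends at the negative of its start. Walks centred in
  this way may be continued antiperiodically and are then stable under rotation; they are the discrete form of the process
  \<open>W(t) - W(1) / 2\<close> for a Brownian motion \<open>W\<close>.
\<close>

definition area :: "int list \<Rightarrow> int" where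
  "area w = pos_sum abs (- (sum_list w div 2)) w"

definition square_sum :: "int list \<Rightarrow> int" where
  "square_sum w = pos_sum power2 (- (sum_list w div 2)) w"

lemma area_nonneg: "0 \<le> area w"
proof -
  have "0 \<le> pos_sum abs p w" for p by (induction w arbitrary: p) auto
  then show ?thesis by (simp add: area_def)
qed

lemma square_sum_nonneg: "0 \<le> square_sum w"
proof -
  have "0 \<le> pos_sum power2 p w" for p by (induction w arbitrary: p) auto
  then show ?thesis by (simp add: square_sum_def)
qed

text \<open>
  This is the Cauchy-Schwarz inequality, proved one step at a time.
\<close>

lemma area_square_le: "area w ^ 2 \<le> int (length w) * square_sum w"
proof -
  have "pos_sum abs p w ^ 2 \<le> int (length w) * pos_sum power2 p w" for p
  proof (induction w arbitrary: p)
    case (Cons s w)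
    let ?x = "\<bar>p + s\<bar>" and ?T = "pos_sum abs (p + s) w" and ?U = "pos_sum power2 (p + s) w" and ?l = "int (length w)"
    have nn: "0 \<le> pos_sum power2 q v" for q v by (induction v arbitrary: q) auto
    have "2 * (?x * ?T) \<le> ?l * ?x ^ 2 + ?U"
    proof (cases "?l = 0")
      case False
      then have l: "?l > 0" by simp
      have "0 \<le> (?l * ?x - ?T) ^ 2" by simp
      then have "?l * (2 * (?x * ?T)) \<le> ?l * (?l * ?x ^ 2) + ?T ^ 2"
        by (simp add: power2_eq_square algebra_simps)
      also have "?T ^ 2 \<le> ?l * ?U" by (rule Cons.IH)
      finally have "?l * (2 * (?x * ?T)) \<le> ?l * (?l * ?x ^ 2 + ?U)" by (simp add: algebra_simps)
      then show ?thesis using l by simp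
    qed simp
    then show ?case using Cons.IH[of "p + s"] by (simp add: power2_eq_square algebra_simps)
  qed simp
  then show ?thesis by (simp add: area_def square_sum_def)
qed

section \<open>Closed configurations and free walks\<close>

text \<open>
  The closing condition of a core between the two halves of the abacus acts as if the list were preceded by the
  position \<open>entry b\<close>, where \<open>b\<close> is its last element.
\<close>

definition entry :: "int \<Rightarrow> int" where
  "entry b = (if 0 < b then - (b + 2) else - 2)"

definition configs :: "nat \<Rightarrow> int list set" where
  "configs n = {vs. length vs = n \<and> chain (entry (last vs)) vs}"

definition closed_walks :: "nat \<Rightarrow> int list set" where
  "closed_walks N = {ss \<in> walks N. last ss = 1 \<and> 2 \<le> sum_list ss}"

text \<open>
  A walk of total displacement \<open>2 * g\<close> is run from \<open>- (g + 1)\<close> to \<open>g - 1\<close>; then its outward positions close up in the sense of \<open>entry\<close>.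
\<close>

definition origin :: "int list \<Rightarrow> int" where
  "origin ss = - (sum_list ss div 2 + 1)"

text \<open>
  The start and the end at distances \<open>g + 1\<close> and \<open>g - 1\<close> give \<open>n\<close> outward steps exactly for length \<open>2 * n + 2\<close>. The value \<open>g = 1\<close> covers the
  lists that end on the negative side: there the walk ends at 0.
\<close>

lemma outward_bij:
  assumes n: "0 < n"
  shows "bij_betw (\<lambda>ss. outward (origin ss) ss) (closed_walks (2 * n + 2)) (configs n)"
proof (rule bij_betw_byWitness[where f' = "\<lambda>vs. refill (entry (last vs)) vs"])
  let ?f = "\<lambda>ss. outward (origin ss) ss" and ?g = "\<lambda>vs. refill (entry (last vs)) vs"
  have fwd: "?g (?f ss) = ss \<and> ?f ss \<in> configs n" if ss: "ss \<in> closed_walks (2 * n + 2)" for ss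
  proof -
    have "even (sum_list ss - int (2 * n + 2))" using ss even_sum_walk by (auto simp: closed_walks_def)
    then have "even (sum_list ss)" by simp
    then obtain g where g: "sum_list ss = 2 * g" by (elim evenE)
    have g1: "1 \<le> g" using ss g by (auto simp: closed_walks_def)
    have p: "origin ss = - (g + 1)" by (simp add: origin_def g)
    have e: "origin ss + sum_list ss = g - 1" by (simp add: p g)
    have "rising_end (origin ss) ss"
      unfolding rising_end_def e using ss g1 by (auto simp: closed_walks_def walks_def)
    note out = outward_chain[OF this]
    have "int (length ss) = 2 * int (length (?f ss)) - (\<bar>g - 1\<bar> - \<bar>- (g + 1)\<bar>)"
      using length_outward[of ss "origin ss"] ss unfolding e unfolding p by (auto simp: closed_walks_def walks_def)
    then have len: "length (?f ss) = n" using ss g1 by (auto simp: closed_walks_def walks_def)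
    then have ne: "?f ss \<noteq> []" using n by auto
    have "g - 1 = max 0 (last (?f ss))"
      using refill_outward[of "origin ss" "?f ss"] out e ne by simp
    then have entry: "entry (last (?f ss)) = origin ss"
      unfolding entry_def p using g1 by (auto simp: max_def split: if_splits)
    show ?thesis using out len unfolding configs_def by (simp add: entry)
  qed
  have bwd: "?f (?g vs) = vs \<and> ?g vs \<in> closed_walks (2 * n + 2)" if vs: "vs \<in> configs n" for vs
  proof -
    let ?b = "last vs" let ?p = "entry ?b"
    have len: "length vs = n" and ch: "chain ?p vs" and ne: "vs \<noteq> []" using vs n by (auto simp: configs_def)
    note re = refill_outward[OF ch]
    have sum: "?p + sum_list (?g vs) = max 0 ?b" using re ne by simp
    have set: "set (?g vs) \<subseteq> {1, -1}" using re by (simp add: rising_end_def)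
    have or: "origin (?g vs) = ?p" and ge: "2 \<le> sum_list (?g vs)"
      using sum by (auto simp: origin_def entry_def max_def split: if_splits)
    have "int (length (?g vs)) = 2 * int n - (max 0 ?b - \<bar>?p\<bar>)"
      using length_outward[OF set, of ?p] unfolding sum using re len by simp
    then have "length (?g vs) = 2 * n + 2" by (auto simp: entry_def max_def split: if_splits)
    moreover have "?g vs \<noteq> []" using ge by (cases "?g vs") auto
    ultimately show ?thesis using re or ge set by (simp add: closed_walks_def walks_def rising_end_def)
  qed
  show "\<forall>ss\<in>closed_walks (2 * n + 2). ?g (?f ss) = ss" "\<forall>vs\<in>configs n. ?f (?g vs) = vs"
    "?f ` closed_walks (2 * n + 2) \<subseteq> configs n" "?g ` configs n \<subseteq> closed_walks (2 * n + 2)"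
    using fwd bwd by blast+
qed

text \<open>
  All unconstrained walks of length \<open>2 * n\<close> are used: those of negative displacement are reflected, and the penultimate step records
  whether this happened. In particular there are \<open>4 ^ n\<close> configurations.
\<close>

definition close_walk :: "int list \<Rightarrow> int list" where
  "close_walk w = (if 0 \<le> sum_list w then w @ [1, 1] else map uminus w @ [-1, 1])"

lemma sum_list_uminus: "sum_list (map uminus (w :: int list)) = - sum_list w"
  by (induction w) auto

lemma uminus_walks: "w \<in> walks N \<Longrightarrow> map uminus w \<in> walks N"
  by (auto simp: walks_def)

lemma close_walk_bij: "bij_betw close_walk (walks (2 * n)) (closed_walks (2 * n + 2))"
  unfolding bij_betw_def
proof
  show "inj_on close_walk (walks (2 * n))"
  proof (rule inj_onI)
    fix w w' :: "int list" assume "close_walk w = close_walk w'"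
    then show "w = w'"
      by (auto simp: close_walk_def inj_map_eq_map inj_def split: if_splits)
  qed
  show "close_walk ` walks (2 * n) = closed_walks (2 * n + 2)"
  proof (intro equalityI subsetI)
    fix ss assume "ss \<in> close_walk ` walks (2 * n)"
    then obtain w where w: "w \<in> walks (2 * n)" "ss = close_walk w" by auto
    then have "even (sum_list w - int (2 * n))" using even_sum_walk by blast
    then have "even (sum_list w)" by simp
    then have "sum_list w \<le> - 2" if "sum_list w < 0" using that by presburger
    then show "ss \<in> closed_walks (2 * n + 2)"
      using w uminus_walks[OF w(1)]
      by (auto simp: closed_walks_def walks_def close_walk_def sum_list_uminus)
  next
    fix ss assume ss: "ss \<in> closed_walks (2 * n + 2)"
    define w where "w = butlast (butlast ss)"
    define l where "l = last (butlast ss)"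
    have len: "length ss = 2 * n + 2" and set: "set ss \<subseteq> {1, -1}" and last: "last ss = 1" and sum: "2 \<le> sum_list ss"
      using ss by (auto simp: closed_walks_def walks_def)
    have "ss \<noteq> []" "butlast ss \<noteq> []" using len by (auto simp flip: length_0_conv)
    then have e: "ss = w @ [l, 1]"
      using last unfolding w_def l_def by (metis append.assoc append_Cons append_Nil append_butlast_last_id)
    then have w: "w \<in> walks (2 * n)" and l: "l = 1 \<or> l = -1"
      using len set by (auto simp: walks_def)
    show "ss \<in> close_walk ` walks (2 * n)"
    proof (cases "l = 1")
      case True
      then have "ss = close_walk w" using sum e by (simp add: close_walk_def)
      then show ?thesis using w by blast
    next
      case False
      then have "ss = close_walk (map uminus w)"
        using sum e l by (simp add: close_walk_def sum_list_uminus comp_def)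
      then show ?thesis using uminus_walks[OF w] by blast
    qed
  qed
qed

definition walk_config :: "int list \<Rightarrow> int list" where
  "walk_config w = outward (origin (close_walk w)) (close_walk w)"

lemma walk_config_bij:
  "0 < n \<Longrightarrow> bij_betw walk_config (walks (2 * n)) (configs n)"
  using bij_betw_trans[OF close_walk_bij outward_bij] unfolding walk_config_def comp_def .

text \<open>
  The start and the end are far from 0 only if the area is large; the displacement is thereby controlled by the area.
\<close>

lemma half_sum_square_le:
  assumes "w \<in> walks (2 * n)"
  shows "(sum_list w div 2) ^ 2 \<le> area w + int n"
proof -
  define h where "h = sum_list w div 2"
  have "even (sum_list w)" using even_sum_walk[OF assms] by simp
  then have D: "sum_list w = 2 * h" by (simp add: h_def)
  have g: "(p + sum_list w') * \<bar>p + sum_list w'\<bar> - p * \<bar>p\<bar> \<le> 2 * pos_sum abs p w' + int (2 * n)"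
    if "w' \<in> walks (2 * n)" for p w'
    using signed_square_growth[of w' p] that by (auto simp: walks_def)
  have neg: "pos_sum abs h (map uminus w) = pos_sum abs (- h) w"
    using pos_sum_uminus[of abs "- h" w] by simp
  have "h * \<bar>h\<bar> + h * \<bar>h\<bar> \<le> 2 * pos_sum abs (- h) w + int (2 * n)"
    using g[OF assms, of "- h"] D by simp
  moreover have "- (h * \<bar>h\<bar>) - h * \<bar>h\<bar> \<le> 2 * pos_sum abs (- h) w + int (2 * n)"
    using g[OF uminus_walks[OF assms], of h] D neg by (simp add: sum_list_uminus)
  moreover have "h ^ 2 = h * \<bar>h\<bar> \<or> h ^ 2 = - (h * \<bar>h\<bar>)" by (auto simp: abs_if power2_eq_square)
  ultimately show ?thesis by (auto simp: area_def h_def)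
qed

text \<open>
  Every position of the closed walk is within distance 2 of the corresponding position of the centred walk, up to reflection, and there are two more positions, both bounded by the starting distance.
\<close>

lemma close_walk_pos_sums:
  assumes w: "w \<in> walks (2 * n)" and n: "0 < n"
  shows "\<bar>pos_sum abs (origin (close_walk w)) (close_walk w) - area w\<bar> \<le> 8 * int n"
    and "\<bar>pos_sum power2 (origin (close_walk w)) (close_walk w) - square_sum w\<bar> \<le> 12 * area w + 32 * int n"
    and "(sum_list (close_walk w) div 2) ^ 2 \<le> 2 * area w + 4 * int n"
    and "1 \<le> sum_list (close_walk w) div 2" "sum_list (close_walk w) div 2 \<le> int n + 1"
proof -
  define h where "h = \<bar>sum_list w div 2\<bar>"
  have "even (sum_list w)" using even_sum_walk[OF w] by simp
  then have D: "\<bar>sum_list w\<bar> = 2 * h" by (auto simp: h_def elim: evenE)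
  have hn: "0 \<le> h" "h \<le> int n" using abs_sum_walk[OF w] D by auto
  have h2: "h ^ 2 \<le> area w + int n" using half_sum_square_le[OF w] by (simp add: h_def)
  \<comment> \<open>\<open>v\<close> is the walk or its reflection, \<open>c\<close> the displacement of its start and \<open>l\<close> the penultimate step\<close>
  have "\<exists>v c l. v \<in> walks (2 * n) \<and> close_walk w = v @ [l, 1] \<and> sum_list v = 2 * h \<and> origin (close_walk w) = - h + c
      \<and> (c = -1 \<and> l = -1 \<and> 1 \<le> h \<or> c = -2 \<and> l = 1) \<and> pos_sum abs (- h) v = area w \<and> pos_sum power2 (- h) v = square_sum w"
  proof (cases "0 \<le> sum_list w")
    case True
    then have "sum_list w div 2 = h" using D by auto
    then show ?thesis using True w D
      by (intro exI[of _ w] exI[of _ "-2"] exI[of _ 1]) (auto simp: close_walk_def origin_def area_def square_sum_def)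
  next
    case False
    then have s: "sum_list w = - (2 * h)" "sum_list w div 2 = - h" "1 \<le> h" using D by auto
    have "pos_sum f (- h) (map uminus w) = pos_sum f h w" if "\<And>x. f (- x) = f x" for f
      using pos_sum_uminus[of f h w] that by simp
    then show ?thesis using False uminus_walks[OF w] s
      by (intro exI[of _ "map uminus w"] exI[of _ "-1"] exI[of _ "-1"])
        (auto simp: close_walk_def origin_def area_def square_sum_def sum_list_uminus)
  qed
  then obtain v c l where v: "v \<in> walks (2 * n)" and cw: "close_walk w = v @ [l, 1]" and sv: "sum_list v = 2 * h"
    and o: "origin (close_walk w) = - h + c" and cl: "c = -1 \<and> l = -1 \<and> 1 \<le> h \<or> c = -2 \<and> l = 1"
    and S: "pos_sum abs (- h) v = area w" and M: "pos_sum power2 (- h) v = square_sum w" by blast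
  have len: "int (length v) = 2 * int n" using v by (simp add: walks_def)
  have c: "\<bar>c\<bar> \<le> 2" "c ^ 2 \<le> 4" using cl by auto
  have "\<bar>pos_sum abs (- h + c) v - area w\<bar> \<le> \<bar>c\<bar> * (2 * int n)"
    using pos_sum_abs_shift[of "- h" c v] unfolding S len .
  also have "\<dots> \<le> 2 * (2 * int n)" using c by (intro mult_right_mono) auto
  finally have 1: "\<bar>pos_sum abs (- h + c) v - area w\<bar> \<le> 4 * int n" by simp
  have "\<bar>pos_sum power2 (- h + c) v - square_sum w\<bar> \<le> 2 * \<bar>c\<bar> * area w + c ^ 2 * (2 * int n)"
    using pos_sum_square_shift[of "- h" c v] unfolding S M len .
  also have "\<dots> \<le> 2 * 2 * area w + 4 * (2 * int n)"
    using c by (intro add_mono mult_mono) (auto simp: area_nonneg)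
  finally have 2: "\<bar>pos_sum power2 (- h + c) v - square_sum w\<bar> \<le> 4 * area w + 8 * int n" by simp
  have tail: "pos_sum f (origin (close_walk w)) (close_walk w)
      = pos_sum f (- h + c) v + (f (h + c + l) + f (h + c + l + 1))" for f
    by (simp add: cw o[unfolded cw] pos_sum_append sv algebra_simps)
  have b: "\<bar>h + c + l\<bar> \<le> h + 1" "\<bar>h + c + l + 1\<bar> \<le> h + 1" using cl hn by auto
  show "\<bar>pos_sum abs (origin (close_walk w)) (close_walk w) - area w\<bar> \<le> 8 * int n"
    unfolding tail using 1 b hn n by linarith
  have "(h + c + l) ^ 2 \<le> (h + 1) ^ 2" "(h + c + l + 1) ^ 2 \<le> (h + 1) ^ 2"
    using b power_mono[OF b(1), of 2] power_mono[OF b(2), of 2] by simp_all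
  moreover have "(h + 1) ^ 2 \<le> 2 * h ^ 2 + 2"
    using zero_le_power2[of "h - 1"] by (simp add: power2_eq_square algebra_simps)
  ultimately show "\<bar>pos_sum power2 (origin (close_walk w)) (close_walk w) - square_sum w\<bar> \<le> 12 * area w + 32 * int n"
    unfolding tail using 2 h2 n area_nonneg[of w] zero_le_power2[of "h + c + l"] zero_le_power2[of "h + c + l + 1"]
    by linarith
  have g: "sum_list (close_walk w) div 2 = h \<and> 1 \<le> h \<or> sum_list (close_walk w) div 2 = h + 1"
    using cl by (auto simp: cw sv)
  have "(h + 1) ^ 2 \<le> 2 * h ^ 2 + 2"
    using zero_le_power2[of "h - 1"] by (simp add: power2_eq_square algebra_simps)
  then show "(sum_list (close_walk w) div 2) ^ 2 \<le> 2 * area w + 4 * int n"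
    using g h2 n area_nonneg[of w] by auto
  show "1 \<le> sum_list (close_walk w) div 2" "sum_list (close_walk w) div 2 \<le> int n + 1"
    using g hn by auto
qed

lemma walk_config_estimates:
  assumes w: "w \<in> walks (2 * n)" and n: "0 < n"
  shows "\<bar>2 * sum_list (map abs (walk_config w)) - area w\<bar> \<le> 12 * int n"
    and "\<bar>2 * sum_list (map power2 (walk_config w)) - square_sum w\<bar> \<le> 20 * area w + 60 * int n"
proof -
  define g where "g = sum_list (close_walk w) div 2"
  let ?T = "pos_sum abs (origin (close_walk w)) (close_walk w)" and ?U = "pos_sum power2 (origin (close_walk w)) (close_walk w)"
  note cps = close_walk_pos_sums[OF w n, folded g_def]
  have cw: "close_walk w \<in> closed_walks (2 * n + 2)" using close_walk_bij w by (auto simp: bij_betw_def)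
  then have len: "int (length (close_walk w)) = 2 * int n + 2" and set: "set (close_walk w) \<subseteq> {1, -1}"
    by (auto simp: closed_walks_def walks_def)
  have "even (sum_list (close_walk w) - int (2 * n + 2))" using cw even_sum_walk by (auto simp: closed_walks_def)
  then have "even (sum_list (close_walk w))" by simp
  then have sum: "sum_list (close_walk w) = 2 * g" by (simp add: g_def)
  have p: "origin (close_walk w) = - (g + 1)" by (simp add: origin_def g_def)
  have e: "origin (close_walk w) + sum_list (close_walk w) = g - 1" by (simp add: p sum)
  have lo: "length (walk_config w) = n"
    using walk_config_bij[OF n] w by (auto simp: bij_betw_def configs_def)
  have "(g - 1) ^ 2 - (g + 1) ^ 2 = - (4 * g)" by (simp add: power2_eq_square algebra_simps)
  then have "4 * sum_list (map abs (walk_config w)) = 2 * ?T + (2 * int n + 2) - 4 * g"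
    using sum_abs_outward[OF set, of "origin (close_walk w)"] unfolding e len walk_config_def[symmetric]
    by (simp add: p power2_eq_square algebra_simps)
  then show "\<bar>2 * sum_list (map abs (walk_config w)) - area w\<bar> \<le> 12 * int n"
    using cps n by linarith
  have "\<bar>g - 1\<bar> ^ 3 - \<bar>- (g + 1)\<bar> ^ 3 = - (6 * g ^ 2 + 2)"
    using cps(4) by (simp add: power2_eq_square power3_eq_cube algebra_simps)
  then have "6 * sum_list (map power2 (walk_config w)) = 3 * ?U + 3 * ?T + 2 - (6 * g ^ 2 + 2)"
    using sum_square_outward[OF set, of "origin (close_walk w)"] unfolding e len walk_config_def[symmetric] lo
    unfolding p by linarith
  then show "\<bar>2 * sum_list (map power2 (walk_config w)) - square_sum w\<bar> \<le> 20 * area w + 60 * int n"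
  proof -
    have bound: "\<bar>2 * X - M\<bar> \<le> 20 * s + 60 * k"
      if "6 * X = 3 * U + 3 * T + 2 - (6 * q + 2)" "\<bar>T - s\<bar> \<le> 8 * k" "\<bar>U - M\<bar> \<le> 12 * s + 32 * k"
        "q \<le> 2 * s + 4 * k" "0 \<le> q" "0 \<le> s" "0 \<le> k" for X U T q s k M :: int
      using that by linarith
    assume "6 * sum_list (map power2 (walk_config w)) = 3 * ?U + 3 * ?T + 2 - (6 * g ^ 2 + 2)"
    from bound[OF this cps(1,2,3) zero_le_power2 area_nonneg] show ?thesis by simp
  qed
qed

section \<open>Bead sets of distinct core partitions on an abacus\<close>

text \<open>
  The beads of an abacus with \<open>s\<close> runners on which the \<open>c r\<close> beads of runner \<open>r\<close> are pushed to the top.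
\<close>

definition runner_set :: "nat \<Rightarrow> (nat \<Rightarrow> nat) \<Rightarrow> nat set" where
  "runner_set s c = {x. x div s < c (x mod s)}"

text \<open>
  For \<open>s = 2 * n + 1\<close> and \<open>t = s + 2\<close>, subtracting \<open>t\<close> from a bead moves it up by one place and back by two runners. The runners are
  therefore passed in the cyclic order \<open>0, 2, \<dots>, 2 * n, 1, 3, \<dots>, 2 * n - 1\<close>, and the step from runner 1 to runner \<open>2 * n\<close> costs one place more.
\<close>

definition admissible :: "nat \<Rightarrow> (nat \<Rightarrow> nat) \<Rightarrow> bool" where
  "admissible n c \<longleftrightarrow> c 0 = 0 \<and> (\<forall>r. 2 \<le> r \<longrightarrow> r \<le> 2 * n \<longrightarrow> c r \<le> c (r - 2) + 1)
     \<and> c 1 \<le> c (2 * n) + 2 \<and> (\<forall>r<2 * n. c r = 0 \<or> c (Suc r) = 0)"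

lemma runner_mem: "r < s \<Longrightarrow> r + s * p \<in> runner_set s c \<longleftrightarrow> p < c r"
  by (simp add: runner_set_def)

lemma runner_split: "0 < s \<Longrightarrow> x = x mod s + s * (x div s) \<and> x mod s < s"
  for x s :: nat by simp

lemma runner_set_image: "0 < s \<Longrightarrow> runner_set s c = (\<lambda>(r, p). r + s * p) ` (SIGMA r:{..<s}. {..<c r})"
proof (intro equalityI subsetI)
  fix x assume "0 < s" "x \<in> runner_set s c"
  then show "x \<in> (\<lambda>(r, p). r + s * p) ` (SIGMA r:{..<s}. {..<c r})"
    by (intro image_eqI[of _ _ "(x mod s, x div s)"]) (auto simp: runner_set_def)
qed (auto simp: runner_mem)

lemma inj_runner: "inj_on (\<lambda>(r, p). r + s * p) (SIGMA r:{..<s}. {..<c r})" for s :: nat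
proof (rule inj_onI, clarsimp)
  fix r p r' p' assume *: "r < s" "r' < s" "r + s * p = r' + s * p'"
  have "(r + s * p) mod s = (r' + s * p') mod s" "(r + s * p) div s = (r' + s * p') div s"
    using *(3) by simp_all
  then show "r = r' \<and> p = p'" using *(1,2) by simp
qed

lemma sum_runner_set: "0 < s \<Longrightarrow> sum f (runner_set s c) = (\<Sum>r<s. \<Sum>p<c r. f (r + s * p))"
  unfolding runner_set_image sum.reindex[OF inj_runner] by (subst sum.Sigma) (auto simp: comp_def split_def)

lemma finite_runner_set: "0 < s \<Longrightarrow> finite (runner_set s c)"
  by (simp add: runner_set_image)

lemma runner_set_core:
  assumes n: "0 < n" and s: "s = 2 * n + 1"
  shows "runner_set s c \<in> core_beads s (2 * n + 3) \<longleftrightarrow> admissible n c"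
proof
  have s0: "0 < s" using s by simp
  assume B: "runner_set s c \<in> core_beads s (2 * n + 3)"
  let ?B = "runner_set s c"
  have zero: "0 \<notin> ?B" and t: "\<And>x. x \<in> ?B \<Longrightarrow> s + 2 \<le> x \<Longrightarrow> x - (s + 2) \<in> ?B" and nc: "\<And>x. x \<in> ?B \<Longrightarrow> Suc x \<notin> ?B"
    using B by (auto simp: core_beads_def down_closed_def s numeral_3_eq_3)
  have c0: "c 0 = 0" using zero runner_mem[OF s0, of 0 c] by simp
  moreover have "c r \<le> c (r - 2) + 1" if r: "2 \<le> r" "r \<le> 2 * n" for r
  proof (rule ccontr)
    assume "\<not> c r \<le> c (r - 2) + 1"
    then have "r + s * Suc (c (r - 2)) \<in> ?B"
      using runner_mem[of r s "Suc (c (r - 2))" c] r by (simp add: s)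
    from t[OF this] r have "r - 2 + s * c (r - 2) \<in> ?B" by (simp add: algebra_simps)
    then show False using runner_mem[of "r - 2" s] r s by simp
  qed
  moreover have "c 1 \<le> c (2 * n) + 2"
  proof (rule ccontr)
    assume "\<not> c 1 \<le> c (2 * n) + 2"
    then have "1 + s * (c (2 * n) + 2) \<in> ?B"
      using runner_mem[of 1 s "c (2 * n) + 2" c] n by (simp add: s)
    from t[OF this] n have "2 * n + s * c (2 * n) \<in> ?B" by (simp add: algebra_simps s)
    then show False using runner_mem[of "2 * n" s] s by simp
  qed
  moreover have "c r = 0 \<or> c (Suc r) = 0" if r: "r < 2 * n" for r
    using nc[of r] runner_mem[of r s 0 c] runner_mem[of "Suc r" s 0 c] r s by auto
  ultimately show "admissible n c" by (simp add: admissible_def)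
next
  have s0: "0 < s" using s by simp
  assume c: "admissible n c"
  let ?B = "runner_set s c"
  have "down_closed s ?B"
    unfolding down_closed_def using le_div_geq[OF s0] by (auto simp: runner_set_def le_mod_geq)
  moreover have "down_closed (2 * n + 3) ?B"
    unfolding down_closed_def
  proof (intro ballI impI)
    fix x assume x: "x \<in> ?B" "2 * n + 3 \<le> x"
    define r p where "r = x mod s" and "p = x div s"
    have e: "x = r + s * p" "r < s" using runner_split[OF s0, of x] by (auto simp: r_def p_def)
    have pc: "p < c r" using x e runner_mem by auto
    have p1: "1 \<le> p" using x(2) e s by (cases p) auto
    then obtain p' where p': "p = Suc p'" by (cases p) auto
    have "r \<noteq> 0" using pc c by (metis admissible_def not_less_zero)
    show "x - (2 * n + 3) \<in> ?B"
    proof (cases "r = 1")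
      case False
      then have r2: "2 \<le> r" "r \<le> 2 * n" using \<open>r \<noteq> 0\<close> e s by auto
      then have "p' < c (r - 2)" using c pc p' by (fastforce simp: admissible_def)
      moreover have "x - (2 * n + 3) = r - 2 + s * p'" using e p' r2 s by simp
      ultimately show ?thesis using runner_mem[of "r - 2" s p' c] e by auto
    next
      case True
      then have "p' \<noteq> 0" using x(2) e p' s by (cases p') auto
      then obtain p'' where p'': "p' = Suc p''" by (cases p') auto
      have "p'' < c (2 * n)" using c pc p' p'' True by (auto simp: admissible_def)
      moreover have "x - (2 * n + 3) = 2 * n + s * p''" using e p' p'' True s by (simp add: algebra_simps)
      ultimately show ?thesis using runner_mem[of "2 * n" s p'' c] s by auto
    qed
  qed
  moreover have "Suc x \<notin> ?B" if x: "x \<in> ?B" for x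
  proof
    assume x': "Suc x \<in> ?B"
    have c0: "c 0 = 0" using c by (simp add: admissible_def)
    have m: "Suc x mod s \<noteq> 0" using x' c0 by (auto simp: runner_set_def intro!: gr0I)
    then have "Suc (x mod s) \<noteq> s" by (metis mod_Suc)
    then have sm: "Suc x mod s = Suc (x mod s)" by (simp add: mod_Suc)
    then have "x mod s < 2 * n" using s mod_less_divisor[OF s0, of "Suc x"] by linarith
    then have "c (x mod s) = 0 \<or> c (Suc (x mod s)) = 0" using c by (simp add: admissible_def)
    then show False using x x' sm by (auto simp: runner_set_def)
  qed
  moreover have "0 \<notin> ?B" using c by (simp add: runner_set_def admissible_def)
  ultimately show "?B \<in> core_beads s (2 * n + 3)"
    using finite_runner_set[OF s0] by (auto simp: core_beads_def)
qed

text \<open>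
  Closure under subtraction of \<open>s\<close> pushes the beads of each runner to the top.
\<close>

lemma core_is_runner_set:
  assumes s: "0 < s" and B: "finite B" "down_closed s B"
  shows "B = runner_set s (\<lambda>r. card {p. r + s * p \<in> B})"
proof -
  have set: "{p. r + s * p \<in> B} = {..<card {p. r + s * p \<in> B}}" for r
  proof (rule downset_eq_lessThan)
    have "(\<lambda>p. r + s * p) ` {p. r + s * p \<in> B} \<subseteq> B" by auto
    then show "finite {p. r + s * p \<in> B}"
      by (rule inj_on_finite[rotated]) (use s B in \<open>auto simp: inj_on_def\<close>)
    fix x y assume "x \<in> {p. r + s * p \<in> B}" "y < x"
    then show "y \<in> {p. r + s * p \<in> B}"
    proof (induction "x - y" arbitrary: y)
      case (Suc d)
      have "r + s * Suc y \<in> B"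
      proof (cases "Suc y = x")
        case False
        then show ?thesis using Suc.hyps(1)[of "Suc y"] Suc.hyps(2) Suc.prems by auto
      qed (use Suc.prems in auto)
      then have "r + s * Suc y - s \<in> B" using B(2) unfolding down_closed_def by auto
      then show ?case by simp
    qed simp
  qed
  have "x \<in> B \<longleftrightarrow> x \<in> runner_set s (\<lambda>r. card {p. r + s * p \<in> B})" for x
  proof -
    have "x \<in> B \<longleftrightarrow> x div s \<in> {p. x mod s + s * p \<in> B}" by simp
    then show ?thesis unfolding runner_set_def by (subst (asm) set) simp
  qed
  then show ?thesis by blast
qed

text \<open>
  The \<open>i\<close>-th entry encodes the neighbouring runners \<open>2 * i + 1\<close> and \<open>2 * i + 2\<close>, of which at most one carries beads: its sign tells
  which one. The value 0 is not used, so that an entry \<open>- 1\<close> stands for two empty runners.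
\<close>

definition beads_on :: "int list \<Rightarrow> nat \<Rightarrow> nat" where
  "beads_on vs r = (if r = 0 then 0 else if even r then nat (vs ! (r div 2 - 1)) else nat (- vs ! (r div 2) - 1))"

lemma beads_on_0 [simp]: "beads_on vs 0 = 0"
  and beads_on_even [simp]: "beads_on vs (Suc (Suc (2 * i))) = nat (vs ! i)"
  and beads_on_odd [simp]: "beads_on vs (Suc (2 * i)) = nat (- vs ! i - 1)"
  by (simp_all add: beads_on_def)

lemma chain_iff_nth:
  "chain p vs \<longleftrightarrow> (\<forall>i<length vs. allowed (if i = 0 then p else vs ! (i - 1)) (vs ! i))"
proof (induction vs arbitrary: p)
  case (Cons v vs)
  show ?case
    unfolding chain.simps Cons.IH by (auto simp: less_Suc_eq_0_disj nth_Cons split: nat.split if_splits) (metis Suc_pred gr0I)+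
qed simp

text \<open>
  The three conditions are the growth bound on the even runners, the growth bound on the odd runners and the absence of consecutive beads.
\<close>

lemma allowed_iff_beads_on:
  "u \<noteq> 0 \<Longrightarrow> v \<noteq> 0 \<Longrightarrow> allowed u v \<longleftrightarrow>
     nat v \<le> nat u + 1 \<and> nat (- v - 1) \<le> nat (- u - 1) + 1 \<and> (nat u = 0 \<or> nat (- v - 1) = 0)"
  by (cases "0 < u"; cases "0 < v") (auto simp: allowed_def zero_less_mult_iff nat_le_iff)

lemma allowed_entry_iff:
  "v \<noteq> 0 \<Longrightarrow> allowed (entry b) v \<longleftrightarrow> nat v \<le> 1 \<and> nat (- v - 1) \<le> nat b + 2"
  by (cases "0 < b"; cases "0 < v") (auto simp: allowed_def entry_def zero_less_mult_iff nat_le_iff)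

lemma admissible_iff_chain:
  assumes n: "0 < n" "length vs = n" and nz: "0 \<notin> set vs"
  shows "admissible n (beads_on vs) \<longleftrightarrow> chain (entry (last vs)) vs"
proof -
  have nz': "vs ! i \<noteq> 0" if "i < n" for i using nz n that by (metis nth_mem)
  have last: "last vs = vs ! (n - 1)" using n by (metis last_conv_nth length_0_conv less_irrefl)
  have beads_on_2n: "beads_on vs (2 * n) = nat (last vs)"
    using n beads_on_even[of vs "n - 1"] by (cases n) (auto simp: last)
  have "chain (entry (last vs)) vs \<longleftrightarrow>
     (nat (vs ! 0) \<le> 1 \<and> nat (- vs ! 0 - 1) \<le> nat (last vs) + 2) \<and>
     (\<forall>i. Suc i < n \<longrightarrow> nat (vs ! Suc i) \<le> nat (vs ! i) + 1 \<and> nat (- vs ! Suc i - 1) \<le> nat (- vs ! i - 1) + 1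
        \<and> (nat (vs ! i) = 0 \<or> nat (- vs ! Suc i - 1) = 0))" (is "_ \<longleftrightarrow> ?R")
  proof -
    have "chain (entry (last vs)) vs \<longleftrightarrow> allowed (entry (last vs)) (vs ! 0) \<and> (\<forall>i. Suc i < n \<longrightarrow> allowed (vs ! i) (vs ! Suc i))"
      unfolding chain_iff_nth n(2) using n(1)
      by (auto split: if_splits) (metis Suc_pred diff_Suc_1 not_gr_zero)
    then show ?thesis
      using allowed_entry_iff[OF nz'[OF n(1)]] allowed_iff_beads_on[OF nz' nz'] by (metis Suc_lessD)
  qed
  also have "?R \<longleftrightarrow> admissible n (beads_on vs)"
  proof
    assume R: ?R
    have "beads_on vs r \<le> beads_on vs (r - 2) + 1" if r: "2 \<le> r" "r \<le> 2 * n" for r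
    proof (cases "even r")
      case True
      then obtain i where i: "r = Suc (Suc (2 * i))" using r by (metis add_2_eq_Suc dvd_def le_add_diff_inverse mult_Suc_right dvd_diff_nat dvd_refl)
      show ?thesis
      proof (cases i)
        case 0
        then show ?thesis using R i beads_on_even[of vs 0] by simp
      next
        case (Suc k)
        then have "nat (vs ! Suc k) \<le> nat (vs ! k) + 1" using R i r by auto
        then show ?thesis using beads_on_even[of vs i] beads_on_even[of vs k] i Suc by simp
      qed
    next
      case False
      then obtain i where "r = Suc (2 * i)" by (metis Suc_eq_plus1 oddE)
      moreover obtain k where "i = Suc k" using r calculation by (cases i) auto
      ultimately have i: "r = Suc (2 * Suc k)" "Suc k < n" using r by auto
      then have "nat (- vs ! Suc k - 1) \<le> nat (- vs ! k - 1) + 1" using R by blast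
      then show ?thesis using beads_on_odd[of vs "Suc k"] beads_on_odd[of vs k] i by simp
    qed
    moreover have "beads_on vs 1 \<le> beads_on vs (2 * n) + 2"
      using R beads_on_odd[of vs 0] unfolding beads_on_2n by simp
    moreover have "beads_on vs r = 0 \<or> beads_on vs (Suc r) = 0" if r: "r < 2 * n" for r
    proof (cases "even r")
      case False
      then obtain i where "r = Suc (2 * i)" by (metis Suc_eq_plus1 oddE)
      then show ?thesis using beads_on_odd[of vs i] beads_on_even[of vs i] by auto
    next
      case True
      then obtain i where i: "r = 2 * i" by (elim evenE)
      show ?thesis
      proof (cases i)
        case (Suc k)
        then have "nat (vs ! k) = 0 \<or> nat (- vs ! Suc k - 1) = 0" using R r i by auto
        then show ?thesis using beads_on_odd[of vs "Suc k"] beads_on_even[of vs k] i Suc by auto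
      qed (simp add: i)
    qed
    ultimately show "admissible n (beads_on vs)" by (simp add: admissible_def)
  next
    assume c: "admissible n (beads_on vs)"
    have step: "beads_on vs r \<le> beads_on vs (r - 2) + 1" if "2 \<le> r" "r \<le> 2 * n" for r
      using c that by (simp add: admissible_def)
    have adj: "beads_on vs r = 0 \<or> beads_on vs (Suc r) = 0" if "r < 2 * n" for r
      using c that by (simp add: admissible_def)
    have first: "beads_on vs 1 \<le> nat (last vs) + 2" using c unfolding beads_on_2n[symmetric] by (simp add: admissible_def)
    show ?R
    proof (intro conjI allI impI)
      show "nat (vs ! 0) \<le> 1" using step[of 2] n beads_on_even[of vs 0] by (simp add: numeral_2_eq_2)
      show "nat (- vs ! 0 - 1) \<le> nat (last vs) + 2" using first beads_on_odd[of vs 0] by simp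
      fix i assume i: "Suc i < n"
      show "nat (vs ! Suc i) \<le> nat (vs ! i) + 1"
        using step[of "Suc (Suc (2 * Suc i))"] i beads_on_even[of vs "Suc i"] beads_on_even[of vs i] by simp
      show "nat (- vs ! Suc i - 1) \<le> nat (- vs ! i - 1) + 1"
        using step[of "Suc (2 * Suc i)"] i beads_on_odd[of vs "Suc i"] beads_on_odd[of vs i] by simp
      show "nat (vs ! i) = 0 \<or> nat (- vs ! Suc i - 1) = 0"
        using adj[of "Suc (Suc (2 * i))"] i beads_on_odd[of vs "Suc i"] beads_on_even[of vs i] by simp
    qed
  qed
  finally show ?thesis by simp
qed

lemma configs_nonzero: "vs \<in> configs n \<Longrightarrow> 0 \<notin> set vs"
  by (auto simp: configs_def chain_iff_nth in_set_conv_nth allowed_def)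

definition abacus :: "nat \<Rightarrow> int list \<Rightarrow> nat set" where
  "abacus n vs = runner_set (2 * n + 1) (beads_on vs)"

lemma runner_set_cong: "0 < s \<Longrightarrow> (\<And>r. r < s \<Longrightarrow> c r = c' r) \<Longrightarrow> runner_set s c = runner_set s c'"
  by (simp add: runner_set_def)

lemma abacus_bij:
  assumes n: "0 < n"
  shows "bij_betw (abacus n) (configs n) (core_beads (2 * n + 1) (2 * n + 3))"
  unfolding bij_betw_def
proof
  let ?s = "2 * n + 1"
  show "inj_on (abacus n) (configs n)"
  proof (rule inj_onI)
    fix vs us assume vs: "vs \<in> configs n" and us: "us \<in> configs n" and eq: "abacus n vs = abacus n us"
    have c: "beads_on vs r = beads_on us r" if r: "r < ?s" for r
    proof -
      have "p < beads_on vs r \<longleftrightarrow> p < beads_on us r" for p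
        using eq runner_mem[OF r, of p "beads_on vs"] runner_mem[OF r, of p "beads_on us"] by (simp add: abacus_def)
      then show ?thesis by (metis less_irrefl nat_neq_iff)
    qed
    show "vs = us"
    proof (rule nth_equalityI)
      show len: "length vs = length us" using vs us by (simp add: configs_def)
      fix i assume i: "i < length vs"
      then have "vs ! i \<noteq> 0" "us ! i \<noteq> 0" using configs_nonzero[OF vs] configs_nonzero[OF us] len by (metis nth_mem)+
      moreover have "i < n" using i vs by (simp add: configs_def)
      then have "nat (vs ! i) = nat (us ! i)" "nat (- vs ! i - 1) = nat (- us ! i - 1)"
        using c[of "Suc (Suc (2 * i))"] c[of "Suc (2 * i)"] by simp_all
      ultimately show "vs ! i = us ! i" by linarith
    qed
  qed
  show "abacus n ` configs n = core_beads ?s (2 * n + 3)"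
  proof (intro equalityI subsetI)
    fix B assume "B \<in> abacus n ` configs n"
    then obtain vs where vs: "vs \<in> configs n" "B = runner_set ?s (beads_on vs)" by (auto simp: abacus_def)
    then show "B \<in> core_beads ?s (2 * n + 3)"
      using runner_set_core[OF n refl, of "beads_on vs"] admissible_iff_chain[OF n _ configs_nonzero[OF vs(1)]]
      by (simp add: configs_def)
  next
    fix B assume B: "B \<in> core_beads ?s (2 * n + 3)"
    define c where "c r = card {p. r + ?s * p \<in> B}" for r
    have Bc: "B = runner_set ?s c"
      unfolding c_def using B by (intro core_is_runner_set) (auto simp: core_beads_def)
    then have adm: "admissible n c" using runner_set_core[OF n refl, of c] B by simp
    \<comment> \<open>read off the runner pair \<open>2 * i + 1\<close>, \<open>2 * i + 2\<close>\<close>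
    define vs where "vs = map (\<lambda>i. if 0 < c (Suc (Suc (2 * i))) then int (c (Suc (Suc (2 * i)))) else - int (c (Suc (2 * i))) - 1) [0..<n]"
    have len: "length vs = n" by (simp add: vs_def)
    have cnt: "beads_on vs r = c r" if r: "r < ?s" for r
    proof (cases "r = 0")
      case True then show ?thesis using adm by (simp add: admissible_def)
    next
      case False
      show ?thesis
      proof (cases "even r")
        case True
        then obtain i where i: "r = Suc (Suc (2 * i))"
          using False by (metis even_Suc_Suc_iff evenE not0_implies_Suc odd_one One_nat_def)
        then have "i < n" using r by simp
        then show ?thesis unfolding i beads_on_even by (simp add: vs_def)
      next
        case False
        then obtain i where i: "r = Suc (2 * i)" by (metis Suc_eq_plus1 oddE)
        then have "i < n" using r by simp
        moreover have "c (Suc (2 * i)) = 0 \<or> c (Suc (Suc (2 * i))) = 0"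
          using adm \<open>i < n\<close> by (simp add: admissible_def)
        ultimately show ?thesis unfolding i beads_on_odd by (auto simp: vs_def)
      qed
    qed
    have B2: "B = abacus n vs"
      unfolding Bc abacus_def using cnt by (intro runner_set_cong) auto
    have nz: "0 \<notin> set vs" by (auto simp: vs_def)
    have "admissible n (beads_on vs)"
      using runner_set_core[OF n refl, of "beads_on vs"] B unfolding B2 abacus_def by simp
    then have "vs \<in> configs n" using admissible_iff_chain[OF n len nz] len by (simp add: configs_def)
    then show "B \<in> abacus n ` configs n" using B2 by blast
  qed
qed

section \<open>The size of a core partition in terms of its walk\<close>

lemma sum_odd_even: "(\<Sum>r<2 * n + 1. f r) = f 0 + (\<Sum>i<n. f (Suc (2 * i)) + f (Suc (Suc (2 * i))))"
  for f :: "nat \<Rightarrow> 'a::comm_monoid_add"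
  by (induction n) (simp_all add: add.assoc)

text \<open>
  A runner with \<open>m\<close> beads contributes \<open>r * m + s * m * (m - 1) / 2\<close> to the sum of all beads, and the size is this sum minus \<open>K * (K - 1) / 2\<close>
  for \<open>K\<close> beads. The linear terms are of lower order.
\<close>

lemma config_size_estimate:
  assumes n: "0 < n" and vs: "vs \<in> configs n"
  defines "B \<equiv> abacus n vs"
    and "S \<equiv> real_of_int (sum_list (map abs vs))" and "A \<equiv> real_of_int (sum_list (map power2 vs))"
  shows "\<bar>2 * real (\<Sum>B) - real (card B) ^ 2 + real (card B) - (2 * real n * A - S ^ 2)\<bar> \<le> A + 8 * real n * S"
proof -
  let ?s = "2 * n + 1"
  let ?u = "\<lambda>i. real (nat (- vs ! i - 1))" and ?w = "\<lambda>i. real (nat (vs ! i))"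
  define K where "K = (\<Sum>i<n. ?u i + ?w i)"
  define Q where "Q = (\<Sum>i<n. ?u i ^ 2 + ?w i ^ 2)"
  define L where "L = (\<Sum>i<n. real (Suc (2 * i)) * ?u i + real (Suc (Suc (2 * i))) * ?w i)"
  have len: "length vs = n" using vs by (simp add: configs_def)
  have S: "S = (\<Sum>i<n. real_of_int \<bar>vs ! i\<bar>)" and A: "A = (\<Sum>i<n. real_of_int (vs ! i) ^ 2)"
    by (simp_all add: S_def A_def sum_list_sum_nth len atLeast0LessThan)
  have split: "(\<Sum>r<?s. f r (beads_on vs r)) = (\<Sum>i<n. f (Suc (2 * i)) (nat (- vs ! i - 1)) + f (Suc (Suc (2 * i))) (nat (vs ! i)))"
    if "\<And>r. f r 0 = 0" for f :: "nat \<Rightarrow> nat \<Rightarrow> real"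
    unfolding sum_odd_even by (simp add: that)
  have card: "real (card B) = K"
  proof -
    have "card B = (\<Sum>r<?s. beads_on vs r)"
      unfolding B_def abacus_def card_eq_sum by (subst sum_runner_set) simp_all
    then show ?thesis using split[of "\<lambda>r m. real m"] by (simp add: K_def)
  qed
  have row: "2 * (\<Sum>p<m. real r + real ?s * real p) = 2 * (real r * real m) + real ?s * (real m ^ 2 - real m)" for r m
    by (induction m) (simp_all add: power2_eq_square algebra_simps)
  have "real (\<Sum>B) = (\<Sum>r<?s. \<Sum>p<beads_on vs r. real r + real ?s * real p)"
    unfolding B_def abacus_def by (subst sum_runner_set) (simp_all only: of_nat_sum of_nat_add of_nat_mult add_gr_0 zero_less_one simp_thms)
  then have "2 * real (\<Sum>B) = (\<Sum>r<?s. 2 * (\<Sum>p<beads_on vs r. real r + real ?s * real p))"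
    by (simp only: sum_distrib_left)
  also have "\<dots> = (\<Sum>r<?s. 2 * (real r * real (beads_on vs r)) + real ?s * (real (beads_on vs r) ^ 2 - real (beads_on vs r)))"
    unfolding row ..
  also have "\<dots> = (\<Sum>i<n. (2 * (real (Suc (2 * i)) * ?u i) + real ?s * (?u i ^ 2 - ?u i))
       + (2 * (real (Suc (Suc (2 * i))) * ?w i) + real ?s * (?w i ^ 2 - ?w i)))"
    by (rule split[of "\<lambda>r m. 2 * (real r * real m) + real ?s * (real m ^ 2 - real m)"]) simp
  also have "\<dots> = 2 * L + real ?s * (Q - K)"
    unfolding L_def Q_def K_def sum_subtractf[symmetric] sum_distrib_left sum.distrib[symmetric]
    by (intro sum.cong refl) (simp add: algebra_simps)
  finally have sum: "2 * real (\<Sum>B) = 2 * L + real ?s * (Q - K)" .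
  have nz: "vs ! i \<noteq> 0" if "i < n" for i using configs_nonzero[OF vs] that len by (metis nth_mem)
  have i1: "\<bar>vs ! i\<bar> - 1 \<le> ?u i + ?w i \<and> ?u i + ?w i \<le> \<bar>vs ! i\<bar> \<and> 1 \<le> real_of_int \<bar>vs ! i\<bar>" if "i < n" for i
    using nz[OF that] by (cases "0 < vs ! i") auto
  have i2: "real_of_int (vs ! i) ^ 2 - 2 * \<bar>vs ! i\<bar> \<le> ?u i ^ 2 + ?w i ^ 2 \<and> ?u i ^ 2 + ?w i ^ 2 \<le> real_of_int (vs ! i) ^ 2"
    if "i < n" for i
  proof (cases "0 < vs ! i")
    case False
    then have neg: "real_of_int (vs ! i) \<le> -1" "?u i = - real_of_int (vs ! i) - 1" "?w i = 0" using nz[OF that] by auto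
    then show ?thesis by (simp add: power2_eq_square algebra_simps)
  qed auto
  have "K \<le> S" unfolding K_def S using i1 by (intro sum_mono) auto
  moreover have "S - real n \<le> K"
  proof -
    have "(\<Sum>i<n. real_of_int \<bar>vs ! i\<bar> - 1) \<le> K" unfolding K_def using i1 by (intro sum_mono) auto
    then show ?thesis by (simp add: S sum_subtractf)
  qed
  moreover have "0 \<le> K" by (auto simp: K_def intro!: sum_nonneg)
  moreover have "Q \<le> A" unfolding Q_def A using i2 by (intro sum_mono) auto
  moreover have "A - 2 * S \<le> Q"
  proof -
    have "(\<Sum>i<n. real_of_int (vs ! i) ^ 2 - 2 * \<bar>vs ! i\<bar>) \<le> Q" unfolding Q_def using i2 by (intro sum_mono) auto
    then show ?thesis by (simp add: S A sum_subtractf sum_distrib_left)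
  qed
  moreover have "0 \<le> L" by (auto simp: L_def intro!: sum_nonneg)
  moreover have "L \<le> 2 * real n * K"
    unfolding L_def K_def sum_distrib_left distrib_left by (intro sum_mono add_mono mult_right_mono) auto
  moreover have "0 \<le> A" by (auto simp: A intro!: sum_nonneg)
  ultimately have b: "K \<le> S" "S - real n \<le> K" "0 \<le> K" "Q \<le> A" "A - 2 * S \<le> Q" "0 \<le> L" "L \<le> 2 * real n * K" "0 \<le> A" .
  have n1: "1 \<le> real n" using n by simp
  have S0: "0 \<le> S" using b by linarith
  have nS: "S \<le> real n * S" using mult_right_mono[OF n1 S0] by simp
  have nK: "real n * K \<le> real n * S" using b by (intro mult_left_mono) auto
  have nK0: "0 \<le> real n * K" using b by simp
  have nQ: "real n * Q \<le> real n * A" using b by (intro mult_left_mono) auto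
  have nQ': "real n * (A - 2 * S) \<le> real n * Q" using b by (intro mult_left_mono) auto
  have SK: "0 \<le> S ^ 2 - K ^ 2" "S ^ 2 - K ^ 2 \<le> 2 * (real n * S)"
  proof -
    show "0 \<le> S ^ 2 - K ^ 2" using power_mono[OF b(1,3), of 2] by simp
    have "S ^ 2 - K ^ 2 = (S - K) * (S + K)" by (simp add: power2_eq_square algebra_simps)
    also have "\<dots> \<le> real n * (2 * S)" using b S0 by (intro mult_mono) auto
    finally show "S ^ 2 - K ^ 2 \<le> 2 * (real n * S)" by simp
  qed
  have "2 * real (\<Sum>B) - real (card B) ^ 2 + real (card B) - (2 * real n * A - S ^ 2)
     = 2 * L + (2 * (real n * Q) + Q - 2 * (real n * A)) - 2 * (real n * K) + (S ^ 2 - K ^ 2)"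
    unfolding sum card by (simp add: algebra_simps)
  moreover have "real n * A - 2 * (real n * S) \<le> real n * Q" using nQ' by (simp add: algebra_simps)
  moreover have "L \<le> 2 * (real n * K)" using b(7) by simp
  ultimately show ?thesis
    using b(1-6) b(8) nS nK nK0 nQ SK S0 unfolding mult.assoc by (smt (verit))
qed

definition core_of_walk :: "nat \<Rightarrow> int list \<Rightarrow> nat list" where
  "core_of_walk n w = the_inv_into (distinct_cores (2 * n + 1) (2 * n + 3)) beads (abacus n (walk_config w))"

lemma core_of_walk_bij:
  assumes n: "0 < n"
  shows "bij_betw (core_of_walk n) (walks (2 * n)) (distinct_cores (2 * n + 1) (2 * n + 3))"
proof -
  have beads: "bij_betw beads (distinct_cores (2 * n + 1) (2 * n + 3)) (core_beads (2 * n + 1) (2 * n + 3))"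
    by (rule distinct_cores_beads_bij) auto
  have "bij_betw (abacus n \<circ> walk_config) (walks (2 * n)) (core_beads (2 * n + 1) (2 * n + 3))"
    using walk_config_bij[OF n] abacus_bij[OF n] by (rule bij_betw_trans)
  from bij_betw_trans[OF this bij_betw_the_inv_into[OF beads]]
  show ?thesis by (rule bij_betw_cong[THEN iffD1, rotated]) (simp add: core_of_walk_def)
qed

lemma core_size_estimate:
  assumes n: "0 < n" and w: "w \<in> walks (2 * n)"
  shows "\<bar>8 * psize (core_of_walk n w) - (4 * real n * of_int (square_sum w) - of_int (area w) ^ 2)\<bar>
    \<le> 1000 * (real n * of_int (area w) + real n ^ 2 + of_int (square_sum w))"
proof -
  define vs where "vs = walk_config w"
  define S where "S = real_of_int (sum_list (map abs vs))"
  define A where "A = real_of_int (sum_list (map power2 vs))"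
  define T where "T = real_of_int (area w)"
  define M where "M = real_of_int (square_sum w)"
  let ?l = "core_of_walk n w" and ?B = "abacus n vs"
  have vs: "vs \<in> configs n" using walk_config_bij[OF n] w by (auto simp: vs_def bij_betw_def)
  have beads: "bij_betw beads (distinct_cores (2 * n + 1) (2 * n + 3)) (core_beads (2 * n + 1) (2 * n + 3))"
    by (rule distinct_cores_beads_bij) auto
  have "?B \<in> core_beads (2 * n + 1) (2 * n + 3)" using abacus_bij[OF n] vs by (auto simp: bij_betw_def)
  then have B: "beads ?l = ?B"
    using beads unfolding core_of_walk_def vs_def by (intro f_the_inv_into_f_bij_betw) auto
  have "is_partition ?l" using core_of_walk_bij[OF n] w by (auto simp: bij_betw_def distinct_cores_def)
  from psize_beads[OF this] have X: "\<bar>2 * psize ?l - (2 * real n * A - S ^ 2)\<bar> \<le> A + 8 * real n * S"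
    using config_size_estimate[OF n vs] unfolding B by (simp add: A_def S_def)
  have n1: "1 \<le> real n" using n by simp
  have T0: "0 \<le> T" and M0: "0 \<le> M" using area_nonneg square_sum_nonneg by (auto simp: T_def M_def)
  have e1: "\<bar>2 * S - T\<bar> \<le> 12 * real n"
    using walk_config_estimates(1)[OF w n] unfolding S_def T_def vs_def by linarith
  have e2: "\<bar>2 * A - M\<bar> \<le> 20 * T + 60 * real n"
    using walk_config_estimates(2)[OF w n] unfolding A_def T_def M_def vs_def by linarith
  have "\<bar>(2 * S) ^ 2 - T ^ 2\<bar> = \<bar>2 * S - T\<bar> * \<bar>2 * S + T\<bar>"
    by (simp add: abs_mult[symmetric] power2_eq_square algebra_simps)
  also have "\<dots> \<le> (12 * real n) * (2 * T + 12 * real n)"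
    using e1 T0 by (intro mult_mono) auto
  finally have e3: "\<bar>4 * S ^ 2 - T ^ 2\<bar> \<le> 24 * (real n * T) + 144 * real n ^ 2"
    by (simp add: power2_eq_square algebra_simps)
  have "real n * \<bar>2 * A - M\<bar> \<le> real n * (20 * T + 60 * real n)"
    using e2 by (intro mult_left_mono) auto
  then have e4: "\<bar>2 * (real n * A) - real n * M\<bar> \<le> 20 * (real n * T) + 60 * real n ^ 2"
  proof -
    have "2 * (real n * A) - real n * M = real n * (2 * A - M)" by (simp add: algebra_simps)
    moreover have "20 * (real n * T) + 60 * real n ^ 2 = real n * (20 * T + 60 * real n)"
      by (simp add: power2_eq_square algebra_simps)
    moreover assume "real n * \<bar>2 * A - M\<bar> \<le> real n * (20 * T + 60 * real n)"
    ultimately show ?thesis by (simp add: abs_mult)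
  qed
  have e5: "real n * S \<le> real n * T + 12 * real n ^ 2"
  proof -
    have "real n * S \<le> real n * (T + 12 * real n)" using e1 T0 by (intro mult_left_mono) auto
    then show ?thesis by (simp add: power2_eq_square algebra_simps)
  qed
  have nT: "T \<le> real n * T" using mult_right_mono[OF n1 T0] by simp
  have nn: "real n \<le> real n ^ 2" using n1 by (simp add: power2_eq_square)
  have "\<bar>2 * psize ?l - (2 * (real n * A) - S ^ 2)\<bar> \<le> A + 8 * (real n * S)"
    using X by (simp only: mult.assoc)
  then show ?thesis
    unfolding T_def[symmetric] M_def[symmetric] mult.assoc
    using e2 e3 e4 e5 nT nn M0 T0 by (smt (verit))
qed

section \<open>Generating functions of weighted paths\<close>

text \<open>
  The first position of a path is not weighted, so that weights multiply under concatenation.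
\<close>

fun path_weight :: "(nat \<Rightarrow> 'a::comm_ring_1) \<Rightarrow> nat \<Rightarrow> int \<Rightarrow> int \<Rightarrow> 'a" where
  "path_weight w 0 i j = (if i = j then 1 else 0)"
| "path_weight w (Suc N) i j =
     w (nat \<bar>i + 1\<bar>) * path_weight w N (i + 1) j + w (nat \<bar>i - 1\<bar>) * path_weight w N (i - 1) j"

lemma path_weight_last:
  "path_weight w (Suc N) i j =
     w (nat \<bar>j\<bar>) * (path_weight w N i (j - 1) + path_weight w N i (j + 1))"
proof (induction N arbitrary: i)
  case 0
  have e: "i + 1 = j \<longleftrightarrow> i = j - 1" "i - 1 = j \<longleftrightarrow> i = j + 1" by auto
  show ?case by (auto simp: e)
next
  case (Suc N)
  show ?case
    by (subst path_weight.simps(2), subst (1 2) Suc.IH) (simp add: algebra_simps)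
qed

text \<open>
  Reversing a path only exchanges which of its end points is not weighted.
\<close>

lemma path_weight_reverse:
  "w (nat \<bar>i\<bar>) * path_weight w N i j = w (nat \<bar>j\<bar>) * path_weight w N j i"
proof (induction N arbitrary: i j)
  case (Suc N)
  have "w (nat \<bar>j\<bar>) * path_weight w (Suc N) j i
      = w (nat \<bar>j\<bar>) * (w (nat \<bar>j + 1\<bar>) * path_weight w N (j + 1) i
                      + w (nat \<bar>j - 1\<bar>) * path_weight w N (j - 1) i)"
    by simp
  also have "\<dots> = w (nat \<bar>j\<bar>) * (w (nat \<bar>i\<bar>) * path_weight w N i (j + 1)
                      + w (nat \<bar>i\<bar>) * path_weight w N i (j - 1))"
    by (simp only: Suc.IH[of "j + 1" i] Suc.IH[of "j - 1" i])
  also have "\<dots> = w (nat \<bar>i\<bar>) * path_weight w (Suc N) i j"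
    by (simp only: path_weight_last) (simp add: algebra_simps)
  finally show ?case ..
qed auto

lemma path_weight_minus: "path_weight w N (- i) (- j) = path_weight w N i j"
proof (induction N arbitrary: i j)
  case (Suc N)
  have "- i + 1 = - (i - 1)" "- i - 1 = - (i + 1)" by auto
  then show ?case by (simp only: path_weight.simps Suc.IH abs_minus_cancel) (simp add: algebra_simps)
qed auto

definition green :: "(nat \<Rightarrow> 'a::comm_ring_1) \<Rightarrow> int \<Rightarrow> int \<Rightarrow> 'a fps" where
  "green w i j = Abs_fps (\<lambda>N. path_weight w N i j)"

lemma green_step:
  "green w i j = (if i = j then 1 else 0) +
     fps_X * (fps_const (w (nat \<bar>i + 1\<bar>)) * green w (i + 1) j
            + fps_const (w (nat \<bar>i - 1\<bar>)) * green w (i - 1) j)"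
  (is "?l = ?r")
proof (rule fps_ext)
  fix N show "fps_nth ?l N = fps_nth ?r N"
    by (cases N) (auto simp: green_def fps_X_mult_nth)
qed

text \<open>
  The first passage from height \<open>h\<close> to \<open>h - 1\<close> either is a single step, or starts with a step up followed by two first passages.
  Defining the series by this recursion avoids a combinatorial model of first passages.
\<close>

fun descent_coeff :: "(nat \<Rightarrow> 'a::comm_ring_1) \<Rightarrow> nat \<Rightarrow> nat \<Rightarrow> 'a" where
  "descent_coeff w 0 h = 0"
| "descent_coeff w (Suc N) h = (if N = 0 then w (h - 1) else 0)
     + w (h + 1) * (\<Sum>a\<in>{..N}. descent_coeff w a (h + 1) * descent_coeff w (N - a) h)"

definition descent :: "(nat \<Rightarrow> 'a::comm_ring_1) \<Rightarrow> nat \<Rightarrow> 'a fps" where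
  "descent w h = Abs_fps (\<lambda>N. descent_coeff w N h)"

lemma descent_eq:
  "descent w h = fps_X * (fps_const (w (h - 1)) + fps_const (w (h + 1)) * descent w (h + 1) * descent w h)"
  (is "?l = ?r")
proof (rule fps_ext)
  fix N show "fps_nth ?l N = fps_nth ?r N"
  proof (cases N)
    case (Suc M)
    have "fps_nth (fps_const (w (h + 1)) * descent w (h + 1) * descent w h) M
      = w (h + 1) * (\<Sum>a\<le>M. descent_coeff w a (h + 1) * descent_coeff w (M - a) h)"
      unfolding mult.assoc fps_mult_left_const_nth
      by (simp add: descent_def fps_mult_nth atLeast0AtMost)
    then show ?thesis
      by (simp add: Suc fps_X_mult_nth) (simp add: descent_def)
  qed (simp add: descent_def)
qed

text \<open>
  As \<open>a i\<close> and \<open>b i\<close> have no constant term, each coefficient of \<open>d i\<close> is determined by earlier coefficients. All decompositions of paths below are obtained from this uniqueness.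
\<close>

lemma fps_system_zero:
  fixes d :: "nat \<Rightarrow> 'a::comm_ring_1 fps"
  assumes "\<And>i. d i = a i * d i + b i * d (Suc i)"
    and a: "\<And>i. fps_nth (a i) 0 = 0" and b: "\<And>i. fps_nth (b i) 0 = 0"
  shows "d i = 0"
proof -
  have "fps_nth (d i) N = 0" for N
  proof (induction N arbitrary: i rule: less_induct)
    case (less N)
    have z: "fps_nth (a i * d k) N = 0" if "fps_nth (a i) 0 = 0" for a k
    proof -
      have "fps_nth (a i) l * fps_nth (d k) (N - l) = 0" if "l \<le> N" for l
        using less.IH[of "N - l" k] that \<open>fps_nth (a i) 0 = 0\<close> by (cases "l = 0") auto
      then show ?thesis by (simp add: fps_mult_nth)
    qed
    have "fps_nth (d i) N = fps_nth (a i * d i + b i * d (Suc i)) N" using assms(1)[of i] by simp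
    then show ?case using z[of a i] z[of b "Suc i"] a b by simp
  qed
  then show ?thesis by (simp add: fps_eq_iff)
qed

text \<open>
  Any solution of the path recursion above height 0 factors through the first passage downwards.
\<close>

lemma descent_unique:
  assumes "\<And>i. y (Suc i) = fps_X * (fps_const (w i) * y i + fps_const (w (Suc (Suc i))) * y (Suc (Suc i)))"
  shows "y (Suc i) = descent w (Suc i) * y i"
proof -
  define d where "d i = y (Suc i) - descent w (Suc i) * y i" for i
  have "d i = (fps_X * fps_const (w (Suc (Suc i))) * descent w (Suc (Suc i))) * d i
            + (fps_X * fps_const (w (Suc (Suc i)))) * d (Suc i)" for i
  proof -
    have F: "descent w (Suc i) * y i = fps_X * (fps_const (w i)
       + fps_const (w (Suc (Suc i))) * descent w (Suc (Suc i)) * descent w (Suc i)) * y i"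
      by (subst descent_eq) simp
    have "d i = fps_X * (fps_const (w i) * y i + fps_const (w (Suc (Suc i))) * y (Suc (Suc i)))
      - fps_X * (fps_const (w i)
       + fps_const (w (Suc (Suc i))) * descent w (Suc (Suc i)) * descent w (Suc i)) * y i"
      unfolding d_def F[symmetric] using assms[of i] by simp
    then show ?thesis unfolding d_def by (simp add: algebra_simps)
  qed
  then have "d i = 0" by (rule fps_system_zero[where d = d]) simp_all
  then show ?thesis unfolding d_def by simp
qed

text \<open>
  The series of excursions from height \<open>h\<close> that stay above \<open>h\<close> until they return to it.
\<close>

definition arch :: "(nat \<Rightarrow> 'a::comm_ring_1) \<Rightarrow> nat \<Rightarrow> 'a fps" where
  "arch w h = fps_X * fps_const (w (Suc h)) * descent w (Suc h)"

lemma arch_nth_0 [simp]: "fps_nth (arch w h) 0 = 0"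
  by (simp add: arch_def)

lemma descent_arch: "descent w (Suc h) * (1 - arch w (Suc h)) = fps_X * fps_const (w h)"
proof -
  have "descent w (Suc h) = fps_X * fps_const (w h) + arch w (Suc h) * descent w (Suc h)"
    by (subst descent_eq) (simp add: arch_def algebra_simps)
  then show ?thesis by (simp add: algebra_simps)
qed

lemma arch_eq: "arch w h * (1 - arch w (Suc h)) = fps_X ^ 2 * fps_const (w (Suc h) * w h)"
proof -
  have "arch w h * (1 - arch w (Suc h))
      = fps_X * fps_const (w (Suc h)) * (descent w (Suc h) * (1 - arch w (Suc h)))"
    by (simp add: arch_def mult.assoc)
  then show ?thesis unfolding descent_arch
    by (simp add: power2_eq_square algebra_simps flip: fps_const_mult)
qed

abbreviation euler :: "'a::comm_ring_1 fps \<Rightarrow> 'a fps" where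
  "euler f \<equiv> fps_X * fps_deriv f"

text \<open>
  The Euler operator marks a step of a first passage; following the mark upwards level by level gives a recursion in the height.
\<close>

lemma euler_descent:
  "fps_X * fps_const (w h) * euler (descent w (Suc h))
     = descent w (Suc h) ^ 2 * (1 + fps_X * fps_const (w (Suc (Suc h))) * euler (descent w (Suc (Suc h))))"
proof -
  have ring: "x * a * (x * f') = f ^ 2 * (1 + x * c * (x * g'))"
    if f: "f = x * (a + c * g * f)" and d: "f' = (a + c * g * f) + x * (c * (g' * f + g * f'))"
    for x a c f f' g g' :: "'a fps"
  proof -
    have "x * f' = x * ((a + c * g * f) + x * (c * (g' * f + g * f')))" by (rule arg_cong[OF d])
    also have "\<dots> = x * (a + c * g * f) + x * x * c * g' * f + x * x * c * g * f'"
      by (simp add: algebra_simps)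
    also have "x * (a + c * g * f) = f" by (rule f[symmetric])
    finally have e: "x * f' - x * x * c * g * f' = f + x * x * c * g' * f"
      by (simp only: diff_eq_eq)
    have "x * a + x * c * g * f = x * (a + c * g * f)" by (simp add: algebra_simps)
    also have "\<dots> = f" by (rule f[symmetric])
    finally have h: "x * a = f - x * c * g * f" by (simp only: eq_diff_eq)
    have "x * a * (x * f') = f * (x * f' - x * x * c * g * f')"
      unfolding h by (simp add: algebra_simps)
    then show ?thesis unfolding e by (simp add: algebra_simps power2_eq_square)
  qed
  let ?f = "descent w (Suc h)" and ?g = "descent w (Suc (Suc h))"
  have f: "?f = fps_X * (fps_const (w h) + fps_const (w (Suc (Suc h))) * ?g * ?f)"
    by (subst descent_eq) simp
  have "fps_deriv ?f = fps_deriv (fps_X * (fps_const (w h) + fps_const (w (Suc (Suc h))) * ?g * ?f))"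
    by (rule arg_cong[OF f])
  also have "\<dots> = (fps_const (w h) + fps_const (w (Suc (Suc h))) * ?g * ?f)
     + fps_X * (fps_const (w (Suc (Suc h))) * (fps_deriv ?g * ?f + ?g * fps_deriv ?f))"
    by (simp only: fps_deriv_mult fps_deriv_add fps_deriv_const fps_deriv_fps_X) (simp add: algebra_simps)
  finally show ?thesis by (rule ring[OF f])
qed

lemma green_from_left:
  assumes "0 \<le> j"
  shows "green w (- int i) j = (\<Prod>l<i. descent w (Suc l)) * green w 0 j"
proof (induction i)
  case (Suc i)
  have "green w (- int (Suc i)) j = descent w (Suc i) * green w (- int i) j"
  proof (rule descent_unique[of "\<lambda>i. green w (- int i) j"])
    fix i
    have "nat \<bar>- int (Suc i) + 1\<bar> = i" "nat \<bar>- int (Suc i) - 1\<bar> = Suc (Suc i)"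
      "- int (Suc i) + 1 = - int i" "- int (Suc i) - 1 = - int (Suc (Suc i))" "- int (Suc i) \<noteq> j"
      using assms by auto
    then show "green w (- int (Suc i)) j = fps_X * (fps_const (w i) * green w (- int i) j
        + fps_const (w (Suc (Suc i))) * green w (- int (Suc (Suc i))) j)"
      using green_step[of w "- int (Suc i)" j] by simp
  qed
  then show ?case using Suc.IH by (simp add: mult_ac)
qed auto

lemma green_minus: "green w (- i) (- j) = green w i j"
  by (simp add: green_def path_weight_minus)

text \<open>
  A path from 0 to 0 is a sequence of arches of either sign.
\<close>

lemma green_0_0: "green w 0 0 * (1 - 2 * arch w 0) = 1"
proof -
  have l: "green w (-1) 0 = descent w 1 * green w 0 0"
    using green_from_left[of 0 w 1] by simp
  then have r: "green w 1 0 = descent w 1 * green w 0 0"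
    using green_minus[of w 1 0] by simp
  have "green w 0 0 = 1 + fps_X * (fps_const (w 1) * green w 1 0 + fps_const (w 1) * green w (-1) 0)"
    by (subst green_step) simp
  then have "green w 0 0 - 2 * (fps_X * (fps_const (w 1) * (descent w 1 * green w 0 0))) = 1"
    unfolding l r diff_eq_eq by (simp only: mult_2 distrib_left)
  then show ?thesis by (simp add: arch_def algebra_simps)
qed

text \<open>
  A path from \<open>- h\<close> to \<open>h\<close> climbs to 0, wanders there, and then makes the reversal of a descent from \<open>h\<close>.
\<close>

lemma green_crossing:
  assumes "w 0 = 1"
  shows "green w (- int h) (int h) = (\<Prod>l<h. descent w (Suc l)) ^ 2 * fps_const (w h) * green w 0 0"
proof -
  have "green w 0 (int h) = fps_const (w h) * green w (int h) 0"
    using path_weight_reverse[of w 0 _ "int h"] assms by (simp add: green_def fps_eq_iff)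
  also have "green w (int h) 0 = (\<Prod>l<h. descent w (Suc l)) * green w 0 0"
    using green_minus[of w "int h" 0] green_from_left[of 0 w h] by simp
  finally show ?thesis
    using green_from_left[of "int h" w h] by (simp add: power2_eq_square algebra_simps)
qed

text \<open>
  Splitting an arch at a marked point of height \<open>h\<close> yields two passages between 0 and \<open>h\<close>. Iterating the previous recursion makes the sum over \<open>h\<close> telescope.
\<close>

lemma sum_crossing:
  assumes "w 0 = 1"
  shows "(\<Sum>h<H. (\<Prod>l<Suc h. descent w (Suc l)) ^ 2 * fps_const (w (Suc h)))
     + (\<Prod>l<H. descent w (Suc l)) ^ 2 * fps_const (w H) * (fps_X * fps_const (w (Suc H)) * euler (descent w (Suc H)))
     = fps_X * fps_const (w 1) * euler (descent w 1)"
proof (induction H)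
  case 0 show ?case using assms by simp
next
  case (Suc H)
  let ?p = "\<lambda>h. (\<Prod>l<h. descent w (Suc l)) ^ 2"
  have "?p H * fps_const (w H) * (fps_X * fps_const (w (Suc H)) * euler (descent w (Suc H)))
     = ?p H * fps_const (w (Suc H)) * (fps_X * fps_const (w H) * euler (descent w (Suc H)))"
    by (simp only: mult_ac)
  also have "\<dots> = ?p (Suc H) * fps_const (w (Suc H)) *
      (1 + fps_X * fps_const (w (Suc (Suc H))) * euler (descent w (Suc (Suc H))))"
    by (simp only: euler_descent) (simp add: power_mult_distrib algebra_simps)
  finally show ?case using Suc.IH by (simp add: algebra_simps)
qed

definition loop_series :: "(nat \<Rightarrow> 'a::comm_ring_1) \<Rightarrow> 'a fps" where
  "loop_series w = Abs_fps (\<lambda>N. \<Sum>h\<in>{- int N..int N}. path_weight w N (- h) h)"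

text \<open>
  Rotating a path from \<open>- h\<close> to \<open>h\<close> shows an arch with a marked point, of either sign, together with a sequence of signed arches.
  Up to the constant term and the sign this is the logarithmic derivative of \<open>1 - 2 * arch\<close>.
\<close>

lemma loop_series_eq:
  fixes w :: "nat \<Rightarrow> 'a::comm_ring_1"
  assumes w0: "w 0 = 1"
  shows "loop_series w * (1 - 2 * arch w 0) = 1 + 2 * euler (arch w 0) - 2 * arch w 0"
proof -
  let ?p = "\<lambda>h. (\<Prod>l<h. descent w (Suc l)) ^ 2"
  let ?T = "fps_X * fps_const (w 1) * euler (descent w 1)"
  have X: "\<exists>g. descent w (Suc l) = fps_X * g" for l using descent_eq by blast
  have pX: "\<exists>g. ?p h = fps_X ^ (2 * h) * g" for h
  proof -
    from X obtain g where g: "\<And>l. descent w (Suc l) = fps_X * g l" by metis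
    have "?p h = fps_X ^ (2 * h) * (\<Prod>l<h. g l) ^ 2"
      by (simp add: g prod.distrib power_mult_distrib mult.commute flip: power_mult)
    then show ?thesis by blast
  qed
  have "fps_nth (loop_series w) N = fps_nth (green w 0 0 * (1 + 2 * ?T)) N" for N
  proof -
    have set: "{- int N..int N} = insert 0 ((\<lambda>h. int (Suc h)) ` {..<N} \<union> (\<lambda>h. - int (Suc h)) ` {..<N})"
    proof (intro equalityI subsetI)
      fix x assume x: "x \<in> {- int N..int N}"
      show "x \<in> insert 0 ((\<lambda>h. int (Suc h)) ` {..<N} \<union> (\<lambda>h. - int (Suc h)) ` {..<N})"
      proof (cases x "0::int" rule: linorder_cases)
        case less
        then have "x = - int (Suc (nat (- x - 1)))" "nat (- x - 1) < N" using x by auto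
        then show ?thesis by blast
      next
        case greater
        then have "x = int (Suc (nat (x - 1)))" "nat (x - 1) < N" using x by auto
        then show ?thesis by blast
      qed auto
    qed auto
    have "(\<Sum>h\<in>{- int N..int N}. path_weight w N (- h) h)
      = path_weight w N 0 0 + ((\<Sum>h\<in>(\<lambda>h. int (Suc h)) ` {..<N}. path_weight w N (- h) h)
         + (\<Sum>h\<in>(\<lambda>h. - int (Suc h)) ` {..<N}. path_weight w N (- h) h))"
      unfolding set by (subst sum.insert) (auto intro!: sum.union_disjoint)
    also have "(\<Sum>h\<in>(\<lambda>h. int (Suc h)) ` {..<N}. path_weight w N (- h) h)
        = (\<Sum>h<N. path_weight w N (- int (Suc h)) (int (Suc h)))"
      by (subst sum.reindex) (auto simp: inj_on_def)
    also have "(\<Sum>h\<in>(\<lambda>h. - int (Suc h)) ` {..<N}. path_weight w N (- h) h)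
        = (\<Sum>h<N. path_weight w N (- int (Suc h)) (int (Suc h)))"
      using path_weight_minus[of w N "- int (Suc _)" "int (Suc _)"]
      by (subst sum.reindex) (auto simp: inj_on_def intro!: sum.cong)
    finally have 1: "fps_nth (loop_series w) N = fps_nth (green w 0 0) N
        + 2 * (\<Sum>h<N. fps_nth (green w (- int (Suc h)) (int (Suc h))) N)"
      by (simp add: loop_series_def green_def)
    have "(\<Sum>h<N. fps_nth (green w (- int (Suc h)) (int (Suc h))) N)
       = fps_nth (green w 0 0 * (\<Sum>h<N. ?p (Suc h) * fps_const (w (Suc h)))) N"
      by (simp only: green_crossing[of w, OF w0] sum_distrib_left fps_sum_nth) (simp only: mult_ac)
    also have "(\<Sum>h<N. ?p (Suc h) * fps_const (w (Suc h))) = ?T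
       - ?p N * fps_const (w N) * (fps_X * fps_const (w (Suc N)) * euler (descent w (Suc N)))"
      using sum_crossing[of w N, OF w0] by (simp add: eq_diff_eq)
    finally have 2: "(\<Sum>h<N. fps_nth (green w (- int (Suc h)) (int (Suc h))) N)
       = fps_nth (green w 0 0 * ?T) N - fps_nth (green w 0 0 *
          (?p N * fps_const (w N) * (fps_X * fps_const (w (Suc N)) * euler (descent w (Suc N))))) N"
      by (simp add: right_diff_distrib)
    obtain g where g: "?p N = fps_X ^ (2 * N) * g" using pX by blast
    have "green w 0 0 * (?p N * fps_const (w N) * (fps_X * fps_const (w (Suc N)) * euler (descent w (Suc N))))
       = fps_X ^ (2 * N + 1) * (green w 0 0 * g * fps_const (w N) * fps_const (w (Suc N)) * euler (descent w (Suc N)))"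
      unfolding g by (simp add: algebra_simps)
    then have "fps_nth (green w 0 0 *
          (?p N * fps_const (w N) * (fps_X * fps_const (w (Suc N)) * euler (descent w (Suc N))))) N = 0"
      by (simp only: fps_X_power_mult_nth) simp
    moreover have "fps_nth (green w 0 0 * (1 + 2 * ?T)) N
        = fps_nth (green w 0 0) N + 2 * fps_nth (green w 0 0 * ?T) N"
    proof -
      have "green w 0 0 * (1 + 2 * ?T) = green w 0 0 + (green w 0 0 * ?T + green w 0 0 * ?T)"
        by (simp add: algebra_simps)
      then show ?thesis by (simp only: fps_add_nth) simp
    qed
    ultimately show ?thesis using 1 2 by (simp only: diff_zero)
  qed
  then have "loop_series w = green w 0 0 * (1 + 2 * ?T)" by (simp add: fps_eq_iff)
  then have "loop_series w * (1 - 2 * arch w 0) = (green w 0 0 * (1 - 2 * arch w 0)) * (1 + 2 * ?T)"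
    by (simp add: mult_ac)
  also have "\<dots> = 1 + 2 * ?T" by (simp add: green_0_0)
  also have "?T = euler (arch w 0) - arch w 0"
    by (simp add: arch_def algebra_simps)
  finally show ?thesis by (simp add: algebra_simps)
qed

section \<open>Laurent polynomials in the discriminant root\<close>

text \<open>
  The series \<open>(1 - 4 x\<^sup>2) powr (r / 2)\<close>.
\<close>

definition delta_pow :: "real \<Rightarrow> real fps" where
  "delta_pow r = (fps_binomial (r / 2) oo (fps_const (-4) * fps_X)) oo (fps_X ^ 2)"

abbreviation delta :: "real fps" where "delta \<equiv> delta_pow 1"

lemma delta_pow_add: "delta_pow (r + s) = delta_pow r * delta_pow s"
proof -
  have "fps_binomial ((r + s) / 2) = fps_binomial (r / 2) * fps_binomial (s / 2)"
    by (simp add: fps_binomial_add_mult add_divide_distrib)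
  then show ?thesis
    by (simp add: delta_pow_def fps_compose_mult_distrib)
qed

lemma delta_pow_0 [simp]: "delta_pow 0 = 1"
  by (simp add: delta_pow_def)

lemma delta_pow_of_nat: "delta_pow (real k) = delta ^ k"
  by (induction k) (simp_all add: delta_pow_add)

lemma delta_square: "delta ^ 2 = 1 - 4 * fps_X ^ 2"
proof -
  have "fps_binomial (1::real) = 1 + fps_X"
    using fps_binomial_1 by simp
  then have "delta_pow 2 = 1 - 4 * fps_X ^ 2"
    by (simp add: delta_pow_def fps_compose_add_distrib fps_compose_sub_distrib fps_compose_mult_distrib
        numeral_fps_const flip: fps_const_neg)
  then show ?thesis using delta_pow_of_nat[of 2] by simp
qed

lemma delta_nth_0 [simp]: "fps_nth delta 0 = 1"
  by (simp add: delta_pow_def)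

lemma delta_nonzero [simp]: "delta \<noteq> 0"
  using delta_nth_0 by (metis fps_zero_nth zero_neq_one)

lemma fps_compose_X_square_nth: "fps_nth (f oo fps_X ^ 2) (2 * n) = fps_nth f n"
proof -
  have "fps_nth (f oo fps_X ^ 2) (2 * n) = (\<Sum>i\<in>{0..2 * n}. if i = n then fps_nth f i else 0)"
    unfolding fps_compose_nth by (intro sum.cong) (auto simp: fps_X_power_nth simp flip: power_mult)
  then show ?thesis by (simp add: sum.delta)
qed

lemma delta_pow_coeff: "fps_nth (delta_pow (- r)) (2 * n) = 4 ^ n * (pochhammer (r / 2) n / fact n)"
proof -
  have "fps_nth (delta_pow (- r)) (2 * n) = (-4) ^ n * (- r / 2 gchoose n)"
    unfolding delta_pow_def fps_compose_X_square_nth fps_compose_linear by simp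
  also have "\<dots> = ((-4) * (-1)) ^ n * (pochhammer (r / 2) n / fact n)"
    unfolding gbinomial_pochhammer power_mult_distrib by simp
  finally show ?thesis by simp
qed

lemma euler_delta: "delta * euler delta = delta ^ 2 - 1"
proof -
  have "fps_deriv (delta ^ 2) = fps_deriv (1 - 4 * fps_X ^ 2)" by (simp only: delta_square)
  then have "2 * (delta * fps_deriv delta) = - (8 * fps_X)"
    by (simp add: power2_eq_square algebra_simps fps_deriv_power numeral_fps_const)
  then have "2 * (delta * euler delta) = 2 * (delta ^ 2 - 1)"
    unfolding delta_square by (simp add: algebra_simps power2_eq_square)
  then show ?thesis by (rule mult_left_cancel[THEN iffD1, rotated]) simp
qed

text \<open>
  The ring of polynomials in \<open>delta\<close>, in Horner form.
\<close>

inductive_set delta_polys :: "real fps set" where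
  zero: "0 \<in> delta_polys"
| step: "f \<in> delta_polys \<Longrightarrow> fps_const c + delta * f \<in> delta_polys"

lemma delta_polys_const [simp, intro]: "fps_const c \<in> delta_polys"
  using delta_polys.step[OF delta_polys.zero, of c] by simp

lemma delta_polys_times_delta: "f \<in> delta_polys \<Longrightarrow> delta * f \<in> delta_polys"
  using delta_polys.step[of f 0] by simp

lemma delta_polys_add [intro]: "f \<in> delta_polys \<Longrightarrow> g \<in> delta_polys \<Longrightarrow> f + g \<in> delta_polys"
proof (induction arbitrary: g rule: delta_polys.induct)
  case (step f c)
  from step.prems show ?case
  proof cases
    case zero then show ?thesis using step.hyps by (simp add: delta_polys.step)
  next
    case (step g' d)
    have "fps_const c + delta * f + g = fps_const (c + d) + delta * (f + g')"
      by (simp add: step algebra_simps flip: fps_const_add)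
    then show ?thesis using step.IH[of g'] step by (simp add: delta_polys.step)
  qed
qed simp

lemma delta_polys_scale: "f \<in> delta_polys \<Longrightarrow> fps_const c * f \<in> delta_polys"
proof (induction rule: delta_polys.induct)
  case (step f d)
  have "fps_const c * (fps_const d + delta * f) = fps_const (c * d) + delta * (fps_const c * f)"
    by (simp add: algebra_simps)
  then show ?case using step.IH by (simp add: delta_polys.step)
qed (simp add: delta_polys.zero)

lemma delta_polys_mult [intro]: "f \<in> delta_polys \<Longrightarrow> g \<in> delta_polys \<Longrightarrow> f * g \<in> delta_polys"
proof (induction rule: delta_polys.induct)
  case (step f c)
  have "(fps_const c + delta * f) * g = fps_const c * g + delta * (f * g)"
    by (simp add: algebra_simps)
  then show ?case using step.IH[OF step.prems] delta_polys_scale[OF step.prems]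
    by (simp add: delta_polys_add delta_polys_times_delta)
qed (simp add: delta_polys.zero)

lemma delta_polys_delta [simp, intro]: "delta \<in> delta_polys"
  using delta_polys_times_delta[of 1] delta_polys_const[of 1] by simp

lemma delta_polys_power [intro]: "f \<in> delta_polys \<Longrightarrow> f ^ n \<in> delta_polys"
  using delta_polys_const[of 1] by (induction n) auto

lemma delta_polys_euler: "f \<in> delta_polys \<Longrightarrow> delta * euler f \<in> delta_polys"
proof (induction rule: delta_polys.induct)
  case (step f c)
  have "delta * euler (fps_const c + delta * f) = (delta * euler delta) * f + delta * (delta * euler f)"
    by (simp add: algebra_simps)
  also have "\<dots> = fps_const (-1) * f + delta * (delta * f) + delta * (delta * euler f)"
    unfolding euler_delta by (simp add: algebra_simps power2_eq_square flip: fps_const_neg)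
  finally show ?case
    using delta_polys_add[OF delta_polys_add[OF delta_polys_scale[OF step.hyps, of "-1"]
        delta_polys_times_delta[OF delta_polys_times_delta[OF step.hyps]]] delta_polys_times_delta[OF step.IH]]
    by (simp only:)
qed (simp add: delta_polys.zero)

text \<open>
  If \<open>f = delta ^ p * F\<close>, then \<open>lead f c\<close> says that \<open>F\<close> is a Laurent polynomial in \<open>delta\<close> with a pole of order at most \<open>p\<close> whose leading coefficient is \<open>c\<close>
  (where \<open>c = 0\<close> allows for a smaller order).
\<close>

definition lead :: "real fps \<Rightarrow> real \<Rightarrow> bool" where
  "lead f c \<longleftrightarrow> (\<exists>g\<in>delta_polys. f = fps_const c + delta * g)"

lemma lead_delta_polys: "lead f c \<Longrightarrow> f \<in> delta_polys"
  unfolding lead_def by (auto intro: delta_polys.step)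

lemma lead_const: "lead (fps_const c) c"
  unfolding lead_def by (rule bexI[of _ 0]) (auto intro: delta_polys.zero)

lemma lead_0: "lead 0 0" and lead_1: "lead 1 1"
  using lead_const[of 0] lead_const[of 1] by simp_all

lemma lead_delta: "f \<in> delta_polys \<Longrightarrow> lead (delta * f) 0"
  unfolding lead_def by auto

lemma lead_add: "lead f c \<Longrightarrow> lead g d \<Longrightarrow> lead (f + g) (c + d)"
  unfolding lead_def
proof (elim bexE)
  fix f' g' assume "f' \<in> delta_polys" "g' \<in> delta_polys" "f = fps_const c + delta * f'" "g = fps_const d + delta * g'"
  then show "\<exists>h\<in>delta_polys. f + g = fps_const (c + d) + delta * h"
    by (intro bexI[of _ "f' + g'"]) (auto simp: algebra_simps simp flip: fps_const_add)
qed

lemma lead_mult: "lead f c \<Longrightarrow> lead g d \<Longrightarrow> lead (f * g) (c * d)"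
proof -
  assume f: "lead f c" and g: "lead g d"
  from f g obtain f' g' where f': "f' \<in> delta_polys" "f = fps_const c + delta * f'"
    and g': "g' \<in> delta_polys" "g = fps_const d + delta * g'"
    unfolding lead_def by auto
  have "f * g = fps_const (c * d) + delta * (fps_const c * g' + f' * g)"
    by (simp add: f' g' algebra_simps)
  then show ?thesis unfolding lead_def
    using f' g' lead_delta_polys[OF g] by (intro bexI[of _ "fps_const c * g' + f' * g"]) auto
qed

lemma lead_scale: "lead f c \<Longrightarrow> lead (fps_const a * f) (a * c)"
  by (intro lead_mult lead_const)

lemma lead_diff: "lead f c \<Longrightarrow> lead g d \<Longrightarrow> lead (f - g) (c - d)"
  using lead_add[of f c "fps_const (-1) * g" "- 1 * d"] lead_scale[of g d "-1"]
  by (simp flip: fps_const_neg)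

lemma lead_sum:
  "(\<And>x. x \<in> A \<Longrightarrow> lead (f x) (c x)) \<Longrightarrow> lead (sum f A) (sum c A)"
  by (induction A rule: infinite_finite_induct) (auto intro: lead_add lead_0)

lemma lead_X_square: "lead (fps_X ^ 2) (1 / 4)"
proof -
  have "fps_const 4 * fps_X ^ 2 = (1 - delta * delta :: real fps)"
    using delta_square by (simp add: power2_eq_square numeral_fps_const)
  then have "fps_const (1/4) * (fps_const 4 * fps_X ^ 2) = fps_const (1/4) * (1 - delta * delta :: real fps)"
    by simp
  then have "fps_X ^ 2 = fps_const (1/4) * (1 - delta * delta :: real fps)"
    by (simp add: mult.assoc[symmetric])
  moreover have "lead (fps_const (1/4) * (1 - delta * delta :: real fps)) (1/4 * (1 - 0))"
    by (intro lead_scale lead_diff lead_1 lead_delta) auto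
  ultimately show ?thesis by simp
qed

text \<open>
  Since \<open>delta * euler delta = delta\<^sup>2 - 1\<close>, the Euler operator raises the pole order by two and multiplies the leading coefficient by \<open>p\<close>.
\<close>

lemma lead_euler:
  assumes "lead (delta ^ p * f) c"
  shows "lead (delta ^ (p + 2) * euler f) (real p * c)"
proof -
  let ?u = "delta ^ p * f"
  have "delta * euler (delta ^ p) = fps_const (real p) * delta ^ p * euler delta"
  proof (cases p)
    case (Suc m)
    have "fps_deriv (delta ^ p) = fps_const (real p) * fps_deriv delta * delta ^ m"
      using fps_deriv_power[of delta p] Suc by simp
    then show ?thesis by (simp only: Suc power_Suc mult_ac)
  qed simp
  then have e: "delta * (delta * euler (delta ^ p)) = fps_const (real p) * delta ^ p * (delta ^ 2 - 1)"
    by (simp only: mult_ac flip: euler_delta)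
  have "delta ^ 2 * euler ?u = delta * (delta * euler (delta ^ p)) * f + delta ^ (p + 2) * euler f"
    by (simp add: power2_eq_square power_add algebra_simps)
  then have "delta ^ (p + 2) * euler f
      = delta ^ 2 * euler ?u - fps_const (real p) * delta ^ p * (delta ^ 2 - 1) * f"
    unfolding e by (simp only: eq_diff_eq add_ac)
  then have "delta ^ (p + 2) * euler f
      = delta * (delta * euler ?u) + fps_const (real p) * ((1 - delta * delta) * ?u)"
    by (simp only:) (simp add: power2_eq_square algebra_simps)
  moreover have "lead \<dots> (0 + real p * ((1 - 0) * c))"
    using lead_delta_polys[OF assms]
    by (intro lead_add lead_scale lead_mult lead_diff lead_1 lead_delta assms delta_polys_euler) auto
  ultimately show ?thesis by simp
qed

text \<open>
  Here \<open>G\<close> is a polynomial in the scaled height \<open>h * delta\<close>, and \<open>Q\<close> is its limit for \<open>delta\<close> tending to 0.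
\<close>

definition leadp :: "real fps poly \<Rightarrow> real poly \<Rightarrow> bool" where
  "leadp G Q \<longleftrightarrow> (\<forall>i. lead (coeff G i) (coeff Q i))"

lemma leadp_0: "leadp 0 0"
  by (simp add: leadp_def lead_0)

lemma leadp_pCons: "leadp (pCons a G) (pCons b Q) \<longleftrightarrow> lead a b \<and> leadp G Q"
proof
  assume "leadp (pCons a G) (pCons b Q)"
  then have "lead (coeff (pCons a G) i) (coeff (pCons b Q) i)" for i by (simp add: leadp_def)
  from this[of 0] this[of "Suc _"] show "lead a b \<and> leadp G Q" by (simp add: leadp_def)
next
  assume "lead a b \<and> leadp G Q"
  then show "leadp (pCons a G) (pCons b Q)"
    by (auto simp: leadp_def coeff_pCons split: nat.split)
qed

lemma leadp_add: "leadp G Q \<Longrightarrow> leadp H R \<Longrightarrow> leadp (G + H) (Q + R)"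
  by (simp add: leadp_def lead_add)

lemma leadp_smult: "lead c a \<Longrightarrow> leadp G Q \<Longrightarrow> leadp (smult c G) (smult a Q)"
  by (simp add: leadp_def lead_mult)

lemma leadp_mult: "leadp G Q \<Longrightarrow> leadp H R \<Longrightarrow> leadp (G * H) (Q * R)"
  by (simp add: leadp_def coeff_mult lead_sum lead_mult)

lemma leadp_sum:
  "(\<And>x. x \<in> A \<Longrightarrow> leadp (f x) (c x)) \<Longrightarrow> leadp (sum f A) (sum c A)"
  by (induction A rule: infinite_finite_induct) (auto intro: leadp_add leadp_0)

text \<open>
  One unit of height is \<open>delta\<close> in the scaled variable.
\<close>

definition step_shift :: "real fps poly \<Rightarrow> real fps poly" where
  "step_shift G = pcompose G [:delta, 1:]"

definition deg_below :: "'a::zero poly \<Rightarrow> nat \<Rightarrow> bool" where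
  "deg_below G n \<longleftrightarrow> (\<forall>i\<ge>n. coeff G i = 0)"

lemma deg_below_0_iff [simp]: "deg_below G 0 \<longleftrightarrow> G = 0"
  by (auto simp: deg_below_def poly_eq_iff)

lemma deg_below_pCons_Suc [simp]: "deg_below (pCons a G) (Suc n) \<longleftrightarrow> deg_below G n"
  unfolding deg_below_def by (metis Suc_le_D Suc_le_mono coeff_pCons_Suc)

lemma step_shift_difference:
  assumes "leadp G Q" "deg_below G n" "deg_below Q n"
  shows "leadp (step_shift G) Q \<and> deg_below (step_shift G) n \<and>
    (\<exists>D. step_shift G - G = smult delta D \<and> leadp D (pderiv Q) \<and> deg_below D (n - 1) \<and> deg_below (pderiv Q) (n - 1))"
  using assms
proof (induction n arbitrary: G Q)
  case 0
  then show ?case by (auto simp: step_shift_def leadp_0 intro!: exI[of _ 0])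
next
  case (Suc n)
  obtain a G' where G: "G = pCons a G'" by (cases G)
  obtain b Q' where Q: "Q = pCons b Q'" by (cases Q)
  have l: "lead a b" "leadp G' Q'" and bd: "deg_below G' n" "deg_below Q' n"
    using Suc.prems by (auto simp: G Q leadp_pCons)
  from Suc.IH[OF l(2) bd] obtain D where IH: "leadp (step_shift G') Q'" "deg_below (step_shift G') n"
    and D: "step_shift G' - G' = smult delta D" "leadp D (pderiv Q')" "deg_below D (n - 1)" "deg_below (pderiv Q') (n - 1)"
    by auto
  have s: "step_shift G = pCons a (step_shift G') + smult delta (step_shift G')"
    by (simp add: step_shift_def G pcompose_pCons)
  have sd: "leadp (smult delta (step_shift G')) 0"
    using leadp_smult[OF lead_delta[of 1] IH(1)] delta_polys_const[of 1] by simp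
  have "leadp (step_shift G) (Q + 0)"
    unfolding s Q by (intro leadp_add sd) (simp add: leadp_pCons l IH)
  moreover have "deg_below (step_shift G) (Suc n)"
    using IH(2) unfolding s deg_below_def by (auto simp: coeff_pCons split: nat.split)
  moreover have "step_shift G - G = smult delta (step_shift G' + pCons 0 D)"
    using D(1) unfolding s unfolding G by (simp add: smult_add_right algebra_simps)
  moreover have "leadp (step_shift G' + pCons 0 D) (pderiv Q)"
    unfolding Q pderiv_pCons by (intro leadp_add IH) (simp add: leadp_pCons D lead_0)
  moreover have "deg_below (step_shift G' + pCons 0 D) n"
    using IH(2) D(3) unfolding deg_below_def by (auto simp: coeff_pCons split: nat.split)
  moreover have "deg_below (pderiv Q) n"
    using bd D(4) unfolding Q pderiv_pCons deg_below_def by (auto simp: coeff_pCons split: nat.split)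
  ultimately show ?case by auto
qed

text \<open>
  To leading order the difference equation is \<open>q - q' / 2 = r\<close>. Its polynomial solution is a Neumann series that ends because each difference
  lowers the degree.
\<close>

lemma solve_difference:
  assumes "leadp R r" "deg_below R n" "deg_below r n" "q - smult (1 / 2) (pderiv q) = r" "lead c (1 / 2)"
  shows "\<exists>G D. leadp G q \<and> step_shift G - G = smult delta D \<and> G - smult c D = R"
  using assms
proof (induction n arbitrary: R r q)
  case 0
  have "q = 0"
  proof (rule ccontr)
    assume "q \<noteq> 0"
    have e: "q = smult (1 / 2) (pderiv q)" using 0 by simp
    then have "degree q = degree (pderiv q)" by (metis degree_smult_eq zero_neq_one divide_eq_0_iff one_neq_zero zero_neq_numeral)
    then have "degree q = 0" by (simp add: degree_pderiv)
    then have "pderiv q = 0" by (simp add: pderiv_eq_0_iff)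
    with e \<open>q \<noteq> 0\<close> show False by simp
  qed
  then show ?case using 0 by (intro exI[of _ 0]) (auto simp: leadp_0 step_shift_def)
next
  case (Suc n)
  obtain D where D: "step_shift R - R = smult delta D" "leadp D (pderiv r)" "deg_below D n" "deg_below (pderiv r) n"
    using step_shift_difference[of R r "Suc n"] Suc.prems by auto
  have 1: "leadp (smult c D) (smult (1 / 2) (pderiv r))"
    using Suc.prems D by (intro leadp_smult) auto
  have 2: "deg_below (smult c D) n" "deg_below (smult (1 / 2) (pderiv r)) n"
    using D by (auto simp: deg_below_def)
  have qr: "q - r = smult (1 / 2) (pderiv q)" using Suc.prems(4) by (simp add: algebra_simps)
  have "smult (1 / 2) (pderiv r) = smult (1 / 2) (pderiv q) - smult (1 / 2) (pderiv (smult (1 / 2) (pderiv q)))"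
    by (subst Suc.prems(4)[symmetric]) (simp add: pderiv_diff smult_diff_right)
  then have "(q - r) - smult (1 / 2) (pderiv (q - r)) = smult (1 / 2) (pderiv r)"
    by (simp only: qr)
  from Suc.IH[OF 1 2 this Suc.prems(5)] obtain G D' where
    G: "leadp G (q - r)" "step_shift G - G = smult delta D'" "G - smult c D' = smult c D" by blast
  have "leadp (R + G) (r + (q - r))" using G Suc.prems by (intro leadp_add)
  moreover have "step_shift (R + G) - (R + G) = smult delta (D + D')"
    using D(1) G(2) by (simp add: step_shift_def pcompose_add smult_add_right algebra_simps)
  moreover have "R + G - smult c (D + D') = R"
    using G(3) by (simp add: smult_add_right algebra_simps)
  ultimately show ?case by (intro exI[of _ "R + G"] exI[of _ "D + D'"]) simp
qed

section \<open>Leading coefficients of the arch moments\<close>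

text \<open>
  The series in \<open>x\<close> that is the coefficient of \<open>\<sigma> ^ j * \<alpha> ^ k\<close>. In the nested power series the outermost variable is \<open>x\<close>, followed by \<open>\<alpha>\<close> and \<open>\<sigma>\<close>.
\<close>

definition mom :: "real fps fps fps \<Rightarrow> nat \<Rightarrow> nat \<Rightarrow> real fps" where
  "mom F j k = Abs_fps (\<lambda>N. fps_nth (fps_nth (fps_nth F N) k) j)"

lemma mom_add [simp]: "mom (F + G) j k = mom F j k + mom G j k"
  and mom_diff [simp]: "mom (F - G) j k = mom F j k - mom G j k"
  and mom_1 [simp]: "mom 1 j k = (if j = 0 \<and> k = 0 then 1 else 0)"
  and mom_euler [simp]: "mom (euler F) j k = euler (mom F j k)"
  and mom_X_square: "mom (fps_X ^ 2 * fps_const c) j k = fps_X ^ 2 * fps_const (fps_nth (fps_nth c k) j)"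
proof -
  have of_nat: "fps_nth (fps_nth (of_nat a * f) k) j = of_nat a * fps_nth (fps_nth f k) j"
    for a and f :: "real fps fps"
    by (induction a) (simp_all add: distrib_right)
  have X: "fps_nth (of_nat a * f) i = of_nat a * fps_nth f i" for a i and f :: "real fps"
    by (induction a) (simp_all add: distrib_right)
  show "mom (F + G) j k = mom F j k + mom G j k" "mom (F - G) j k = mom F j k - mom G j k"
    "mom 1 j k = (if j = 0 \<and> k = 0 then 1 else 0)"
    "mom (fps_X ^ 2 * fps_const c) j k = fps_X ^ 2 * fps_const (fps_nth (fps_nth c k) j)"
    by (simp_all add: mom_def fps_eq_iff fps_X_power_mult_nth)
  show "mom (euler F) j k = euler (mom F j k)"
    by (auto simp: mom_def fps_eq_iff of_nat simp del: of_nat_Suc)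
qed

lemma mom_mult:
  "mom (F * G) j k = (\<Sum>(a, b)\<in>{..j} \<times> {..k}. mom F a b * mom G (j - a) (k - b))"
proof (rule fps_ext)
  fix N
  let ?t = "\<lambda>i b a. fps_nth (fps_nth (fps_nth F i) b) a
      * fps_nth (fps_nth (fps_nth G (N - i)) (k - b)) (j - a)"
  have "fps_nth (mom (F * G) j k) N = (\<Sum>i\<le>N. \<Sum>b\<le>k. \<Sum>a\<le>j. ?t i b a)"
    by (simp add: mom_def fps_mult_nth fps_sum_nth atLeast0AtMost)
  also have "\<dots> = (\<Sum>i\<le>N. \<Sum>a\<le>j. \<Sum>b\<le>k. ?t i b a)"
    by (intro sum.cong refl sum.swap)
  also have "\<dots> = (\<Sum>a\<le>j. \<Sum>i\<le>N. \<Sum>b\<le>k. ?t i b a)"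
    by (rule sum.swap)
  also have "\<dots> = (\<Sum>a\<le>j. \<Sum>b\<le>k. \<Sum>i\<le>N. ?t i b a)"
    by (intro sum.cong refl sum.swap)
  also have "\<dots> = fps_nth (\<Sum>(a, b)\<in>{..j} \<times> {..k}. mom F a b * mom G (j - a) (k - b)) N"
    by (simp add: mom_def fps_mult_nth fps_sum_nth atLeast0AtMost flip: sum.cartesian_product)
  finally show "fps_nth (mom (F * G) j k) N
    = fps_nth (\<Sum>(a, b)\<in>{..j} \<times> {..k}. mom F a b * mom G (j - a) (k - b)) N" .
qed

text \<open>
  The element \<open>exp (\<sigma> * S + \<alpha> * A)\<close>.
\<close>

definition exp_weight :: "real \<Rightarrow> real \<Rightarrow> real fps fps" where
  "exp_weight S A = Abs_fps (\<lambda>k. fps_const (A ^ k / fact k) * fps_exp S)"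

lemma exp_weight_nth: "fps_nth (fps_nth (exp_weight S A) k) j = S ^ j / fact j * (A ^ k / fact k)"
  by (simp add: exp_weight_def mult_ac)

lemma exp_weight_0 [simp]: "exp_weight 0 0 = 1"
  by (auto simp: fps_eq_iff exp_weight_nth power_0_left)

lemma exp_weight_mult: "exp_weight S A * exp_weight S' A' = exp_weight (S + S') (A + A')"
proof (rule fps_ext)
  fix k
  have "(\<Sum>i\<le>k. (A ^ i / fact i) * (A' ^ (k - i) / fact (k - i))) = fps_nth (fps_exp A * fps_exp A') k"
    by (simp add: fps_mult_nth atLeast0AtMost)
  then have A: "(\<Sum>i\<le>k. (A ^ i / fact i) * (A' ^ (k - i) / fact (k - i))) = (A + A') ^ k / fact k"
    by (simp add: fps_exp_add_mult[symmetric])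
  have "fps_nth (exp_weight S A * exp_weight S' A') k
      = (\<Sum>i\<le>k. fps_const ((A ^ i / fact i) * (A' ^ (k - i) / fact (k - i))) * fps_exp (S + S'))"
    unfolding fps_mult_nth exp_weight_def fps_nth_Abs_fps fps_exp_add_mult atLeast0AtMost
    by (intro sum.cong refl) (simp only: mult_ac flip: fps_const_mult)
  also have "\<dots> = fps_const (\<Sum>i\<le>k. (A ^ i / fact i) * (A' ^ (k - i) / fact (k - i))) * fps_exp (S + S')"
    unfolding sum_distrib_right[symmetric]
    by (rule arg_cong[where f = "\<lambda>f. f * fps_exp (S + S')"]) (simp add: fps_eq_iff fps_sum_nth)
  finally show "fps_nth (exp_weight S A * exp_weight S' A') k = fps_nth (exp_weight (S + S') (A + A')) k"
    unfolding A by (simp only: exp_weight_def fps_nth_Abs_fps)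
qed

definition height_weight :: "nat \<Rightarrow> real fps fps" where
  "height_weight h = exp_weight (real h) (real h ^ 2)"

lemma height_weight_0 [simp]: "height_weight 0 = 1"
  by (simp add: height_weight_def)

abbreviation arch_mom :: "nat \<Rightarrow> nat \<Rightarrow> nat \<Rightarrow> real fps" where
  "arch_mom i \<equiv> mom (arch height_weight i)"

text \<open>
  The terms of a Cauchy product in which neither factor has the indices \<open>(0, 0)\<close>.
\<close>

abbreviation splittings :: "nat \<Rightarrow> nat \<Rightarrow> (nat \<times> nat) set" where
  "splittings j k \<equiv> {..j} \<times> {..k} - {(0, 0), (j, k)}"

text \<open>
  The unweighted arch series, which does not depend on the height.
\<close>

definition flat_arch :: "real fps" where "flat_arch = fps_const (1 / 2) * (1 - delta)"

lemma arch_mom_eq: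
  "arch_mom i j k - (\<Sum>(a, b)\<in>{..j} \<times> {..k}. arch_mom i a b * arch_mom (Suc i) (j - a) (k - b))
    = fps_X ^ 2 * fps_const ((2 * real i + 1) ^ j / fact j * ((2 * real i ^ 2 + 2 * real i + 1) ^ k / fact k))"
proof -
  have "arch height_weight i - arch height_weight i * arch height_weight (Suc i)
      = fps_X ^ 2 * fps_const (height_weight (Suc i) * height_weight i)"
    using arch_eq[of height_weight i] by (simp add: algebra_simps)
  then have "mom (arch height_weight i - arch height_weight i * arch height_weight (Suc i)) j k
      = mom (fps_X ^ 2 * fps_const (height_weight (Suc i) * height_weight i)) j k" by simp
  moreover have "height_weight (Suc i) * height_weight i = exp_weight (2 * real i + 1) (2 * real i ^ 2 + 2 * real i + 1)"
    unfolding height_weight_def exp_weight_mult by (simp add: algebra_simps power2_eq_square)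
  ultimately show ?thesis
    by (simp only: mom_diff mom_X_square exp_weight_nth mom_mult[of "arch height_weight i"])
qed

lemma delta_eq_flat_arch: "delta = 1 - 2 * flat_arch"
proof -
  have "fps_const 2 * flat_arch = 1 - delta"
    by (simp add: flat_arch_def mult.assoc[symmetric])
  then show ?thesis by (simp add: numeral_fps_const)
qed

lemma flat_arch_nth_0 [simp]: "fps_nth flat_arch 0 = 0"
  by (simp add: flat_arch_def)

lemma lead_flat_arch: "lead flat_arch (1 / 2)"
proof -
  have "lead (fps_const (1 / 2) * (1 - delta * 1)) (1 / 2 * (1 - 0))"
    by (intro lead_scale lead_diff lead_1 lead_delta lead_delta_polys[OF lead_1])
  then show ?thesis by (simp add: flat_arch_def)
qed

lemma arch_mom_0_0: "arch_mom i 0 0 = flat_arch"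
proof -
  have E: "arch_mom i 0 0 - arch_mom i 0 0 * arch_mom (Suc i) 0 0 = fps_X ^ 2" for i
    using arch_mom_eq[of i 0 0] by simp
  have "(1 - 2 * flat_arch) ^ 2 = 1 - 4 * fps_X ^ 2"
    using delta_square unfolding delta_eq_flat_arch .
  then have "4 * (flat_arch - flat_arch * flat_arch) = 4 * fps_X ^ 2"
    by (simp add: power2_eq_square algebra_simps)
  then have A: "flat_arch - flat_arch * flat_arch = fps_X ^ 2"
    by (rule mult_left_cancel[THEN iffD1, rotated]) simp
  have z: "fps_nth (arch_mom i 0 0) 0 = 0" for i by (simp add: mom_def)
  have "arch_mom i 0 0 - flat_arch = 0"
  proof (rule fps_system_zero[where d = "\<lambda>i. arch_mom i 0 0 - flat_arch"
        and a = "\<lambda>i. arch_mom (Suc i) 0 0" and b = "\<lambda>_. flat_arch"])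
    fix i
    have "arch_mom i 0 0 - arch_mom i 0 0 * arch_mom (Suc i) 0 0 = flat_arch - flat_arch * flat_arch"
      by (simp only: E A)
    then show "arch_mom i 0 0 - flat_arch = arch_mom (Suc i) 0 0 * (arch_mom i 0 0 - flat_arch)
        + flat_arch * (arch_mom (Suc i) 0 0 - flat_arch)"
      by (simp add: algebra_simps)
  qed (simp_all add: z)
  then show ?thesis by simp
qed

lemma arch_mom_step:
  assumes "(j, k) \<noteq> (0, 0)"
  shows "(1 - flat_arch) * arch_mom i j k - flat_arch * arch_mom (Suc i) j k
    = (\<Sum>(a, b)\<in>splittings j k. arch_mom i a b * arch_mom (Suc i) (j - a) (k - b))
     + fps_X ^ 2 * fps_const ((2 * real i + 1) ^ j / fact j * ((2 * real i ^ 2 + 2 * real i + 1) ^ k / fact k))"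
proof -
  let ?f = "\<lambda>(a, b). arch_mom i a b * arch_mom (Suc i) (j - a) (k - b)"
  have "sum ?f ({..j} \<times> {..k}) = sum ?f (splittings j k) + sum ?f {(0, 0), (j, k)}"
    using assms by (subst sum.subset_diff[of "{(0, 0), (j, k)}"]) auto
  also have "sum ?f {(0, 0), (j, k)} = flat_arch * arch_mom (Suc i) j k + arch_mom i j k * flat_arch"
    using assms by (subst sum.insert) (auto simp: arch_mom_0_0)
  finally show ?thesis using arch_mom_eq[of i j k] by (simp add: algebra_simps)
qed

text \<open>
  The weight of the first and last step of an arch; it reaches the leading order only for these two index pairs.
\<close>

definition riccati_source :: "nat \<Rightarrow> nat \<Rightarrow> real poly" where
  "riccati_source j k = (if (j, k) = (1, 0) then [:0, 1 / 2:] else if (j, k) = (0, 1) then [:0, 0, 1 / 2:] else 0)"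

lemma leadp_1: "leadp 1 1"
  by (simp add: one_pCons leadp_pCons lead_1 leadp_0)

lemma leadp_power: "leadp G Q \<Longrightarrow> leadp (G ^ n) (Q ^ n)"
  by (induction n) (auto intro: leadp_mult leadp_1)

lemma leadp_riccati_source:
  assumes "(j, k) \<noteq> (0, 0)"
  shows "leadp (smult (fps_X ^ 2 * (delta ^ (2 * j + 2 * k - 2) * fps_const (1 / (fact j * fact k))))
      ([:delta, 2:] ^ j * [:delta ^ 2, 2 * delta, 2:] ^ k)) (riccati_source j k)"
proof -
  let ?e = "2 * j + 2 * k - 2" and ?P = "[:0, 2:] ^ j * [:0, 0, 2:] ^ k :: real poly"
  let ?c = "if ?e = 0 then 1 else 0 :: real"
  have two: "lead 2 2" using lead_const[of 2] by (simp add: numeral_fps_const)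
  have d: "lead delta 0" "lead (delta ^ 2) 0" "lead (2 * delta) 0"
    using lead_delta[of 1] lead_delta[of delta] lead_delta[of 2] lead_delta_polys[OF lead_1]
      lead_delta_polys[OF two]
    by (auto simp: power2_eq_square mult.commute)
  have e: "lead (delta ^ ?e) ?c"
  proof (cases ?e)
    case (Suc m) then show ?thesis using lead_delta[of "delta ^ m"] by auto
  qed (simp add: lead_1)
  have "leadp (smult (fps_X ^ 2 * (delta ^ ?e * fps_const (1 / (fact j * fact k))))
      ([:delta, 2:] ^ j * [:delta ^ 2, 2 * delta, 2:] ^ k))
     (smult (1 / 4 * (?c * (1 / (fact j * fact k)))) ?P)"
    by (intro leadp_smult leadp_mult leadp_power lead_mult lead_X_square e lead_const)
      (simp_all add: leadp_pCons leadp_0 two d)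
  also have "smult (1 / 4 * (?c * (1 / (fact j * fact k)))) ?P = riccati_source j k"
  proof (cases "?e = 0")
    case True
    then have "(j = 1 \<and> k = 0) \<or> (j = 0 \<and> k = 1)" using assms by auto
    then show ?thesis by (auto simp: riccati_source_def)
  next
    case False then show ?thesis by (auto simp: riccati_source_def)
  qed
  finally show ?thesis .
qed

lemma deg_below_mono: "deg_below G n \<Longrightarrow> n \<le> m \<Longrightarrow> deg_below G m"
  by (auto simp: deg_below_def)

lemma deg_below_degree: "deg_below G (Suc (degree G))"
  by (simp add: deg_below_def coeff_eq_0)

text \<open>
  Marking heights by \<open>\<sigma>\<close> and squared heights by \<open>\<alpha>\<close>, the coefficient of index \<open>(j, k)\<close> has pole order \<open>3 * j + 4 * k - 1\<close>: a unit of length counts as two poles and a unit of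
  height as one. In the scaled height \<open>i * delta\<close> the recursion for arches turns into a Riccati equation whose solution is the family \<open>q\<close>. The exact difference equation at
  index \<open>(j, k)\<close> is linear with inhomogeneity given by smaller indices, has a polynomial solution of the required form, and has no other solution.
\<close>

theorem arch_moments_lead:
  fixes q :: "nat \<Rightarrow> nat \<Rightarrow> real poly"
  assumes q: "\<And>j k. (j, k) \<noteq> (0, 0) \<Longrightarrow> j + 2 * k \<le> d \<Longrightarrow>
      q j k - smult (1 / 2) (pderiv (q j k))
        = (\<Sum>(a, b)\<in>splittings j k. q a b * q (j - a) (k - b)) + riccati_source j k"
  shows "(j, k) \<noteq> (0, 0) \<Longrightarrow> j + 2 * k \<le> d \<Longrightarrow>
     \<exists>G. leadp G (q j k) \<and> (\<forall>i. delta ^ (3 * j + 4 * k - 1) * arch_mom i j k = poly G (of_nat i * delta))"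
proof (induction "j + k" arbitrary: j k rule: less_induct)
  case less
  let ?p = "\<lambda>j k. 3 * j + 4 * k - 1 :: nat"
  have "\<exists>G. leadp G (q a b) \<and> (\<forall>i. delta ^ ?p a b * arch_mom i a b = poly G (of_nat i * delta))"
    if "(a, b) \<in> splittings j k" for a b
    using that less.prems by (intro less.hyps) auto
  then obtain G where G: "\<And>a b. (a, b) \<in> splittings j k \<Longrightarrow> leadp (G a b) (q a b)"
     "\<And>a b i. (a, b) \<in> splittings j k \<Longrightarrow> delta ^ ?p a b * arch_mom i a b = poly (G a b) (of_nat i * delta)"
    by metis
  have compl: "(j - a, k - b) \<in> splittings j k" if "(a, b) \<in> splittings j k" for a b
    using that by auto
  have step_shift_poly: "poly (step_shift G) (of_nat i * delta) = poly G (of_nat (Suc i) * delta)" for G i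
    by (simp add: step_shift_def poly_pcompose algebra_simps)
  have step_shift_lead: "leadp (step_shift G) Q" if "leadp G Q" for G Q
    using step_shift_difference[OF that, of "max (Suc (degree G)) (Suc (degree Q))"]
      deg_below_mono[OF deg_below_degree] by (meson max.cobounded1 max.cobounded2)
  \<comment> \<open>\<open>T\<close> is the source term: \<open>delta * (2 * i + 1)\<close> and \<open>delta\<^sup>2 * (2 * i\<^sup>2 + 2 * i + 1)\<close> are polynomials in \<open>i * delta\<close>\<close>
  define T where "T = smult (fps_X ^ 2 * (delta ^ (2 * j + 2 * k - 2) * fps_const (1 / (fact j * fact k))))
      ([:delta, 2:] ^ j * [:delta ^ 2, 2 * delta, 2:] ^ k)"
  define R where "R = (\<Sum>(a, b)\<in>splittings j k. G a b * step_shift (G (j - a) (k - b))) + T"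
  define r where "r = (\<Sum>(a, b)\<in>splittings j k. q a b * q (j - a) (k - b)) + riccati_source j k"
  have "leadp R r"
    unfolding R_def r_def T_def
    by (intro leadp_add leadp_sum leadp_riccati_source less.prems)
      (auto intro!: leadp_mult G step_shift_lead)
  then obtain H D where H: "leadp H (q j k)" "step_shift H - H = smult delta D" "H - smult flat_arch D = R"
    using solve_difference[of R r "max (Suc (degree R)) (Suc (degree r))" "q j k" flat_arch]
      deg_below_mono[OF deg_below_degree] q[OF less.prems] lead_flat_arch
    unfolding r_def by (meson max.cobounded1 max.cobounded2)
  have R: "poly R (of_nat i * delta) = delta ^ (?p j k - 1) *
      ((1 - flat_arch) * arch_mom i j k - flat_arch * arch_mom (Suc i) j k)" for i
  proof -
    let ?\<eta> = "of_nat i * delta"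
    have 1: "poly (G a b * step_shift (G (j - a) (k - b))) ?\<eta>
        = delta ^ (?p j k - 1) * (arch_mom i a b * arch_mom (Suc i) (j - a) (k - b))"
      if ab: "(a, b) \<in> splittings j k" for a b
    proof -
      have "a \<le> j" "b \<le> k" "?p a b + ?p (j - a) (k - b) = ?p j k - 1"
        using ab less.prems by auto
      then have "delta ^ (?p j k - 1) = delta ^ ?p a b * delta ^ ?p (j - a) (k - b)"
        by (metis power_add)
      then show ?thesis
        unfolding poly_mult step_shift_poly G(2)[OF ab, symmetric] G(2)[OF compl[OF ab], symmetric]
        by (simp only: mult_ac)
    qed
    have e: "?p j k - 1 = (2 * j + 2 * k - 2) + (j + 2 * k)" using less.prems by auto
    have c: "fps_const ((2 * real i + 1) ^ j / fact j * ((2 * real i ^ 2 + 2 * real i + 1) ^ k / fact k))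
       = fps_const (1 / (fact j * fact k)) * ((2 * of_nat i + 1) ^ j * (2 * of_nat i ^ 2 + 2 * of_nat i + 1) ^ k)"
      by (simp add: fps_of_nat[symmetric] numeral_fps_const fps_const_power flip: fps_const_1_eq_1)
    have "poly T ?\<eta> = fps_X ^ 2 * (delta ^ (2 * j + 2 * k - 2) * fps_const (1 / (fact j * fact k)))
        * ((delta * (2 * of_nat i + 1)) ^ j * (delta ^ 2 * (2 * of_nat i ^ 2 + 2 * of_nat i + 1)) ^ k)"
      by (simp add: T_def algebra_simps power2_eq_square)
    also have "\<dots> = delta ^ (?p j k - 1) * (fps_X ^ 2 *
        fps_const ((2 * real i + 1) ^ j / fact j * ((2 * real i ^ 2 + 2 * real i + 1) ^ k / fact k)))"
      unfolding e c power_mult_distrib power_add power_mult by (simp only: mult_ac)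
    finally have T: "poly T ?\<eta> = delta ^ (?p j k - 1) * (fps_X ^ 2 *
        fps_const ((2 * real i + 1) ^ j / fact j * ((2 * real i ^ 2 + 2 * real i + 1) ^ k / fact k)))" .
    have S: "poly (\<Sum>(a, b)\<in>splittings j k. G a b * step_shift (G (j - a) (k - b))) ?\<eta>
       = delta ^ (?p j k - 1) *
         (\<Sum>(a, b)\<in>splittings j k. arch_mom i a b * arch_mom (Suc i) (j - a) (k - b))"
      unfolding poly_sum sum_distrib_left
    proof (rule sum.cong[OF refl])
      fix x assume "x \<in> splittings j k"
      then show "poly (case x of (a, b) \<Rightarrow> G a b * step_shift (G (j - a) (k - b))) ?\<eta>
         = delta ^ (?p j k - 1) * (case x of (a, b) \<Rightarrow> arch_mom i a b * arch_mom (Suc i) (j - a) (k - b))"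
        using 1[of "fst x" "snd x"] by (cases x) simp
    qed
    show ?thesis
      unfolding R_def poly_add T S arch_mom_step[OF less.prems(1)] by (simp only: distrib_left)
  qed
  define y where "y i = poly H (of_nat i * delta)" for i
  have step: "(1 - flat_arch) * y i - flat_arch * y (Suc i) = delta * poly R (of_nat i * delta)" for i
  proof -
    have "y (Suc i) - y i = delta * poly D (of_nat i * delta)"
      using arg_cong[OF H(2), of "\<lambda>P. poly P (of_nat i * delta)"] by (simp only: y_def poly_diff step_shift_poly poly_smult)
    moreover have "y i - flat_arch * poly D (of_nat i * delta) = poly R (of_nat i * delta)"
      using arg_cong[OF H(3), of "\<lambda>P. poly P (of_nat i * delta)"] by (simp only: y_def poly_diff poly_smult)
    ultimately have "delta * poly R (of_nat i * delta) = delta * y i - flat_arch * (y (Suc i) - y i)"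
      by (simp only: right_diff_distrib mult_ac) (simp add: algebra_simps)
    then show ?thesis unfolding delta_eq_flat_arch by (simp add: algebra_simps)
  qed
  have "delta ^ ?p j k * arch_mom i j k - y i = 0" for i
  proof (rule fps_system_zero)
    fix i
    have p: "delta ^ ?p j k = delta * delta ^ (?p j k - 1)"
      using less.prems by (cases "?p j k") auto
    show "delta ^ ?p j k * arch_mom i j k - y i = flat_arch * (delta ^ ?p j k * arch_mom i j k - y i)
       + flat_arch * (delta ^ ?p j k * arch_mom (Suc i) j k - y (Suc i))"
      using step[of i] unfolding R p by (simp add: algebra_simps)
  qed simp_all
  then show ?case using H(1) by (intro exI[of _ H]) (simp add: y_def)
qed

section \<open>Leading coefficients of the loop moments\<close>

corollary arch_mom_lead:
  fixes q :: "nat \<Rightarrow> nat \<Rightarrow> real poly"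
  assumes q: "\<And>j k. (j, k) \<noteq> (0, 0) \<Longrightarrow> j + 2 * k \<le> d \<Longrightarrow>
      q j k - smult (1 / 2) (pderiv (q j k))
        = (\<Sum>(a, b)\<in>splittings j k. q a b * q (j - a) (k - b)) + riccati_source j k"
    and "(j, k) \<noteq> (0, 0)" "j + 2 * k \<le> d"
  shows "lead (delta ^ (3 * j + 4 * k - 1) * arch_mom 0 j k) (coeff (q j k) 0)"
proof -
  obtain G where "leadp G (q j k)"
    "\<forall>i. delta ^ (3 * j + 4 * k - 1) * arch_mom i j k = poly G (of_nat i * delta)"
    using arch_moments_lead[of d q j k] assms by blast
  then show ?thesis by (simp add: poly_0_coeff_0 leadp_def)
qed

abbreviation loop_mom :: "nat \<Rightarrow> nat \<Rightarrow> real fps" where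
  "loop_mom \<equiv> mom (loop_series height_weight)"

text \<open>
  The recursion for \<open>z\<close> is the leading order of the identity \<open>loop_series_eq\<close>, where dividing by \<open>1 - 2 * flat_arch = delta\<close> adds a pole.
\<close>

theorem loop_mom_lead:
  fixes q :: "nat \<Rightarrow> nat \<Rightarrow> real poly" and z :: "nat \<Rightarrow> nat \<Rightarrow> real"
  assumes q: "\<And>j k. (j, k) \<noteq> (0, 0) \<Longrightarrow> j + 2 * k \<le> d \<Longrightarrow>
      q j k - smult (1 / 2) (pderiv (q j k))
        = (\<Sum>(a, b)\<in>splittings j k. q a b * q (j - a) (k - b)) + riccati_source j k"
    and z0: "z 0 0 = 1"
    and z: "\<And>j k. (j, k) \<noteq> (0, 0) \<Longrightarrow> j + 2 * k \<le> d \<Longrightarrow>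
      z j k = 2 * (real (3 * j + 4 * k - 1) * coeff (q j k) 0)
        + 2 * (\<Sum>(a, b)\<in>{..j} \<times> {..k} - {(j, k)}. z a b * coeff (q (j - a) (k - b)) 0)"
  shows "j + 2 * k \<le> d \<Longrightarrow> lead (delta ^ (3 * j + 4 * k + 2) * loop_mom j k) (z j k)"
proof (induction "j + k" arbitrary: j k rule: less_induct)
  case less
  have E: "(\<Sum>(a, b)\<in>{..j} \<times> {..k}. loop_mom a b * mom (1 - 2 * arch height_weight 0) (j - a) (k - b))
    = mom (1 + 2 * euler (arch height_weight 0) - 2 * arch height_weight 0) j k" for j k
    unfolding mom_mult[symmetric] by (subst loop_series_eq) simp_all
  have two: "mom (2 * F) j k = 2 * mom F j k" for F j k by (simp only: mult_2 mom_add)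
  show ?case
  proof (cases "(j, k) = (0, 0)")
    case True
    have "2 * euler flat_arch = - euler delta"
      unfolding delta_eq_flat_arch by (simp add: algebra_simps)
    then have e: "1 + 2 * euler flat_arch - 2 * flat_arch = delta - euler delta"
      by (simp add: delta_eq_flat_arch)
    have "loop_mom 0 0 * mom (1 - 2 * arch height_weight 0) 0 0
        = mom (1 + 2 * euler (arch height_weight 0) - 2 * arch height_weight 0) 0 0"
      using E[of 0 0] by (simp only: atMost_0) simp
    then have "loop_mom 0 0 * (1 - 2 * flat_arch) = 1 + 2 * euler flat_arch - 2 * flat_arch"
      unfolding mom_diff mom_add two mom_euler arch_mom_0_0 mom_1 by (simp only: simp_thms if_True)
    then have "loop_mom 0 0 * delta = delta - euler delta"
      unfolding e delta_eq_flat_arch[symmetric] .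
    then have "delta * (loop_mom 0 0 * delta) = delta * delta - delta * euler delta"
      by (simp add: right_diff_distrib)
    then have "delta * delta * loop_mom 0 0 = 1"
      unfolding euler_delta by (simp add: power2_eq_square mult_ac)
    then show ?thesis using True z0 lead_1 by simp
  next
    case False
    define p where "p = 3 * j + 4 * k - 1"
    have p: "3 * j + 4 * k + 2 = p + 3" using False by (auto simp: p_def)
    let ?A = "{..j} \<times> {..k} - {(j, k)}"
    let ?f = "\<lambda>(a, b). loop_mom a b * mom (1 - 2 * arch height_weight 0) (j - a) (k - b)"
    have "sum ?f ({..j} \<times> {..k}) = sum ?f ?A + loop_mom j k * delta"
      by (subst sum.subset_diff[of "{(j, k)}"]) (auto simp: mom_diff two arch_mom_0_0 delta_eq_flat_arch)
    also have "sum ?f ?A = (\<Sum>(a, b)\<in>?A. - (2 * (loop_mom a b * arch_mom 0 (j - a) (k - b))))"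
    proof (rule sum.cong[OF refl])
      fix x assume "x \<in> ?A"
      then show "?f x = (case x of (a, b) \<Rightarrow> - (2 * (loop_mom a b * arch_mom 0 (j - a) (k - b))))"
        by (cases x) (auto simp: mom_diff two)
    qed
    also have "\<dots> = - (2 * (\<Sum>(a, b)\<in>?A. loop_mom a b * arch_mom 0 (j - a) (k - b)))"
      by (simp add: sum_distrib_left sum_negf split_def)
    finally have "- (2 * (\<Sum>(a, b)\<in>?A. loop_mom a b * arch_mom 0 (j - a) (k - b))) + loop_mom j k * delta
        = mom (1 + 2 * euler (arch height_weight 0) - 2 * arch height_weight 0) j k"
      using E[of j k] by (simp only:)
    moreover have "mom (1 + 2 * euler (arch height_weight 0) - 2 * arch height_weight 0) j k
        = 2 * euler (arch_mom 0 j k) - 2 * arch_mom 0 j k"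
      unfolding mom_diff mom_add two mom_euler using False by (simp only: mom_1) simp
    ultimately have L: "loop_mom j k * delta = 2 * (\<Sum>(a, b)\<in>?A. loop_mom a b * arch_mom 0 (j - a) (k - b))
        + 2 * euler (arch_mom 0 j k) - 2 * arch_mom 0 j k"
      by (metis (no_types, lifting) add_diff_eq minus_add_cancel)
    have ab: "delta ^ (p + 2) * (loop_mom a b * arch_mom 0 (j - a) (k - b))
       = (delta ^ (3 * a + 4 * b + 2) * loop_mom a b)
        * (delta ^ (3 * (j - a) + 4 * (k - b) - 1) * arch_mom 0 (j - a) (k - b))"
      if "(a, b) \<in> ?A" for a b
    proof -
      have "p + 2 = (3 * a + 4 * b + 2) + (3 * (j - a) + 4 * (k - b) - 1)"
        using that False by (auto simp: p_def)
      then show ?thesis by (simp only: power_add mult_ac)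
    qed
    have "delta ^ (p + 3) * loop_mom j k = delta ^ (p + 2) * (loop_mom j k * delta)"
      by (simp add: power_add eval_nat_numeral mult_ac)
    also have "\<dots> = fps_const 2 * (\<Sum>(a, b)\<in>?A. delta ^ (p + 2) * (loop_mom a b * arch_mom 0 (j - a) (k - b)))
        + fps_const 2 * (delta ^ (p + 2) * euler (arch_mom 0 j k))
        - fps_const 2 * (delta ^ (p + 2) * arch_mom 0 j k)"
      unfolding L by (simp add: distrib_left right_diff_distrib sum_distrib_left split_def mult_ac numeral_fps_const)
    also have "(\<Sum>(a, b)\<in>?A. delta ^ (p + 2) * (loop_mom a b * arch_mom 0 (j - a) (k - b)))
       = (\<Sum>(a, b)\<in>?A. (delta ^ (3 * a + 4 * b + 2) * loop_mom a b)
        * (delta ^ (3 * (j - a) + 4 * (k - b) - 1) * arch_mom 0 (j - a) (k - b)))"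
    proof (rule sum.cong[OF refl])
      fix x assume "x \<in> ?A"
      then show "(case x of (a, b) \<Rightarrow> delta ^ (p + 2) * (loop_mom a b * arch_mom 0 (j - a) (k - b)))
        = (case x of (a, b) \<Rightarrow> (delta ^ (3 * a + 4 * b + 2) * loop_mom a b)
          * (delta ^ (3 * (j - a) + 4 * (k - b) - 1) * arch_mom 0 (j - a) (k - b)))"
        by (cases x) (simp only: prod.case ab)
    qed
    finally have eq: "delta ^ (p + 3) * loop_mom j k
      = fps_const 2 * (\<Sum>(a, b)\<in>?A. (delta ^ (3 * a + 4 * b + 2) * loop_mom a b)
          * (delta ^ (3 * (j - a) + 4 * (k - b) - 1) * arch_mom 0 (j - a) (k - b)))
        + fps_const 2 * (delta ^ (p + 2) * euler (arch_mom 0 j k))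
        - fps_const 2 * (delta ^ (p + 2) * arch_mom 0 j k)" .
    have arch: "lead (delta ^ p * arch_mom 0 j k) (coeff (q j k) 0)"
      unfolding p_def using q False less.prems by (intro arch_mom_lead)
    have sum: "lead (\<Sum>(a, b)\<in>?A. (delta ^ (3 * a + 4 * b + 2) * loop_mom a b)
        * (delta ^ (3 * (j - a) + 4 * (k - b) - 1) * arch_mom 0 (j - a) (k - b)))
        (\<Sum>(a, b)\<in>?A. z a b * coeff (q (j - a) (k - b)) 0)"
    proof (rule lead_sum)
      fix x assume "x \<in> ?A"
      then obtain a b where x: "x = (a, b)" and ab: "a \<le> j" "b \<le> k" "(a, b) \<noteq> (j, k)" by auto
      have "lead (delta ^ (3 * a + 4 * b + 2) * loop_mom a b *
          (delta ^ (3 * (j - a) + 4 * (k - b) - 1) * arch_mom 0 (j - a) (k - b)))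
          (z a b * coeff (q (j - a) (k - b)) 0)"
        using ab less.prems q by (intro lead_mult less.hyps arch_mom_lead[of d q]) auto
      then show "lead (case x of (a, b) \<Rightarrow> delta ^ (3 * a + 4 * b + 2) * loop_mom a b *
            (delta ^ (3 * (j - a) + 4 * (k - b) - 1) * arch_mom 0 (j - a) (k - b)))
          (case x of (a, b) \<Rightarrow> z a b * coeff (q (j - a) (k - b)) 0)"
        by (simp only: x prod.case)
    qed
    have "delta ^ (p + 2) * arch_mom 0 j k = delta * (delta * (delta ^ p * arch_mom 0 j k))"
      by (simp add: power_add power2_eq_square mult_ac)
    then have low: "lead (delta ^ (p + 2) * arch_mom 0 j k) 0"
      using lead_delta[OF delta_polys_times_delta[OF lead_delta_polys[OF arch]]] by (simp only:)
    have "lead (delta ^ (p + 3) * loop_mom j k)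
       (2 * (\<Sum>(a, b)\<in>?A. z a b * coeff (q (j - a) (k - b)) 0) + 2 * (real p * coeff (q j k) 0) - 2 * 0)"
      unfolding eq by (intro lead_add lead_diff lead_scale sum lead_euler arch low)
    then show ?thesis using z[OF False less.prems] unfolding p by (simp add: p_def add.commute)
  qed
qed

section \<open>Loop moments and walks\<close>

lemma path_weight_walks:
  "path_weight height_weight N i j = (\<Sum>w\<in>walks N. if i + sum_list w = j
     then exp_weight (of_int (pos_sum abs i w)) (of_int (pos_sum power2 i w)) else 0)"
proof (induction N arbitrary: i)
  case (Suc N)
  have s: "height_weight (nat \<bar>i + s\<bar>) * path_weight height_weight N (i + s) j = (\<Sum>w\<in>walks N. if i + sum_list (s # w) = j
     then exp_weight (of_int (pos_sum abs i (s # w))) (of_int (pos_sum power2 i (s # w))) else 0)" for s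
    unfolding Suc.IH sum_distrib_left
  proof (rule sum.cong[OF refl])
    fix w
    have "real (nat \<bar>i + s\<bar>) = of_int \<bar>i + s\<bar>" "of_int \<bar>i + s\<bar> ^ 2 = (of_int ((i + s) ^ 2) :: real)" by simp_all
    then have "height_weight (nat \<bar>i + s\<bar>) = exp_weight (of_int \<bar>i + s\<bar>) (of_int ((i + s) ^ 2))"
      by (simp only: height_weight_def)
    then show "height_weight (nat \<bar>i + s\<bar>) * (if i + s + sum_list w = j
        then exp_weight (of_int (pos_sum abs (i + s) w)) (of_int (pos_sum power2 (i + s) w)) else 0)
      = (if i + sum_list (s # w) = j
     then exp_weight (of_int (pos_sum abs i (s # w))) (of_int (pos_sum power2 i (s # w))) else 0)"
      by (simp add: exp_weight_mult add.assoc)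
  qed
  show ?case using s[of 1] s[of "-1"] by (simp add: sum_walks_Suc)
qed (simp add: walks_0)

text \<open>
  A walk of displacement \<open>2 * h\<close> is counted as a path from \<open>- h\<close> to \<open>h\<close>.
\<close>

lemma loop_series_walks:
  "fps_nth (loop_series height_weight) (2 * n) = (\<Sum>w\<in>walks (2 * n). exp_weight (of_int (area w)) (of_int (square_sum w)))"
proof -
  let ?H = "{- int (2 * n)..int (2 * n)}"
  have "fps_nth (loop_series height_weight) (2 * n) = (\<Sum>w\<in>walks (2 * n). \<Sum>h\<in>?H. if - h + sum_list w = h
     then exp_weight (of_int (pos_sum abs (- h) w)) (of_int (pos_sum power2 (- h) w)) else 0)"
    unfolding loop_series_def fps_nth_Abs_fps path_weight_walks by (rule sum.swap)
  also have "\<dots> = (\<Sum>w\<in>walks (2 * n). exp_weight (of_int (area w)) (of_int (square_sum w)))"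
  proof (rule sum.cong[OF refl])
    fix w assume w: "w \<in> walks (2 * n)"
    then have "even (sum_list w)" using even_sum_walk by fastforce
    then have iff: "- h + sum_list w = h \<longleftrightarrow> h = sum_list w div 2" for h by auto
    have "sum_list w div 2 \<in> ?H" using abs_sum_walk[OF w] by auto
    then show "(\<Sum>h\<in>?H. if - h + sum_list w = h
        then exp_weight (of_int (pos_sum abs (- h) w)) (of_int (pos_sum power2 (- h) w)) else 0)
      = exp_weight (of_int (area w)) (of_int (square_sum w))"
      unfolding iff by (simp add: sum.delta area_def square_sum_def)
  qed
  finally show ?thesis .
qed

lemma loop_mom_walks:
  "fps_nth (loop_mom j k) (2 * n)
     = (\<Sum>w\<in>walks (2 * n). real_of_int (area w) ^ j * real_of_int (square_sum w) ^ k) / (fact j * fact k)"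
  unfolding mom_def fps_nth_Abs_fps loop_series_walks by (simp add: fps_sum_nth exp_weight_nth sum_divide_distrib)

section \<open>The numerical solution of the recursions\<close>

text \<open>
  The solution of the Riccati recursion for \<open>j + 2 * k \<le> 6\<close>. Given the right-hand side \<open>r\<close>, each entry is \<open>r + r' / 2 + r'' / 4 + \<dots>\<close>.
\<close>

definition profile :: "nat \<Rightarrow> nat \<Rightarrow> real poly" where
  "profile j k =
   [[0,
      [:1 / 4, 1 / 2:],
      [:5 / 16, 1 / 2, 1 / 4:],
      [:15 / 16, 25 / 16, 1, 1 / 4:],
      [:1105 / 256, 15 / 2, 175 / 32, 2, 5 / 16:],
      [:1695 / 64, 12155 / 256, 75 / 2, 525 / 32, 4, 7 / 16:],
      [:414125 / 2048, 11865 / 32, 158015 / 512, 150, 5775 / 128, 8, 21 / 32:]],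
    [[:1 / 4, 1 / 2, 1 / 2:],
      [:9 / 8, 2, 3 / 2, 1 / 2:],
      [:221 / 32, 99 / 8, 155 / 16, 4, 3 / 4:],
      [:1695 / 32, 1547 / 16, 159 / 2, 595 / 16, 10, 5 / 4:],
      [:248475 / 512, 28815 / 32, 196911 / 256, 390, 1995 / 16, 24, 35 / 16:]],
    [[:19 / 16, 9 / 4, 2, 1, 1 / 4:],
      [:153 / 8, 575 / 16, 63 / 2, 65 / 4, 5, 3 / 4:],
      [:34503 / 128, 8145 / 16, 14457 / 32, 243, 2695 / 32, 18, 15 / 8:]],
    [[:631 / 32, 153 / 4, 575 / 16, 21, 65 / 8, 2, 1 / 4:]]] ! k ! j"

text \<open>
  The leading coefficients of the loop moments, computed from the constant terms of \<open>profile\<close>.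
\<close>

definition loop_const :: "nat \<Rightarrow> nat \<Rightarrow> real" where
  "loop_const j k =
   [[1, 3 / 2, 9 / 2, 321 / 16, 477 / 4, 227349 / 256, 254529 / 32],
    [2, 35 / 2, 615 / 4, 12077 / 8, 33513 / 2],
    [20, 7161 / 16, 31983 / 4],
    [488]] ! k ! j"

lemma atMost_numerals:
  "{..0::nat} = {0}" "{..Suc 0} = {0, Suc 0}" "{..2::nat} = {0, Suc 0, 2}" "{..3::nat} = {0, Suc 0, 2, 3}"
  "{..4::nat} = {0, Suc 0, 2, 3, 4}" "{..5::nat} = {0, Suc 0, 2, 3, 4, 5}" "{..6::nat} = {0, Suc 0, 2, 3, 4, 5, 6}"
  by auto

lemma sum_grid: "sum f ({..j} \<times> {..k}) = (\<Sum>a\<le>j. \<Sum>b\<le>k. f (a, b))"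
  by (simp add: sum.cartesian_product)

lemma grid_cases:
  assumes "j + 2 * k \<le> (6::nat)"
  shows "(j, k) \<in> {(0, 0), (1, 0), (2, 0), (3, 0), (4, 0), (5, 0), (6, 0),
    (0, 1), (1, 1), (2, 1), (3, 1), (4, 1), (0, 2), (1, 2), (2, 2), (0, 3)}"
proof -
  have "k = 0 \<or> k = 1 \<or> k = 2 \<or> k = 3" using assms by arith
  moreover have "j = 0 \<or> j = 1 \<or> j = 2 \<or> j = 3 \<or> j = 4 \<or> j = 5 \<or> j = 6" using assms by arith
  ultimately show ?thesis using assms by (elim disjE) simp_all
qed

lemma profile_eq:
  assumes jk: "(j, k) \<noteq> (0, 0)" "j + 2 * k \<le> 6"
  shows "profile j k - smult (1 / 2) (pderiv (profile j k))
        = (\<Sum>(a, b)\<in>splittings j k. profile a b * profile (j - a) (k - b)) + riccati_source j k"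
proof -
  let ?f = "\<lambda>(a, b). profile a b * profile (j - a) (k - b)"
  have p0: "profile 0 0 = 0" by (simp add: profile_def)
  have "sum ?f (splittings j k) = sum ?f ({..j} \<times> {..k})"
    by (rule sum.mono_neutral_left) (auto simp: p0)
  moreover have "profile j k - smult (1 / 2) (pderiv (profile j k)) = sum ?f ({..j} \<times> {..k}) + riccati_source j k"
    using grid_cases[OF jk(2)] jk(1)
    by (elim insertE) (simp_all add: sum_grid profile_def riccati_source_def atMost_numerals pderiv_pCons)
  ultimately show ?thesis by simp
qed

lemma loop_const_eq:
  assumes jk: "(j, k) \<noteq> (0, 0)" "j + 2 * k \<le> 6"
  shows "loop_const j k = 2 * (real (3 * j + 4 * k - 1) * coeff (profile j k) 0)
        + 2 * (\<Sum>(a, b)\<in>{..j} \<times> {..k} - {(j, k)}. loop_const a b * coeff (profile (j - a) (k - b)) 0)"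
proof -
  let ?f = "\<lambda>(a, b). loop_const a b * coeff (profile (j - a) (k - b)) 0"
  have p0: "profile 0 0 = 0" by (simp add: profile_def)
  have "sum ?f ({..j} \<times> {..k} - {(j, k)}) = sum ?f ({..j} \<times> {..k})"
    by (rule sum.mono_neutral_left) (auto simp: p0)
  moreover have "loop_const j k = 2 * (real (3 * j + 4 * k - 1) * coeff (profile j k) 0)
      + 2 * sum ?f ({..j} \<times> {..k})"
    using grid_cases[OF jk(2)] jk(1)
    by (elim insertE) (simp_all add: sum_grid profile_def loop_const_def atMost_numerals)
  ultimately show ?thesis by simp
qed

section \<open>Coefficient asymptotics\<close>

text \<open>
  The coefficients are binomial, so the limit is the product formula for the reciprocal Gamma function; this covers half-integral exponents of both signs.
\<close>

lemma delta_pow_coeff_asymp: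
  "(\<lambda>n. fps_nth (delta_pow (- r)) (2 * n) / 4 ^ n / real n powr (r / 2 - 1)) \<longlonglongrightarrow> rGamma (r / 2)"
proof -
  have "(\<lambda>n. rGamma_series (r / 2) n * (real n / (r / 2 + real n))) \<longlonglongrightarrow> rGamma (r / 2) * 1"
    by (intro tendsto_mult rGamma_series_LIMSEQ) real_asymp
  moreover have "\<forall>\<^sub>F n in sequentially. rGamma_series (r / 2) n * (real n / (r / 2 + real n))
      = fps_nth (delta_pow (- r)) (2 * n) / 4 ^ n / real n powr (r / 2 - 1)"
  proof -
    have "\<forall>\<^sub>F n in sequentially. n > nat \<lceil>\<bar>r\<bar>\<rceil>" by (rule eventually_gt_at_top)
    then show ?thesis
    proof eventually_elim
      case (elim n)
      then have n: "real n > 0" "r / 2 + real n > 0" by linarith+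
      have "exp (r / 2 * ln (real n)) = real n powr (r / 2 - 1) * real n"
        using n(1) by (simp add: powr_def left_diff_distrib exp_diff)
      then show ?case
        using n by (simp add: rGamma_series_def delta_pow_coeff pochhammer_Suc)
    qed
  qed
  ultimately show ?thesis by (simp add: tendsto_cong)
qed

lemma delta_pow_coeff_negligible:
  assumes "r < R"
  shows "(\<lambda>n. fps_nth (delta_pow (- r)) (2 * n) / 4 ^ n / real n powr (R / 2 - 1)) \<longlonglongrightarrow> 0"
proof -
  have lim: "(\<lambda>n. fps_nth (delta_pow (- r)) (2 * n) / 4 ^ n / real n powr (r / 2 - 1) * real n powr ((r - R) / 2))
     \<longlonglongrightarrow> rGamma (r / 2) * 0"
  proof (intro tendsto_mult delta_pow_coeff_asymp)
    show "(\<lambda>n. real n powr ((r - R) / 2)) \<longlonglongrightarrow> 0"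
      using assms by (intro tendsto_neg_powr filterlim_real_sequentially) auto
  qed
  have e: "a / real n powr (r / 2 - 1) * real n powr ((r - R) / 2) = a / real n powr (R / 2 - 1)" for a n
  proof -
    have "r / 2 - 1 = (r - R) / 2 + (R / 2 - 1)" by (simp add: diff_divide_distrib)
    then have "real n powr (r / 2 - 1) = real n powr ((r - R) / 2) * real n powr (R / 2 - 1)"
      by (simp only: powr_add)
    then show ?thesis by (cases "n = 0") simp_all
  qed
  show ?thesis using lim by (simp only: e mult_zero_right)
qed

lemma delta_polys_coeff_negligible:
  assumes "g \<in> delta_polys" "r < R"
  shows "(\<lambda>n. fps_nth (delta_pow (- r) * g) (2 * n) / 4 ^ n / real n powr (R / 2 - 1)) \<longlonglongrightarrow> 0"
  using assms
proof (induction arbitrary: r rule: delta_polys.induct)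
  case (step g c)
  have "delta_pow (- r) * (fps_const c + delta * g)
     = fps_const c * delta_pow (- r) + delta_pow (- (r - 1)) * g"
    using delta_pow_add[of "- r" 1] by (simp add: algebra_simps)
  moreover have "(\<lambda>n. c * (fps_nth (delta_pow (- r)) (2 * n) / 4 ^ n / real n powr (R / 2 - 1))
     + fps_nth (delta_pow (- (r - 1)) * g) (2 * n) / 4 ^ n / real n powr (R / 2 - 1)) \<longlonglongrightarrow> c * 0 + 0"
    using step.prems by (intro tendsto_add tendsto_mult tendsto_const delta_pow_coeff_negligible step.IH) auto
  ultimately show ?case by (simp add: add_divide_distrib)
qed simp

theorem lead_coeff_asymp:
  assumes "lead (delta ^ p * f) c"
  shows "(\<lambda>n. fps_nth f (2 * n) / 4 ^ n / real n powr (real p / 2 - 1)) \<longlonglongrightarrow> c * rGamma (real p / 2)"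
proof -
  obtain g where g: "g \<in> delta_polys" "delta ^ p * f = fps_const c + delta * g"
    using assms unfolding lead_def by auto
  have 1: "delta_pow (- real p) * delta ^ p = 1"
    using delta_pow_add[of "- real p" "real p"] by (simp add: delta_pow_of_nat)
  have "f = delta_pow (- real p) * (delta ^ p * f)"
    by (simp only: mult.assoc[symmetric] 1 mult_1_left)
  also have "\<dots> = fps_const c * delta_pow (- real p) + delta_pow (- (real p - 1)) * g"
    unfolding g(2) using delta_pow_add[of "- real p" 1] by (simp add: algebra_simps)
  finally have f: "f = fps_const c * delta_pow (- real p) + delta_pow (- (real p - 1)) * g" .
  have "(\<lambda>n. c * (fps_nth (delta_pow (- real p)) (2 * n) / 4 ^ n / real n powr (real p / 2 - 1))
     + fps_nth (delta_pow (- (real p - 1)) * g) (2 * n) / 4 ^ n / real n powr (real p / 2 - 1))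
     \<longlonglongrightarrow> c * rGamma (real p / 2) + 0"
    by (intro tendsto_add tendsto_mult tendsto_const delta_pow_coeff_asymp delta_polys_coeff_negligible g) auto
  then show ?thesis by (subst f) (simp add: add_divide_distrib)
qed

section \<open>The limit of the moments\<close>

definition avg :: "nat \<Rightarrow> (int list \<Rightarrow> real) \<Rightarrow> real" where
  "avg n f = (\<Sum>w\<in>walks (2 * n). f w) / 4 ^ n"

lemma avg_add: "avg n (\<lambda>w. f w + g w) = avg n f + avg n g"
  and avg_diff: "avg n (\<lambda>w. f w - g w) = avg n f - avg n g"
  and avg_scale: "avg n (\<lambda>w. c * f w) = c * avg n f"
  by (simp_all add: avg_def sum.distrib sum_subtractf sum_distrib_left add_divide_distrib diff_divide_distrib)

lemma avg_1: "avg n (\<lambda>w. 1) = 1"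
  by (simp add: avg_def card_walks power_mult)

lemma avg_mono: "(\<And>w. w \<in> walks (2 * n) \<Longrightarrow> f w \<le> g w) \<Longrightarrow> avg n f \<le> avg n g"
  by (simp add: avg_def divide_right_mono sum_mono)

lemma abs_avg_le: "\<bar>avg n f\<bar> \<le> avg n (\<lambda>w. \<bar>f w\<bar>)"
  by (simp add: avg_def divide_right_mono sum_abs)

definition scaled_squares :: "nat \<Rightarrow> int list \<Rightarrow> real" where
  "scaled_squares n w = of_int (square_sum w) / real n ^ 2"

definition scaled_area2 :: "nat \<Rightarrow> int list \<Rightarrow> real" where
  "scaled_area2 n w = of_int (area w) ^ 2 / real n ^ 3"

text \<open>
  The pole order \<open>6 * i + 4 * k + 2\<close> is even, so the Gamma values are factorials; the factors \<open>fact (2 * i) * fact k\<close> undo the exponential normalisation of the moments.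
\<close>

lemma avg_moments_limit:
  assumes "2 * i + 2 * k \<le> 6"
  shows "(\<lambda>n. avg n (\<lambda>w. scaled_area2 n w ^ i * scaled_squares n w ^ k))
    \<longlonglongrightarrow> fact (2 * i) * fact k * loop_const (2 * i) k / fact (3 * i + 2 * k)"
proof -
  let ?p = "3 * (2 * i) + 4 * k + 2"
  have "loop_const 0 0 = 1" by (simp add: loop_const_def)
  from lead_coeff_asymp[OF loop_mom_lead[of 6 profile loop_const, OF profile_eq this loop_const_eq assms]]
  have "(\<lambda>n. fact (2 * i) * fact k * (fps_nth (loop_mom (2 * i) k) (2 * n) / 4 ^ n / real n powr (real ?p / 2 - 1)))
    \<longlonglongrightarrow> fact (2 * i) * fact k * (loop_const (2 * i) k * rGamma (real ?p / 2))"
    by (intro tendsto_mult tendsto_const)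
  moreover have "real ?p / 2 = 1 + real (3 * i + 2 * k)" by simp
  then have "rGamma (real ?p / 2) = 1 / fact (3 * i + 2 * k)"
    by (simp only: rGamma_inverse_Gamma Gamma_fact) (simp add: field_simps)
  moreover have "\<forall>\<^sub>F n in sequentially. fact (2 * i) * fact k * (fps_nth (loop_mom (2 * i) k) (2 * n) / 4 ^ n / real n powr (real ?p / 2 - 1))
      = avg n (\<lambda>w. scaled_area2 n w ^ i * scaled_squares n w ^ k)"
    using eventually_gt_at_top[of 0]
  proof eventually_elim
    case (elim n)
    have e: "real ?p / 2 - 1 = real (3 * i + 2 * k)" by (simp add: add_divide_distrib)
    have "real n powr (real ?p / 2 - 1) = real n ^ (3 * i + 2 * k)"
      unfolding e by (rule powr_realpow) (use elim in simp)
    moreover have "scaled_area2 n w ^ i * scaled_squares n w ^ k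
        = real_of_int (area w) ^ (2 * i) * real_of_int (square_sum w) ^ k / real n ^ (3 * i + 2 * k)" for w
      by (simp add: scaled_area2_def scaled_squares_def power_divide power_add flip: power_mult)
    ultimately show ?case
      by (simp add: avg_def loop_mom_walks sum_divide_distrib[symmetric])
  qed
  ultimately show ?thesis by (simp add: tendsto_cong)
qed

text \<open>
  In the scaling limit this is twice the integral of the square minus the squared integral of the modulus, for the antiperiodic
  process \<open>W(t) - W(1) / 2\<close> on the unit interval.
\<close>

definition main_part :: "nat \<Rightarrow> int list \<Rightarrow> real" where
  "main_part n w = scaled_squares n w / 2 - scaled_area2 n w / 8"

lemma main_part_limits:
  "(\<lambda>n. avg n (\<lambda>w. main_part n w ^ 1)) \<longlonglongrightarrow> 5 / 16"
  "(\<lambda>n. avg n (\<lambda>w. main_part n w ^ 2)) \<longlonglongrightarrow> 1217 / 7680"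
  "(\<lambda>n. avg n (\<lambda>w. main_part n w ^ 3)) \<longlonglongrightarrow> 1601353 / 13762560"
proof -
  let ?m = "\<lambda>i k n. avg n (\<lambda>w. scaled_area2 n w ^ i * scaled_squares n w ^ k)"
  have lim: "?m 0 1 \<longlonglongrightarrow> 1" "?m 1 0 \<longlonglongrightarrow> 3 / 2"
    "?m 0 2 \<longlonglongrightarrow> 5 / 3" "?m 1 1 \<longlonglongrightarrow> 41 / 16" "?m 2 0 \<longlonglongrightarrow> 159 / 40"
    "?m 0 3 \<longlonglongrightarrow> 61 / 15" "?m 1 2 \<longlonglongrightarrow> 10661 / 1680" "?m 2 1 \<longlonglongrightarrow> 11171 / 1120"
    "?m 3 0 \<longlonglongrightarrow> 84843 / 5376"
    using avg_moments_limit[of 0 1] avg_moments_limit[of 1 0] avg_moments_limit[of 0 2] avg_moments_limit[of 1 1]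
      avg_moments_limit[of 2 0] avg_moments_limit[of 0 3] avg_moments_limit[of 1 2] avg_moments_limit[of 2 1]
      avg_moments_limit[of 3 0]
    by (simp_all add: loop_const_def fact_numeral)
  have 1: "avg n (\<lambda>w. main_part n w ^ 1) = 1 / 2 * ?m 0 1 n - 1 / 8 * ?m 1 0 n" for n
    unfolding avg_scale[symmetric] avg_diff[symmetric] by (simp add: main_part_def)
  have 2: "avg n (\<lambda>w. main_part n w ^ 2) = 1 / 4 * ?m 0 2 n - 1 / 8 * ?m 1 1 n + 1 / 64 * ?m 2 0 n" for n
    unfolding avg_scale[symmetric] avg_diff[symmetric] avg_add[symmetric]
    by (rule arg_cong[where f = "avg n"]) (simp add: main_part_def fun_eq_iff power2_eq_square algebra_simps)
  have 3: "avg n (\<lambda>w. main_part n w ^ 3)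
     = 1 / 8 * ?m 0 3 n - 3 / 32 * ?m 1 2 n + 3 / 128 * ?m 2 1 n - 1 / 512 * ?m 3 0 n" for n
    unfolding avg_scale[symmetric] avg_diff[symmetric] avg_add[symmetric]
    by (rule arg_cong[where f = "avg n"]) (simp add: main_part_def fun_eq_iff power2_eq_square power3_eq_cube algebra_simps)
  have "(\<lambda>n. 1 / 2 * ?m 0 1 n - 1 / 8 * ?m 1 0 n) \<longlonglongrightarrow> 1 / 2 * 1 - 1 / 8 * (3 / 2)"
    by (intro tendsto_intros lim)
  then show "(\<lambda>n. avg n (\<lambda>w. main_part n w ^ 1)) \<longlonglongrightarrow> 5 / 16" unfolding 1 by simp
  have "(\<lambda>n. 1 / 4 * ?m 0 2 n - 1 / 8 * ?m 1 1 n + 1 / 64 * ?m 2 0 n)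
     \<longlonglongrightarrow> 1 / 4 * (5 / 3) - 1 / 8 * (41 / 16) + 1 / 64 * (159 / 40)"
    by (intro tendsto_intros lim)
  then show "(\<lambda>n. avg n (\<lambda>w. main_part n w ^ 2)) \<longlonglongrightarrow> 1217 / 7680" unfolding 2 by simp
  have "(\<lambda>n. 1 / 8 * ?m 0 3 n - 3 / 32 * ?m 1 2 n + 3 / 128 * ?m 2 1 n - 1 / 512 * ?m 3 0 n)
     \<longlonglongrightarrow> 1 / 8 * (61 / 15) - 3 / 32 * (10661 / 1680) + 3 / 128 * (11171 / 1120) - 1 / 512 * (84843 / 5376)"
    by (intro tendsto_intros lim)
  then show "(\<lambda>n. avg n (\<lambda>w. main_part n w ^ 3)) \<longlonglongrightarrow> 1601353 / 13762560" unfolding 3 by simp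
qed

definition scaled_size :: "nat \<Rightarrow> int list \<Rightarrow> real" where
  "scaled_size n w = psize (core_of_walk n w) / real n ^ 3"

text \<open>
  By Cauchy-Schwarz, \<open>area w / n\<^sup>2\<close> is at most \<open>(1 + a) / sqrt n\<close> up to a constant, where \<open>a\<close> is the scaled sum of squares. All lower-order terms are therefore small relative to \<open>1 + a\<close>.
\<close>

lemma scaled_size_close:
  assumes n: "0 < n" and w: "w \<in> walks (2 * n)"
  shows "\<bar>scaled_size n w - main_part n w\<bar> \<le> 250 / sqrt (real n) * (1 + scaled_squares n w)"
    and "0 \<le> scaled_squares n w" and "\<bar>main_part n w\<bar> \<le> 1 + scaled_squares n w"
proof -
  let ?r = "real n" and ?a = "scaled_squares n w"
  let ?S = "real_of_int (area w)" and ?M = "real_of_int (square_sum w)"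
  have n1: "1 \<le> ?r" using n by simp
  have M0: "0 \<le> ?M" and S0: "0 \<le> ?S" using square_sum_nonneg area_nonneg by auto
  then show a0: "0 \<le> ?a" by (simp add: scaled_squares_def)
  have M: "?M = ?a * ?r ^ 2" using n by (simp add: scaled_squares_def)
  have "area w ^ 2 \<le> int (2 * n) * square_sum w" using area_square_le[of w] w by (simp add: walks_def)
  then have "real_of_int (area w ^ 2) \<le> real_of_int (int (2 * n) * square_sum w)" by (simp only: of_int_le_iff)
  then have SM: "?S ^ 2 \<le> 2 * ?r * ?M" by simp
  then have b: "scaled_area2 n w \<le> 2 * ?a"
    unfolding scaled_area2_def M using n by (simp add: field_simps power2_eq_square power3_eq_cube)
  have "0 \<le> scaled_area2 n w" by (simp add: scaled_area2_def)
  then show "\<bar>main_part n w\<bar> \<le> 1 + ?a" using b a0 by (simp add: main_part_def abs_le_iff)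
  have sq: "sqrt ?r * sqrt ?r = ?r" "1 \<le> sqrt ?r" using n1 by simp_all
  have "?S ^ 2 \<le> (?r * sqrt ?r * (1 + ?a)) ^ 2"
  proof -
    have "2 * ?a \<le> (1 + ?a) ^ 2" using a0 by (simp add: power2_eq_square algebra_simps)
    then have "?r ^ 3 * (2 * ?a) \<le> ?r ^ 3 * (1 + ?a) ^ 2" by (intro mult_left_mono) auto
    moreover have "(?r * sqrt ?r * (1 + ?a)) ^ 2 = ?r ^ 3 * (1 + ?a) ^ 2"
      using sq(1) by (simp add: power_mult_distrib power2_eq_square power3_eq_cube)
    moreover have "2 * ?r * ?M = ?r ^ 3 * (2 * ?a)" by (simp add: M power2_eq_square power3_eq_cube)
    ultimately show ?thesis using SM by simp
  qed
  then have S: "?S \<le> ?r * sqrt ?r * (1 + ?a)"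
    by (rule power2_le_imp_le) (use a0 in simp)
  have rS: "?r * ?S \<le> ?r ^ 2 * sqrt ?r * (1 + ?a)"
    using mult_left_mono[OF S, of ?r] by (simp add: power2_eq_square mult.assoc)
  have r2: "?r ^ 2 + ?M \<le> ?r ^ 2 * sqrt ?r * (1 + ?a)"
  proof -
    have "?r ^ 2 * (1 + ?a) * 1 \<le> ?r ^ 2 * (1 + ?a) * sqrt ?r" using sq(2) a0 by (intro mult_left_mono) auto
    then show ?thesis by (simp add: M algebra_simps)
  qed
  have "x \<le> 1000 * (2 * z)" if "x \<le> 1000 * (p + q + m)" "p \<le> z" "q + m \<le> z" for x p q m z :: real
    using that by (simp add: algebra_simps)
  from this[OF core_size_estimate[OF n w] rS r2]
  have "\<bar>8 * psize (core_of_walk n w) - (4 * ?r * ?M - ?S ^ 2)\<bar> \<le> 1000 * (2 * (?r ^ 2 * sqrt ?r * (1 + ?a)))" .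
  moreover have "8 * psize (core_of_walk n w) - (4 * ?r * ?M - ?S ^ 2) = 8 * ?r ^ 3 * (scaled_size n w - main_part n w)"
    using n by (simp add: scaled_size_def main_part_def scaled_squares_def scaled_area2_def field_simps power2_eq_square power3_eq_cube)
  moreover have "1000 * (2 * (?r ^ 2 * sqrt ?r * (1 + ?a))) = 8 * ?r ^ 3 * (250 / sqrt ?r * (1 + ?a))"
  proof -
    have "?r / sqrt ?r = sqrt ?r" by (rule real_div_sqrt) simp
    moreover have "?r ^ 3 * (250 / sqrt ?r) = 250 * (?r ^ 2 * (?r / sqrt ?r))"
      by (simp add: power2_eq_square power3_eq_cube)
    ultimately have "?r ^ 3 * (250 / sqrt ?r) = 250 * (?r ^ 2 * sqrt ?r)" by (simp only:)
    moreover have "8 * ?r ^ 3 * (250 / sqrt ?r * (1 + ?a)) = 8 * (?r ^ 3 * (250 / sqrt ?r)) * (1 + ?a)"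
      by (simp only: mult.assoc)
    ultimately show ?thesis by simp
  qed
  ultimately have "\<bar>8 * ?r ^ 3 * (scaled_size n w - main_part n w)\<bar> \<le> 8 * ?r ^ 3 * (250 / sqrt ?r * (1 + ?a))"
    by (simp only:)
  moreover have "\<bar>8 * ?r ^ 3 * (scaled_size n w - main_part n w)\<bar> = 8 * ?r ^ 3 * \<bar>scaled_size n w - main_part n w\<bar>"
    by (simp add: abs_mult)
  ultimately have "8 * ?r ^ 3 * \<bar>scaled_size n w - main_part n w\<bar> \<le> 8 * ?r ^ 3 * (250 / sqrt ?r * (1 + ?a))"
    by (simp only:)
  then show "\<bar>scaled_size n w - main_part n w\<bar> \<le> 250 / sqrt ?r * (1 + ?a)"
    by (rule mult_left_le_imp_le) (use n in simp)
qed

lemma abs_power_diff_le: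
  fixes x y m :: real
  assumes "\<bar>x\<bar> \<le> m" "\<bar>y\<bar> \<le> m"
  shows "\<bar>x ^ Suc j - y ^ Suc j\<bar> \<le> real (Suc j) * m ^ j * \<bar>x - y\<bar>"
proof (induction j)
  case (Suc j)
  have m: "0 \<le> m" using assms by linarith
  have "x ^ Suc (Suc j) - y ^ Suc (Suc j) = x * (x ^ Suc j - y ^ Suc j) + (x - y) * y ^ Suc j"
    by (simp add: algebra_simps)
  then have "\<bar>x ^ Suc (Suc j) - y ^ Suc (Suc j)\<bar> \<le> \<bar>x\<bar> * \<bar>x ^ Suc j - y ^ Suc j\<bar> + \<bar>x - y\<bar> * \<bar>y\<bar> ^ Suc j"
    by (metis abs_mult abs_triangle_ineq power_abs)
  also have "\<dots> \<le> m * (real (Suc j) * m ^ j * \<bar>x - y\<bar>) + \<bar>x - y\<bar> * m ^ Suc j"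
    using assms m Suc.IH by (intro add_mono mult_mono power_mono) auto
  finally show ?case by (simp add: algebra_simps)
qed simp

text \<open>
  The error in the power \<open>Suc j\<close> is at most a multiple of \<open>(1 + a) ^ 3 / sqrt n\<close>, whose average tends to 0 because the third moment of \<open>a\<close> converges.
\<close>

lemma scaled_size_moments_close:
  assumes j: "j < 3"
  shows "(\<lambda>n. avg n (\<lambda>w. scaled_size n w ^ Suc j) - avg n (\<lambda>w. main_part n w ^ Suc j)) \<longlonglongrightarrow> 0"
proof (rule tendsto_0_le)
  let ?C = "real (Suc j) * 251 ^ j * 250"
  let ?m = "\<lambda>n. avg n (\<lambda>w. 1 + (3 * (scaled_area2 n w ^ 0 * scaled_squares n w ^ 1)
       + (3 * (scaled_area2 n w ^ 0 * scaled_squares n w ^ 2) + scaled_area2 n w ^ 0 * scaled_squares n w ^ 3)))"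
  let ?b = "\<lambda>n. (1 / sqrt (real n)) * ?m n"
  have zero: "(\<lambda>n. 1 / sqrt (real n)) \<longlonglongrightarrow> 0" by real_asymp
  have "convergent ?m"
    unfolding avg_add avg_scale avg_1
    by (intro convergent_add convergent_const convergent_mult; rule convergentI, rule avg_moments_limit) auto
  then obtain L where "?m \<longlonglongrightarrow> L"
    unfolding convergent_def by blast
  from tendsto_mult[OF zero this] show "?b \<longlonglongrightarrow> 0" by (simp only: mult_zero_left)
  show "\<forall>\<^sub>F n in sequentially. norm (avg n (\<lambda>w. scaled_size n w ^ Suc j) - avg n (\<lambda>w. main_part n w ^ Suc j))
      \<le> norm (?b n) * ?C"
    using eventually_gt_at_top[of 0]
  proof eventually_elim
    case (elim n)
    have cube: "(1 + x) ^ 3 = 1 + (3 * x + (3 * x ^ 2 + x ^ 3))" for x :: real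
      by (simp add: power3_eq_cube power2_eq_square algebra_simps)
    have alg: "real (Suc j) * (251 * t) ^ j * (250 / s * t) = ?C / s * t ^ Suc j" for s t :: real
      by (simp add: power_mult_distrib)
    have abs_bounds: "\<bar>x\<bar> \<le> 251 * t \<and> \<bar>y\<bar> \<le> 251 * t"
      if "\<bar>x - y\<bar> \<le> d" "d \<le> 250 * t" "\<bar>y\<bar> \<le> t" for x y d t :: real
      using that by linarith
    have "\<bar>avg n (\<lambda>w. scaled_size n w ^ Suc j - main_part n w ^ Suc j)\<bar>
        \<le> avg n (\<lambda>w. \<bar>scaled_size n w ^ Suc j - main_part n w ^ Suc j\<bar>)" by (rule abs_avg_le)
    also have "\<dots> \<le> avg n (\<lambda>w. (?C / sqrt (real n)) * (1 + scaled_squares n w) ^ 3)"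
    proof (rule avg_mono)
      fix w assume w: "w \<in> walks (2 * n)"
      let ?a = "1 + scaled_squares n w"
      note close = scaled_size_close[OF elim w]
      have "250 / sqrt (real n) * ?a \<le> 250 * ?a"
        using elim close(2) by (intro mult_right_mono) (auto simp: divide_le_eq)
      then have x: "\<bar>scaled_size n w\<bar> \<le> 251 * ?a" and y: "\<bar>main_part n w\<bar> \<le> 251 * ?a"
        using abs_bounds[OF close(1) _ close(3)] by blast+
      have "\<bar>scaled_size n w ^ Suc j - main_part n w ^ Suc j\<bar>
         \<le> real (Suc j) * (251 * ?a) ^ j * \<bar>scaled_size n w - main_part n w\<bar>"
        by (rule abs_power_diff_le[OF x y])
      also have "\<dots> \<le> real (Suc j) * (251 * ?a) ^ j * (250 / sqrt (real n) * ?a)"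
        using close by (intro mult_left_mono) auto
      also have "\<dots> = ?C / sqrt (real n) * ?a ^ Suc j" by (rule alg)
      also have "\<dots> \<le> ?C / sqrt (real n) * ?a ^ 3"
        using close(2) j by (intro mult_left_mono power_increasing) auto
      finally show "\<bar>scaled_size n w ^ Suc j - main_part n w ^ Suc j\<bar> \<le> ?C / sqrt (real n) * ?a ^ 3" .
    qed
    also have "\<dots> = ?C * ?b n"
      unfolding avg_scale by (simp add: cube)
    also have "\<dots> = ?b n * ?C" by (rule mult.commute)
    also have "\<dots> \<le> norm (?b n) * ?C"
      unfolding real_norm_def by (rule mult_right_mono[OF abs_ge_self]) simp
    finally show ?case by (simp only: avg_diff real_norm_def)
  qed
qed

lemma scaled_size_limits:
  "(\<lambda>n. avg n (\<lambda>w. scaled_size n w ^ 1)) \<longlonglongrightarrow> 5 / 16"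
  "(\<lambda>n. avg n (\<lambda>w. scaled_size n w ^ 2)) \<longlonglongrightarrow> 1217 / 7680"
  "(\<lambda>n. avg n (\<lambda>w. scaled_size n w ^ 3)) \<longlonglongrightarrow> 1601353 / 13762560"
proof -
  have "(\<lambda>n. avg n (\<lambda>w. scaled_size n w ^ Suc j)) \<longlonglongrightarrow> L"
    if "(\<lambda>n. avg n (\<lambda>w. main_part n w ^ Suc j)) \<longlonglongrightarrow> L" "j < 3" for j L
    by (rule Lim_transform[OF that(1) scaled_size_moments_close[OF that(2)]])
  from this[of 0] this[of 1] this[of 2]
  show "(\<lambda>n. avg n (\<lambda>w. scaled_size n w ^ 1)) \<longlonglongrightarrow> 5 / 16"
    "(\<lambda>n. avg n (\<lambda>w. scaled_size n w ^ 2)) \<longlonglongrightarrow> 1217 / 7680"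
    "(\<lambda>n. avg n (\<lambda>w. scaled_size n w ^ 3)) \<longlonglongrightarrow> 1601353 / 13762560"
    using main_part_limits by (simp_all add: numeral_2_eq_2 numeral_3_eq_3)
qed

text \<open>
  Skewness is invariant under scaling, so it may be computed from the raw moments of the scaled size.
\<close>

lemma skewness_via_walks:
  assumes n: "0 < n"
  defines "e \<equiv> \<lambda>j. avg n (\<lambda>w. scaled_size n w ^ j)"
  shows "skewness (pmf_of_set (distinct_cores (2 * n + 1) (2 * n + 3))) psize
    = (e 3 - 3 * e 1 * e 2 + 2 * e 1 ^ 3) / (e 2 - e 1 ^ 2) powr (3 / 2)"
proof -
  let ?C = "distinct_cores (2 * n + 1) (2 * n + 3)" and ?r = "real n"
  let ?E = "measure_pmf.expectation (pmf_of_set ?C)"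
  have bij: "bij_betw (core_of_walk n) (walks (2 * n)) ?C" by (rule core_of_walk_bij[OF n])
  have card: "card ?C = 4 ^ n"
    using bij_betw_same_card[OF bij] by (simp add: card_walks power_mult)
  then have fin: "finite ?C" "?C \<noteq> {}" using card_ge_0_finite[of ?C] by auto
  have E: "?E (\<lambda>l. f (psize l)) = avg n (\<lambda>w. f (?r ^ 3 * scaled_size n w))" for f
  proof -
    have "?E (\<lambda>l. f (psize l)) = (\<Sum>l\<in>?C. f (psize l)) / real (card ?C)"
      using fin by (simp add: integral_pmf_of_set)
    also have "(\<Sum>l\<in>?C. f (psize l)) = (\<Sum>w\<in>walks (2 * n). f (psize (core_of_walk n w)))"
      by (rule sum.reindex_bij_betw[OF bij, symmetric])
    also have "\<dots> = (\<Sum>w\<in>walks (2 * n). f (?r ^ 3 * scaled_size n w))"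
      using n by (simp add: scaled_size_def)
    finally show ?thesis unfolding card avg_def by simp
  qed
  have mean: "?E psize = ?r ^ 3 * e 1"
    using E[of "\<lambda>x. x"] by (simp add: avg_scale e_def)
  have third: "?E (\<lambda>l. (psize l - ?r ^ 3 * e 1) ^ 3)
     = ?r ^ 9 * (e 3 - 3 * e 1 * e 2 + 2 * e 1 ^ 3)"
  proof -
    have x: "(?r ^ 3 * x - ?r ^ 3 * m) ^ 3 = ?r ^ 9 * (x ^ 3 + ((3 * m ^ 2) * x ^ 1 - (3 * m) * x ^ 2) - m ^ 3 * 1)" for x m
      by (simp add: eval_nat_numeral algebra_simps)
    have "?E (\<lambda>l. (psize l - ?r ^ 3 * e 1) ^ 3)
      = avg n (\<lambda>w. (?r ^ 3 * scaled_size n w - ?r ^ 3 * e 1) ^ 3)"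
      by (rule E)
    also have "\<dots> = ?r ^ 9 * (e 3 + ((3 * e 1 ^ 2) * e 1 - (3 * e 1) * e 2) - e 1 ^ 3 * 1)"
      unfolding x avg_scale avg_add avg_diff avg_1 e_def by (rule refl)
    finally have "?E (\<lambda>l. (psize l - ?r ^ 3 * e 1) ^ 3)
      = ?r ^ 9 * (e 3 + ((3 * e 1 ^ 2) * e 1 - (3 * e 1) * e 2) - e 1 ^ 3 * 1)" .
    then show ?thesis by (simp add: power2_eq_square power3_eq_cube algebra_simps)
  qed
  have var: "?E (\<lambda>l. (psize l - ?r ^ 3 * e 1) ^ 2)
     = ?r ^ 6 * (e 2 - e 1 ^ 2)"
  proof -
    have x: "(?r ^ 3 * x - ?r ^ 3 * m) ^ 2 = ?r ^ 6 * (x ^ 2 - (2 * m) * x ^ 1 + m ^ 2 * 1)" for x m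
      by (simp add: eval_nat_numeral algebra_simps)
    have "?E (\<lambda>l. (psize l - ?r ^ 3 * e 1) ^ 2)
      = avg n (\<lambda>w. (?r ^ 3 * scaled_size n w - ?r ^ 3 * e 1) ^ 2)"
      by (rule E)
    also have "\<dots> = ?r ^ 6 * (e 2 - (2 * e 1) * e 1 + e 1 ^ 2 * 1)"
      unfolding x avg_scale avg_add avg_diff avg_1 e_def by (rule refl)
    finally have "?E (\<lambda>l. (psize l - ?r ^ 3 * e 1) ^ 2)
      = ?r ^ 6 * (e 2 - (2 * e 1) * e 1 + e 1 ^ 2 * 1)" .
    then show ?thesis by (simp add: power2_eq_square algebra_simps)
  qed
  have "(?r ^ 6 * (e 2 - e 1 ^ 2)) powr (3 / 2) = (?r ^ 6) powr (3 / 2) * (e 2 - e 1 ^ 2) powr (3 / 2)"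
    by (rule powr_mult)
  also have "(?r ^ 6) powr (3 / 2) = ?r ^ 9"
    using n by (simp add: powr_powr flip: powr_numeral)
  finally show ?thesis
    unfolding skewness_def mean third var using n by simp
qed

theorem mainTheorem10:
  shows "(\<lambda>n::nat. skewness (pmf_of_set (distinct_cores (2 * n + 1) (2 * n + 3))) psize)
           \<longlonglongrightarrow> 396793 / 390815488 * sqrt 467 * sqrt 7680"
proof -
  define e where "e n j = avg n (\<lambda>w. scaled_size n w ^ j)" for n j
  have e: "(\<lambda>n. e n 1) \<longlonglongrightarrow> 5 / 16" "(\<lambda>n. e n 2) \<longlonglongrightarrow> 1217 / 7680" "(\<lambda>n. e n 3) \<longlonglongrightarrow> 1601353 / 13762560"
    unfolding e_def by (rule scaled_size_limits)+
  have var: "(\<lambda>n. e n 2 - e n 1 ^ 2) \<longlonglongrightarrow> 1217 / 7680 - (5 / 16) ^ 2"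
    by (intro tendsto_intros e)
  have lim: "(\<lambda>n. (e n 3 - 3 * e n 1 * e n 2 + 2 * e n 1 ^ 3) / (e n 2 - e n 1 ^ 2) powr (3 / 2))
    \<longlonglongrightarrow> (1601353 / 13762560 - 3 * (5 / 16) * (1217 / 7680) + 2 * (5 / 16) ^ 3) / (1217 / 7680 - (5 / 16) ^ 2) powr (3 / 2)"
    by (intro tendsto_intros e) (simp_all add: power2_eq_square)
  have ev: "\<forall>\<^sub>F n in sequentially. (e n 3 - 3 * e n 1 * e n 2 + 2 * e n 1 ^ 3) / (e n 2 - e n 1 ^ 2) powr (3 / 2)
     = skewness (pmf_of_set (distinct_cores (2 * n + 1) (2 * n + 3))) psize"
    using eventually_gt_at_top[of 0]
    by eventually_elim (simp only: e_def skewness_via_walks)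
  have val: "(1601353 / 13762560 - 3 * (5 / 16) * (1217 / 7680) + 2 * (5 / 16) ^ 3) / (1217 / 7680 - (5 / 16) ^ 2) powr (3 / 2)
     = 396793 / 390815488 * sqrt 467 * sqrt (7680::real)"
  proof -
    have v: "1217 / 7680 - (5 / 16) ^ 2 = 467 / (7680::real)" by (simp add: power2_eq_square)
    have "(467 / 7680) powr (3 / 2) = (467 / 7680) powr 1 * (467 / 7680 :: real) powr (1 / 2)"
      unfolding powr_add[symmetric] by simp
    also have "\<dots> = 467 / 7680 * (sqrt 467 / sqrt 7680)"
      by (simp add: powr_half_sqrt real_sqrt_divide)
    finally have p: "(467 / 7680) powr (3 / 2) = 467 / 7680 * (sqrt 467 / sqrt (7680::real))" .
    have m: "1601353 / 13762560 - 3 * (5 / 16) * (1217 / 7680) + 2 * (5 / 16) ^ 3 = 396793 / (13762560::real)"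
      by (simp add: power3_eq_cube)
    have s: "sqrt 467 * sqrt 467 = (467::real)" by simp
    have "396793 / 13762560 / (467 / 7680 * (a / b)) = 396793 / 390815488 * a * b"
      if "a * a = 467" "a \<noteq> 0" "b \<noteq> 0" for a b :: real
    proof -
      have "1 / a = a / 467" using that by (simp add: field_simps)
      have "396793 / 13762560 / (467 / 7680 * (a / b)) = 396793 / 13762560 * 7680 / 467 * b * (1 / a)"
        using that by simp
      also have "\<dots> = 396793 / 390815488 * a * b" unfolding \<open>1 / a = a / 467\<close> by simp
      finally show ?thesis .
    qed
    from this[OF s] show ?thesis unfolding v p m by simp
  qed
  show ?thesis using Lim_transform_eventually[OF lim ev] unfolding val .
qed

end
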